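(* Let $E$ be the edge set of an irreducible, aperiodic Markov chain with $r$ states and $|E|$ edges, where $|E|>r$, let $c>0$ and $\alpha>0$ be constants, and for each number of users $n$ let $m=m(n)=\lfloor c\,n^{\frac{2}{|E|-r}-\alpha}\rfloor$ be the number of observations per user. Suppose users move according to the Markov chain model on $E$ described in the context, with random transition probabilities (encoded by $\mathbf{P}_1,\mathbf{P}_2,\dots$) known to the adversary, and let $\mathbf{Y}^{(m)}$ be the anonymized observations. Then user $1$ has perfect location privacy at every time, i.e. $$\forall k\in\mathbb{N},\qquad \lim_{n\to\infty} I\big(X_1(k);\mathbf{Y}^{(m)}\,\big|\,\mathbf{P}_1,\dots,\mathbf{P}_n\big)=0 .$$
   Context: Markov chain model. There are $r$ locations (states) $1,\dots,r$ and users $u=1,2,3,\dots$. $E\subset\{1,\dots,r\}^2$ is a fixed set of directed edges, common to all users, such that the directed graph is irreducible (strongly connected) and aperiodic (the gcd of its cycle lengths is $1$). The location process $X_u(1),X_u(2),\dots$ of user $u$ is a time-homogeneous Markov chain with $X_u(1)=1$ and transition probabilities $p_u(i,j)$, where $p_u(i,j)=0$ for $(i,j)\notin E$ and $\sum_{j}p_u(i,j)=1$ for each $i$. Users differ only in the values of $p_u(i,j)$, $(i,j)\in E$. Because each row sums to $1$, the transition probabilities of a user have $d=|E|-r$ degrees of freedom. Fix a set $E_d\subset E$ of $d$ edges obtained by leaving out exactly one outgoing edge of each state, and let $\mathbf{P}_u\in\mathbb{R}^d$ be the vector of the $p_u(i,j)$ with $(i,j)\in E_d$; it determines all transition probabilities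 of user $u$. Let $R_{\mathbf{p}}\subset\mathbb{R}^d$ be the set of acceptable values of $\mathbf{P}_u$ (those for which all resulting transition probabilities, including those of the left-out edges, lie in $[0,1]$). The vectors $\mathbf{P}_u$, $u\ge1$, are drawn independently from a $d$-dimensional continuous density $f_{\mathbf{P}}$ for which there are constants $\delta_1,\delta_2>0$ with $\delta_1<f_{\mathbf{P}}(\mathbf{p})<\delta_2$ for $\mathbf{p}\in R_{\mathbf{p}}$ and $f_{\mathbf{P}}(\mathbf{p})=0$ for $\mathbf{p}\notin R_{\mathbf{p}}$. Conditionally on $(\mathbf{P}_u)_{u\ge1}$, the chains of different users are independent. Anonymization. For each $n$, $\Pi=\Pi^{(n)}$ is a uniformly random permutation of $\{1,\dots,n\}$, independent of the $\mathbf{P}_u$'s and of all the chains. Put $\mathbf{X}_u^{(m)}=(X_u(1),\dots,X_u(m))^T$. The adversary observes $$\mathbf{Y}^{(m)}=\big(\mathbf{X}^{(m)}_{\Pi^{-1}(1)},\dots,\mathbf{X}^{(m)}_{\Pi^{-1}(n)}\big),$$ so that the $\Pi(u)$-th column of $\mathbf{Y}^{(m)}$ is $\mathbf{X}_u^{(m)}$ (if $m=0$ there are no observations). $I(X;Y\mid Z)=H(X\mid Z)-H(X\mid Y,Z)$ is conditional mutual information (averaged over $Z$); conditioning on $\mathbf{P}_1,\dots,\mathbf{P}_n$ expresses that the adversary knows these vectors. *)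

theory Defs
  imports "HOL-Probability.Probability" "HOL-Combinatorics.Permutations"
begin

definition strongly_connected_on :: "'s set \<Rightarrow> 's rel \<Rightarrow> bool" where
  "strongly_connected_on S E \<longleftrightarrow> (\<forall>i\<in>S. \<forall>j\<in>S. (i, j) \<in> E\<^sup>*)"

text \<open>Cycles are closed directed walks of positive length, as in the usual definition of the period.\<close>

definition aperiodic_rel :: "'s rel \<Rightarrow> bool" where
  "aperiodic_rel E \<longleftrightarrow> Gcd {l::nat. l > 0 \<and> (\<exists>i. (i, i) \<in> E ^^ l)} = 1"

text \<open>The free coordinates \<open>Ed\<close>: exactly one outgoing edge of every state is left out.\<close>

definition free_edges :: "'s set \<Rightarrow> 's rel \<Rightarrow> 's rel \<Rightarrow> bool" where
  "free_edges S E Ed \<longleftrightarrow> Ed \<subseteq> E \<and> (\<forall>i\<in>S. \<exists>!j. (i, j) \<in> E - Ed)"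

text \<open>
  A parameter vector is an extensional function on \<open>Ed\<close>; the space of these functions
  with the product Lebesgue measure plays the role of $d$-dimensional Euclidean space,
  where $d$ is the number of free edges.
\<close>

abbreviation param_space :: "'s rel \<Rightarrow> ('s \<times> 's \<Rightarrow> real) measure" where
  "param_space Ed \<equiv> PiM Ed (\<lambda>_. lborel)"

definition trans_prob :: "'s rel \<Rightarrow> 's rel \<Rightarrow> ('s \<times> 's \<Rightarrow> real) \<Rightarrow> 's \<Rightarrow> 's \<Rightarrow> real" where
  "trans_prob E Ed p i j =
    (if (i, j) \<in> Ed then p (i, j)
     else if (i, j) \<in> E then 1 - (\<Sum>j' | (i, j') \<in> Ed. p (i, j'))
     else 0)"

definition acceptable :: "'s rel \<Rightarrow> 's rel \<Rightarrow> ('s \<times> 's \<Rightarrow> real) set" where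
  "acceptable E Ed =
    {p \<in> space (param_space Ed). \<forall>(i, j)\<in>E. trans_prob E Ed p i j \<in> {0..1}}"

lemma sum_trans_prob:
  assumes S: "finite S" "i \<in> S" and E: "E \<subseteq> S \<times> S" and Ed: "free_edges S E Ed"
  shows "(\<Sum>j\<in>S. trans_prob E Ed p i j) = 1"
proof -
  obtain j0 where j0: "(i, j0) \<in> E - Ed" and uniq: "\<And>j. (i, j) \<in> E - Ed \<Longrightarrow> j = j0"
    using Ed S unfolding free_edges_def by metis
  let ?D = "{j. (i, j) \<in> Ed}"
  have sub: "insert j0 ?D \<subseteq> S" using j0 E Ed by (auto simp: free_edges_def)
  then have fin: "finite ?D" using S by (meson finite_subset insert_subset)
  have "(\<Sum>j\<in>S. trans_prob E Ed p i j) = (\<Sum>j\<in>insert j0 ?D. trans_prob E Ed p i j)"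
    using S sub uniq by (intro sum.mono_neutral_right) (auto simp: trans_prob_def)
  also have "\<dots> = trans_prob E Ed p i j0 + (\<Sum>j\<in>?D. trans_prob E Ed p i j)"
    using fin j0 by (intro sum.insert) auto
  also have "\<dots> = 1" using j0 by (auto simp: trans_prob_def)
  finally show ?thesis .
qed

abbreviation cond_prob :: "'a measure \<Rightarrow> 'a measure \<Rightarrow> 'a set \<Rightarrow> 'a \<Rightarrow> real" where
  "cond_prob M F A \<equiv> real_cond_exp M F (indicator A)"

text \<open>
  Users, times and states are numbered from 1; values of the families at index 0 are
  unconstrained. \<open>P u\<close> is the parameter vector and \<open>X u k\<close> the location of user \<open>u\<close>
  at time \<open>k\<close>; \<open>perm n\<close> is the permutation used when there are \<open>n\<close> users.
\<close>

locale anonymized_markov_users = prob_space M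
  for M :: "'a measure" +
  fixes r :: nat and E Ed :: "nat rel"
    and f :: "(nat \<times> nat \<Rightarrow> real) \<Rightarrow> real"
    and P :: "nat \<Rightarrow> 'a \<Rightarrow> nat \<times> nat \<Rightarrow> real"
    and X :: "nat \<Rightarrow> nat \<Rightarrow> 'a \<Rightarrow> nat"
    and perm :: "nat \<Rightarrow> 'a \<Rightarrow> nat \<Rightarrow> nat"
  assumes edges: "E \<subseteq> {1..r} \<times> {1..r}"
    and free: "free_edges {1..r} E Ed"
    and density_bounds: "\<exists>\<delta>1>0. \<exists>\<delta>2>0. \<forall>p\<in>acceptable E Ed. \<delta>1 < f p \<and> f p < \<delta>2"
    and density_zero: "\<And>p. p \<in> space (param_space Ed) - acceptable E Ed \<Longrightarrow> f p = 0"
    and params_density: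
      "\<And>u. u \<ge> 1 \<Longrightarrow> distributed M (param_space Ed) (P u) (\<lambda>p. ennreal (f p))"
    and params_indep: "indep_vars (\<lambda>_. param_space Ed) P {1..}"
    and location_measurable:
      "\<And>u k. u \<ge> 1 \<Longrightarrow> k \<ge> 1 \<Longrightarrow> X u k \<in> M \<rightarrow>\<^sub>M count_space {1..r}"
    and initial: "\<And>u. u \<ge> 1 \<Longrightarrow> AE \<omega> in M. X u 1 \<omega> = 1"
    \<comment> \<open>Markov property and transition probabilities, conditionally on all parameter vectors\<close>
    and markov: "\<And>u k j. u \<ge> 1 \<Longrightarrow> k \<ge> 1 \<Longrightarrow> j \<in> {1..r} \<Longrightarrow>
      AE \<omega> in M.
        cond_prob M
          (vimage_algebra (space M)
            (\<lambda>\<omega>. (\<lambda>v\<in>{1..}. P v \<omega>, \<lambda>l\<in>{1..k}. X u l \<omega>))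
            (PiM {1..} (\<lambda>_. param_space Ed) \<Otimes>\<^sub>M PiM {1..k} (\<lambda>_. count_space {1..r})))
          {\<omega> \<in> space M. X u (k + 1) \<omega> = j} \<omega>
        = trans_prob E Ed (P u \<omega>) (X u k \<omega>) j"
    \<comment> \<open>conditional independence of the chains given all parameter vectors\<close>
    and chains_cond_indep: "\<And>J A. J \<subseteq> {1..} \<Longrightarrow> finite J \<Longrightarrow> J \<noteq> {} \<Longrightarrow>
      (\<And>u. u \<in> J \<Longrightarrow> A u \<in> sets (vimage_algebra (space M) (\<lambda>\<omega>. \<lambda>k\<in>{1..}. X u k \<omega>)
                              (PiM {1..} (\<lambda>_. count_space {1..r})))) \<Longrightarrow>
      AE \<omega> in M.
        cond_prob M (vimage_algebra (space M) (\<lambda>\<omega>. \<lambda>v\<in>{1..}. P v \<omega>)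
                      (PiM {1..} (\<lambda>_. param_space Ed))) (\<Inter>u\<in>J. A u) \<omega>
        = (\<Prod>u\<in>J. cond_prob M (vimage_algebra (space M) (\<lambda>\<omega>. \<lambda>v\<in>{1..}. P v \<omega>)
                      (PiM {1..} (\<lambda>_. param_space Ed))) (A u) \<omega>)"
    and permutation_measurable: "\<And>n. n \<ge> 1 \<Longrightarrow>
      perm n \<in> M \<rightarrow>\<^sub>M count_space {\<pi>. \<pi> permutes {1..n}}"
    and permutation_uniform: "\<And>n. n \<ge> 1 \<Longrightarrow>
      distr M (count_space {\<pi>. \<pi> permutes {1..n}}) (perm n)
        = uniform_count_measure {\<pi>. \<pi> permutes {1..n}}"
    and permutation_indep: "\<And>n. n \<ge> 1 \<Longrightarrow>
      indep_set
        (sets (vimage_algebra (space M) (perm n) (count_space {\<pi>. \<pi> permutes {1..n}})))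
        (sets (vimage_algebra (space M)
          (\<lambda>\<omega>. (\<lambda>u\<in>{1..}. P u \<omega>, \<lambda>u\<in>{1..}. \<lambda>k\<in>{1..}. X u k \<omega>))
          (PiM {1..} (\<lambda>_. param_space Ed) \<Otimes>\<^sub>M
            PiM {1..} (\<lambda>_. PiM {1..} (\<lambda>_. count_space {1..r})))))"

text \<open>The columns of the observed matrix are indexed by \<open>{1..n}\<close>, its rows by \<open>{1..m}\<close>.\<close>

definition anonymized_obs ::
  "(nat \<Rightarrow> nat \<Rightarrow> 'a \<Rightarrow> nat) \<Rightarrow> (nat \<Rightarrow> 'a \<Rightarrow> nat \<Rightarrow> nat) \<Rightarrow> nat \<Rightarrow> nat \<Rightarrow> 'a \<Rightarrow> nat \<Rightarrow> nat \<Rightarrow> nat"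
  where "anonymized_obs X perm n m \<omega> = (\<lambda>j\<in>{1..n}. \<lambda>k\<in>{1..m}. X (inv (perm n \<omega>) j) k \<omega>)"

abbreviation obs_space :: "nat \<Rightarrow> nat \<Rightarrow> nat \<Rightarrow> (nat \<Rightarrow> nat \<Rightarrow> nat) measure" where
  "obs_space r n m \<equiv> PiM {1..n} (\<lambda>_. PiM {1..m} (\<lambda>_. count_space {1..r}))"

lemma anonymized_obs_column:
  assumes "perm n \<omega> permutes {1..n}" "u \<in> {1..n}" "k \<in> {1..m}"
  shows "anonymized_obs X perm n m \<omega> (perm n \<omega> u) k = X u k \<omega>"
  using assms permutes_in_image[OF assms(1), of u]
  by (simp add: anonymized_obs_def permutes_inverses)

end

theory Submission
  imports Defs "HOL-Real_Asymp.Real_Asymp"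
begin

text \<open>
  Let \<open>Q\<close> and \<open>Q'\<close> be the conditional probabilities of \<open>X 1 k = s\<close> given the parameters, and given the
  parameters and the observations. The mutual information is a difference of expected entropies of
  \<open>Q\<close> and \<open>Q'\<close>, so it is enough that \<open>Q' - Q\<close> tends to 0 in mean square; since \<open>Q' - Q\<close> is itself a
  function of observations and parameters, this follows if the indicator of \<open>X 1 k = s\<close> minus \<open>Q\<close>
  is asymptotically uncorrelated with every such function bounded by 1.

  Split the parameter cube into cells of side \<open>n powr (\<beta> - 1 / d)\<close> for a small \<open>\<beta> > 0\<close>, and let \<open>J\<close> be the
  set of users in the cell of user 1. Because the permutation is uniform, exchanging the paths of
  user 1 and of a user in \<open>J\<close> changes the joint law of paths and observations only by the distance
  of their path laws, which a chi-square estimate bounds by a quantity of order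
  the square root of the number of observations times the side of the cell, tending to 0. Hence the indicator can be replaced
  by its average over \<open>J\<close>, which is within \<open>1 / sqrt |J|\<close> of \<open>Q\<close> in mean by independence. Finally, as the
  parameter vectors are exchangeable, the expectation of \<open>1 / |J|\<close> is at most the number of cells
  divided by \<open>n\<close>, which tends to 0.
\<close>

section \<open>Products of finite laws\<close>

text \<open>The exponent \<open>2 / d\<close> depends on gaining a square root. For cells of side
  \<eta>, adding up the errors of single transitions bounds the distance of two path laws of length
  \<open>K\<close> by a multiple of \<open>K * \<eta>\<close>, which would stop at the exponent
  \<open>1 / d\<close>. The chi-square divergence multiplies along the path, and its square root is
  of order \<open>sqrt K * \<eta>\<close>. The price is a division by transition probabilities,
  which can be arbitrarily small near the boundary of the acceptable set. Only the law of user 1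
  stands in the denominators, so it suffices to discard the event that user 1 has a transition
  probability below \<epsilon> on some edge, with \<epsilon> fixed before \<open>n\<close>. The side
  is constrained from both ends: it must exceed \<open>n powr (- 1 / d)\<close> for the cell to hold
  many users, while \<open>sqrt K\<close> times the side must vanish. The factor
  \<open>n powr (- \<alpha>)\<close> in the number of observations is the room in which \<beta> is
  chosen.\<close>

lemma sum_PiE_insert:
  fixes h :: "('i \<Rightarrow> 'y) \<Rightarrow> real"
  assumes "a \<notin> I"
  shows "(\<Sum>x\<in>PiE (insert a I) T. h x) = (\<Sum>x\<in>PiE I T. \<Sum>y\<in>T a. h (x(a := y)))"
proof -
  have "(\<Sum>x\<in>PiE (insert a I) T. h x) = (\<Sum>(y, x)\<in>T a \<times> PiE I T. h (x(a := y)))"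
    unfolding PiE_insert_eq
    using inj_combinator[OF assms, of T] by (subst sum.reindex) (auto simp: case_prod_unfold)
  also have "\<dots> = (\<Sum>x\<in>PiE I T. \<Sum>y\<in>T a. h (x(a := y)))"
    by (subst sum.cartesian_product [symmetric]) (rule sum.swap)
  finally show ?thesis .
qed

lemma sum_prod_PiE_eq_1:
  fixes a :: "'i \<Rightarrow> 'y \<Rightarrow> real"
  assumes "finite I" "finite \<Omega>" "\<And>v. v \<in> I \<Longrightarrow> (\<Sum>y\<in>\<Omega>. a v y) = 1"
  shows "(\<Sum>x\<in>I \<rightarrow>\<^sub>E \<Omega>. \<Prod>v\<in>I. a v (x v)) = 1"
  using assms by (subst prod_sum_PiE [symmetric]) (auto)

text \<open>Factors are exchanged one at a time; each exchange costs the L1 distance of that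
  coordinate, because the remaining factors have total mass 1. In the application two factors are
  transposed, so only two coordinates contribute.\<close>

lemma sum_abs_diff_prod_le:
  fixes a b :: "'i \<Rightarrow> 'y \<Rightarrow> real"
  assumes "finite I" "finite \<Omega>"
    and "\<And>v y. v \<in> I \<Longrightarrow> y \<in> \<Omega> \<Longrightarrow> 0 \<le> a v y" "\<And>v. v \<in> I \<Longrightarrow> (\<Sum>y\<in>\<Omega>. a v y) = 1"
    and "\<And>v y. v \<in> I \<Longrightarrow> y \<in> \<Omega> \<Longrightarrow> 0 \<le> b v y" "\<And>v. v \<in> I \<Longrightarrow> (\<Sum>y\<in>\<Omega>. b v y) = 1"
  shows "(\<Sum>x\<in>I \<rightarrow>\<^sub>E \<Omega>. \<bar>(\<Prod>v\<in>I. a v (x v)) - (\<Prod>v\<in>I. b v (x v))\<bar>)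
    \<le> (\<Sum>v\<in>I. \<Sum>y\<in>\<Omega>. \<bar>a v y - b v y\<bar>)"
  using assms
proof (induction I rule: finite_induct)
  case empty
  then show ?case by simp
next
  case (insert i I)
  let ?pa = "\<lambda>x. \<Prod>v\<in>I. a v (x v)" and ?pb = "\<lambda>x. \<Prod>v\<in>I. b v (x v)"
  have upd: "(\<Prod>v\<in>I. c v ((x(i := y)) v)) = (\<Prod>v\<in>I. c v (x v))" for c :: "'i \<Rightarrow> 'y \<Rightarrow> real" and x y
    using insert.hyps by (intro prod.cong) auto
  have at: "(x(i := y)) i = y" for x :: "'i \<Rightarrow> 'y" and y
    by simp
  have "(\<Sum>x\<in>insert i I \<rightarrow>\<^sub>E \<Omega>. \<bar>(\<Prod>v\<in>insert i I. a v (x v)) - (\<Prod>v\<in>insert i I. b v (x v))\<bar>)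
    = (\<Sum>x\<in>I \<rightarrow>\<^sub>E \<Omega>. \<Sum>y\<in>\<Omega>. \<bar>a i y * ?pa x - b i y * ?pb x\<bar>)"
    using insert.hyps by (subst sum_PiE_insert) (auto simp: upd at simp del: fun_upd_apply)
  also have "\<dots> \<le> (\<Sum>x\<in>I \<rightarrow>\<^sub>E \<Omega>. \<Sum>y\<in>\<Omega>. a i y * \<bar>?pa x - ?pb x\<bar> + ?pb x * \<bar>a i y - b i y\<bar>)"
  proof (intro sum_mono)
    fix x y assume xy: "x \<in> I \<rightarrow>\<^sub>E \<Omega>" "y \<in> \<Omega>"
    have nn: "0 \<le> a i y" "0 \<le> ?pb x"
      using xy insert.prems(2,4) by (auto intro!: prod_nonneg dest: PiE_mem)
    have "a i y * ?pa x - b i y * ?pb x = a i y * (?pa x - ?pb x) + ?pb x * (a i y - b i y)"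
      by (simp add: algebra_simps)
    then show "\<bar>a i y * ?pa x - b i y * ?pb x\<bar>
        \<le> a i y * \<bar>?pa x - ?pb x\<bar> + ?pb x * \<bar>a i y - b i y\<bar>"
      using nn by (metis abs_mult abs_of_nonneg abs_triangle_ineq)
  qed
  also have "\<dots> = (\<Sum>y\<in>\<Omega>. a i y) * (\<Sum>x\<in>I \<rightarrow>\<^sub>E \<Omega>. \<bar>?pa x - ?pb x\<bar>)
      + (\<Sum>x\<in>I \<rightarrow>\<^sub>E \<Omega>. ?pb x) * (\<Sum>y\<in>\<Omega>. \<bar>a i y - b i y\<bar>)"
    by (simp add: sum.distrib sum_product sum_distrib_left sum_distrib_right sum.swap[of _ \<Omega>])
  also have "\<dots> \<le> (\<Sum>v\<in>insert i I. \<Sum>y\<in>\<Omega>. \<bar>a v y - b v y\<bar>)"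
    using insert by (subst sum_prod_PiE_eq_1) auto
  finally show ?case .
qed

lemma sum_prod_PiE_mult:
  fixes a :: "'i \<Rightarrow> 'y \<Rightarrow> real"
  assumes "finite I" "finite \<Omega>"
  shows "(\<Sum>x\<in>I \<rightarrow>\<^sub>E \<Omega>. (\<Prod>v\<in>I. a v (x v)) * (\<Prod>v\<in>I. h v (x v)))
    = (\<Prod>v\<in>I. \<Sum>y\<in>\<Omega>. a v y * h v y)"
  using assms by (subst prod_sum_PiE) (auto simp: prod.distrib)

text \<open>Cross terms vanish by independence, so the variance of the sum is at most its length.\<close>

lemma sum_prod_PiE_abs_sum_le:
  fixes a h :: "'i \<Rightarrow> 'y \<Rightarrow> real"
  assumes fin: "finite I" "finite \<Omega>" and J: "J \<subseteq> I"
    and nn: "\<And>v y. v \<in> I \<Longrightarrow> y \<in> \<Omega> \<Longrightarrow> 0 \<le> a v y" and one: "\<And>v. v \<in> I \<Longrightarrow> (\<Sum>y\<in>\<Omega>. a v y) = 1"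
    and h: "\<And>u y. u \<in> J \<Longrightarrow> y \<in> \<Omega> \<Longrightarrow> \<bar>h u y\<bar> \<le> 1"
    and zero: "\<And>u. u \<in> J \<Longrightarrow> (\<Sum>y\<in>\<Omega>. a u y * h u y) = 0"
  shows "(\<Sum>x\<in>I \<rightarrow>\<^sub>E \<Omega>. (\<Prod>v\<in>I. a v (x v)) * \<bar>\<Sum>u\<in>J. h u (x u)\<bar>) \<le> sqrt (card J)"
proof -
  let ?p = "\<lambda>x. \<Prod>v\<in>I. a v (x v)" and ?S = "\<lambda>x. \<Sum>u\<in>J. h u (x u)"
  let ?PI = "I \<rightarrow>\<^sub>E \<Omega>"
  have finJ: "finite J" using J fin finite_subset by blast
  have p_nn: "0 \<le> ?p x" if "x \<in> ?PI" for x
    using that nn by (auto intro!: prod_nonneg simp: PiE_mem)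
  have p1: "(\<Sum>x\<in>?PI. ?p x) = 1"
    using fin one by (rule sum_prod_PiE_eq_1)
  have cross: "(\<Sum>x\<in>?PI. ?p x * (h u (x u) * h w (x w))) = 0" if "u \<in> J" "w \<in> J" "u \<noteq> w" for u w
  proof -
    \<comment> \<open>Writes the product of the two test functions as a product over all
      coordinates, with factor 1 elsewhere, so that the expectation factorizes; the factor at
      \<open>u\<close> is centred and therefore 0.\<close>
    let ?h = "\<lambda>v y. (if v = u then h u y else 1) * (if v = w then h w y else 1)"
    have "(\<Sum>x\<in>?PI. ?p x * (h u (x u) * h w (x w))) = (\<Sum>x\<in>?PI. ?p x * (\<Prod>v\<in>I. ?h v (x v)))"
      using that J fin by (intro sum.cong refl) (auto simp: prod.distrib prod.delta)
    also have "\<dots> = (\<Prod>v\<in>I. \<Sum>y\<in>\<Omega>. a v y * ?h v y)"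
      using fin by (rule sum_prod_PiE_mult)
    also have "\<dots> = 0"
      using that J fin zero by (intro prod_zero bexI[of _ u]) auto
    finally show ?thesis .
  qed
  have diag: "(\<Sum>x\<in>?PI. ?p x * (h u (x u) * h u (x u))) \<le> 1" if "u \<in> J" for u
  proof -
    have "(\<Sum>x\<in>?PI. ?p x * (h u (x u) * h u (x u))) \<le> (\<Sum>x\<in>?PI. ?p x * 1)"
    proof (intro sum_mono mult_left_mono)
      fix x assume x: "x \<in> ?PI"
      have "\<bar>h u (x u)\<bar> \<le> 1" using that J x h by (auto simp: PiE_mem)
      then show "h u (x u) * h u (x u) \<le> 1"
        by (metis abs_ge_zero abs_mult abs_mult_self_eq mult_le_one)
    qed (use p_nn in auto)
    then show ?thesis using p1 by simp
  qed
  have sq: "(\<Sum>x\<in>?PI. ?p x * (?S x)\<^sup>2) \<le> card J"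
  proof -
    have "(\<Sum>x\<in>?PI. ?p x * (?S x)\<^sup>2) = (\<Sum>x\<in>?PI. \<Sum>u\<in>J. \<Sum>w\<in>J. ?p x * (h u (x u) * h w (x w)))"
      by (simp only: power2_eq_square sum_product) (simp only: sum_distrib_left)
    also have "\<dots> = (\<Sum>u\<in>J. \<Sum>w\<in>J. \<Sum>x\<in>?PI. ?p x * (h u (x u) * h w (x w)))"
      by (subst sum.swap) (simp add: sum.swap[of _ J ?PI])
    also have "\<dots> \<le> (\<Sum>u\<in>J. \<Sum>w\<in>J. if w = u then 1 else 0)"
      using cross diag by (intro sum_mono) auto
    also have "\<dots> = card J" using finJ by simp
    finally show ?thesis .
  qed
  \<comment> \<open>Cauchy-Schwarz with the weight split as
    \<open>sqrt (?p x) * sqrt (?p x)\<close>; total mass 1 leaves the root of the second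
    moment.\<close>
  have "(\<Sum>x\<in>?PI. ?p x * \<bar>?S x\<bar>) = (\<Sum>x\<in>?PI. sqrt (?p x) * (sqrt (?p x) * \<bar>?S x\<bar>))"
    using p_nn by (intro sum.cong refl) (simp flip: mult.assoc)
  also have "\<dots> \<le> sqrt (\<Sum>x\<in>?PI. (sqrt (?p x))\<^sup>2) * sqrt (\<Sum>x\<in>?PI. (sqrt (?p x) * \<bar>?S x\<bar>)\<^sup>2)"
    using L2_set_mult_ineq[of "\<lambda>x. sqrt (?p x)" "\<lambda>x. sqrt (?p x) * \<bar>?S x\<bar>" ?PI]
      p_nn by (simp add: L2_set_def abs_mult cong: sum.cong)
  also have "\<dots> = sqrt (\<Sum>x\<in>?PI. ?p x * (?S x)\<^sup>2)"
    using p_nn p1 by (simp add: power_mult_distrib cong: sum.cong)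
  also have "\<dots> \<le> sqrt (card J)" using sq by simp
  finally show ?thesis .
qed


text \<open>The observations see \<open>x\<close> and \<open>\<pi>\<close> only through
  \<open>x \<circ> inv \<pi>\<close>. Replacing \<open>\<pi>\<close> by
  \<open>\<pi> \<circ> t\<close> and \<open>x\<close> by \<open>x \<circ> t\<close>, with
  \<open>t\<close> the transposition of \<open>i\<close> and \<open>u\<close>, keeps that
  composition, moves the test from \<open>x u\<close> to \<open>x i\<close> and transposes the laws
  instead. The sum over all permutations, which stands for the uniform choice of
  \<open>\<pi>\<close>, absorbs the first substitution.\<close>

lemma sum_permutes_PiE_swap:
  fixes a :: "'i \<Rightarrow> 'y \<Rightarrow> real" and G :: "('i \<Rightarrow> 'y) \<Rightarrow> real"
  assumes iu: "i \<in> I" "u \<in> I"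
  shows "(\<Sum>\<pi> | \<pi> permutes I. \<Sum>x\<in>I \<rightarrow>\<^sub>E \<Omega>.
      (\<Prod>v\<in>I. a v (x v)) * (G (\<lambda>j\<in>I. x (inv \<pi> j)) * g (x u)))
    = (\<Sum>\<pi> | \<pi> permutes I. \<Sum>x\<in>I \<rightarrow>\<^sub>E \<Omega>.
      (\<Prod>v\<in>I. a (Transposition.transpose i u v) (x v)) * (G (\<lambda>j\<in>I. x (inv \<pi> j)) * g (x i)))"
proof -
  let ?t = "Transposition.transpose i u"
  have t: "?t permutes I" using iu by (rule permutes_swap_id)
  have t_in: "?t v \<in> I \<longleftrightarrow> v \<in> I" for v using t by (rule permutes_in_image)
  have "(\<Sum>\<pi> | \<pi> permutes I. \<Sum>x\<in>I \<rightarrow>\<^sub>E \<Omega>.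
      (\<Prod>v\<in>I. a v (x v)) * (G (\<lambda>j\<in>I. x (inv \<pi> j)) * g (x u)))
    = (\<Sum>\<pi> | \<pi> permutes I. \<Sum>x\<in>I \<rightarrow>\<^sub>E \<Omega>.
      (\<Prod>v\<in>I. a v (x v)) * (G (\<lambda>j\<in>I. x (inv (\<pi> \<circ> ?t) j)) * g (x u)))"
    by (rule sum_permutations_compose_right[OF t])
  also have "\<dots> = (\<Sum>\<pi> | \<pi> permutes I. \<Sum>x\<in>I \<rightarrow>\<^sub>E \<Omega>.
      (\<Prod>v\<in>I. a (?t v) (x v)) * (G (\<lambda>j\<in>I. x (inv \<pi> j)) * g (x i)))"
  proof (rule sum.cong[OF refl])
    fix \<pi> assume "\<pi> \<in> {\<pi>. \<pi> permutes I}"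
    then have \<pi>: "\<pi> permutes I" by simp
    have inv: "inv (\<pi> \<circ> ?t) = ?t \<circ> inv \<pi>"
      using permutes_bij[OF \<pi>] by (subst o_inv_distrib) auto
    have prod: "(\<Prod>v\<in>I. a v (x (?t v))) = (\<Prod>v\<in>I. a (?t v) (x v))" for x
      by (subst prod.permute[OF t]) (simp add: comp_def)
    show "(\<Sum>x\<in>I \<rightarrow>\<^sub>E \<Omega>. (\<Prod>v\<in>I. a v (x v)) * (G (\<lambda>j\<in>I. x (inv (\<pi> \<circ> ?t) j)) * g (x u)))
      = (\<Sum>x\<in>I \<rightarrow>\<^sub>E \<Omega>. (\<Prod>v\<in>I. a (?t v) (x v)) * (G (\<lambda>j\<in>I. x (inv \<pi> j)) * g (x i)))"
    proof (rule sum.reindex_bij_witness[where i = "\<lambda>x. x \<circ> ?t" and j = "\<lambda>x. x \<circ> ?t"])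
      fix x assume "x \<in> I \<rightarrow>\<^sub>E \<Omega>"
      then show "x \<circ> ?t \<in> I \<rightarrow>\<^sub>E \<Omega>"
        by (auto simp: PiE_iff t_in extensional_def)
      show "x \<circ> ?t \<circ> ?t = x" by (simp add: comp_assoc)
      show "(\<Prod>v\<in>I. a (?t v) ((x \<circ> ?t) v)) * (G (\<lambda>j\<in>I. (x \<circ> ?t) (inv \<pi> j)) * g ((x \<circ> ?t) i))
        = (\<Prod>v\<in>I. a v (x v)) * (G (\<lambda>j\<in>I. x (inv (\<pi> \<circ> ?t) j)) * g (x u))"
        unfolding inv using prod[of "x \<circ> ?t"] by simp
    qed (auto simp: comp_assoc PiE_iff t_in extensional_def)
  qed
  finally show ?thesis .
qed

text \<open>
  Swapping user \<open>i\<close> with a user \<open>u\<close> whose path law is \<open>\<tau>\<close>-close changes the joint law of paths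
  and observations by at most \<open>2 * \<tau>\<close>, so \<open>g (x i)\<close> can be replaced by its average over \<open>J\<close>,
  which concentrates.
\<close>

lemma shuffled_correlation_le:
  fixes a :: "'i \<Rightarrow> 'y \<Rightarrow> real" and G :: "('i \<Rightarrow> 'y) \<Rightarrow> real" and g :: "'y \<Rightarrow> real"
  assumes fin: "finite I" "finite \<Omega>" and J: "J \<subseteq> I" "J \<noteq> {}" and i: "i \<in> I"
    and nn: "\<And>v y. v \<in> I \<Longrightarrow> y \<in> \<Omega> \<Longrightarrow> 0 \<le> a v y" and one: "\<And>v. v \<in> I \<Longrightarrow> (\<Sum>y\<in>\<Omega>. a v y) = 1"
    and G: "\<And>z. \<bar>G z\<bar> \<le> 1" and g: "\<And>y. 0 \<le> g y" "\<And>y. g y \<le> 1"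
    and \<tau>: "\<And>u. u \<in> J \<Longrightarrow> (\<Sum>y\<in>\<Omega>. \<bar>a i y - a u y\<bar>) \<le> \<tau>"
  shows "\<bar>\<Sum>\<pi> | \<pi> permutes I. \<Sum>x\<in>I \<rightarrow>\<^sub>E \<Omega>. (\<Prod>v\<in>I. a v (x v)) *
      (G (\<lambda>j\<in>I. x (inv \<pi> j)) * (g (x i) - (\<Sum>y\<in>\<Omega>. a i y * g y)))\<bar>
    \<le> fact (card I) * (3 * \<tau> + 1 / sqrt (card J))"
proof -
  let ?S = "{\<pi>. \<pi> permutes I}" and ?PI = "I \<rightarrow>\<^sub>E \<Omega>"
  let ?p = "\<lambda>x. \<Prod>v\<in>I. a v (x v)" and ?G = "\<lambda>\<pi> x. G (\<lambda>j\<in>I. x (inv \<pi> j))"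
  define q where "q u = (\<Sum>y\<in>\<Omega>. a u y * g y)" for u
  define T where "T u = (\<Sum>\<pi>\<in>?S. \<Sum>x\<in>?PI. ?p x * (?G \<pi> x * g (x u)))" for u
  define T0 where "T0 = (\<Sum>\<pi>\<in>?S. \<Sum>x\<in>?PI. ?p x * ?G \<pi> x)"
  define N where "N = real (card J)"
  define F :: real where "F = fact (card I)"
  have finJ: "finite J" using J fin finite_subset by blast
  have N: "N > 0" using J finJ by (simp add: N_def card_gt_0_iff)
  have F: "F > 0" and card_S: "real (card ?S) = F"
    using card_permutations[OF refl fin(1)] by (auto simp: F_def)
  have p_nn: "0 \<le> ?p x" if "x \<in> ?PI" for x
    using that nn by (auto intro!: prod_nonneg dest: PiE_mem)
  have p1: "(\<Sum>x\<in>?PI. ?p x) = 1"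
    using fin one by (rule sum_prod_PiE_eq_1)
  have outer: "\<bar>\<Sum>\<pi>\<in>?S. \<Sum>x\<in>?PI. h \<pi> x\<bar> \<le> F * c"
    if "\<And>\<pi>. (\<Sum>x\<in>?PI. \<bar>h \<pi> x\<bar>) \<le> c" for h and c :: real
  proof -
    have "\<bar>\<Sum>\<pi>\<in>?S. \<Sum>x\<in>?PI. h \<pi> x\<bar> \<le> (\<Sum>\<pi>\<in>?S. \<Sum>x\<in>?PI. \<bar>h \<pi> x\<bar>)"
      by (intro order.trans[OF sum_abs] sum_mono sum_abs)
    also have "\<dots> \<le> (\<Sum>\<pi>\<in>?S. c)" using that by (intro sum_mono)
    finally show ?thesis using card_S by simp
  qed
  have q01: "0 \<le> q u" "q u \<le> 1" if "u \<in> I" for u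
  proof -
    show "0 \<le> q u" using that nn g by (auto simp: q_def intro!: sum_nonneg)
    have "q u \<le> (\<Sum>y\<in>\<Omega>. a u y * 1)"
      unfolding q_def using that nn g by (intro sum_mono mult_left_mono) auto
    then show "q u \<le> 1" using one that by simp
  qed
  have q_close: "\<bar>q u - q i\<bar> \<le> \<tau>" if "u \<in> J" for u
  proof -
    have "\<bar>q u - q i\<bar> = \<bar>\<Sum>y\<in>\<Omega>. (a u y - a i y) * g y\<bar>"
      by (simp add: q_def sum_subtractf left_diff_distrib)
    also have "\<dots> \<le> (\<Sum>y\<in>\<Omega>. \<bar>(a u y - a i y) * g y\<bar>)" by (rule sum_abs)
    also have "\<dots> \<le> (\<Sum>y\<in>\<Omega>. \<bar>a i y - a u y\<bar>)"
      using g by (intro sum_mono) (auto simp: abs_mult abs_minus_commute intro!: mult_left_le)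
    finally show ?thesis using \<tau>[OF that] by simp
  qed
  have \<tau>0: "0 \<le> \<tau>" using J q_close by (meson abs_ge_zero all_not_in_conv order.trans)
  have T_close: "\<bar>T i - T u\<bar> \<le> F * (2 * \<tau>)" if u: "u \<in> J" for u
  proof -
    let ?t = "Transposition.transpose i u"
    let ?q = "\<lambda>x. \<Prod>v\<in>I. a (?t v) (x v)"
    have uI: "u \<in> I" using u J by auto
    have t_in: "?t v \<in> I" if "v \<in> I" for v
      using permutes_in_image[OF permutes_swap_id[OF i uI]] that by simp
    have "T i - T u = (\<Sum>\<pi>\<in>?S. \<Sum>x\<in>?PI. (?p x - ?q x) * (?G \<pi> x * g (x i)))"
      unfolding T_def sum_permutes_PiE_swap[OF i uI]
      by (simp add: sum_subtractf left_diff_distrib)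
    also have "\<bar>\<dots>\<bar> \<le> F * (2 * \<tau>)"
    proof (rule outer)
      fix \<pi>
      have "(\<Sum>x\<in>?PI. \<bar>(?p x - ?q x) * (?G \<pi> x * g (x i))\<bar>) \<le> (\<Sum>x\<in>?PI. \<bar>?p x - ?q x\<bar>)"
        using g G by (intro sum_mono) (auto simp: abs_mult intro!: mult_left_le mult_le_one)
      also have "\<dots> \<le> (\<Sum>v\<in>I. \<Sum>y\<in>\<Omega>. \<bar>a v y - a (?t v) y\<bar>)"
        using fin nn one t_in by (intro sum_abs_diff_prod_le) auto
      \<comment> \<open>The two families of laws differ at \<open>i\<close> and \<open>u\<close>
        only, by at most \<tau> each, whence the factor 2. For \<open>u = i\<close> the left side is
        0.\<close>
      also have "\<dots> \<le> (\<Sum>v\<in>I. (if v = i then \<tau> else 0) + (if v = u then \<tau> else 0))"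
        using \<tau>[OF u] \<tau>0 by (intro sum_mono) (auto simp: Transposition.transpose_def abs_minus_commute)
      also have "\<dots> = 2 * \<tau>" using fin i uI by (simp add: sum.distrib)
      finally show "(\<Sum>x\<in>?PI. \<bar>(?p x - ?q x) * (?G \<pi> x * g (x i))\<bar>) \<le> 2 * \<tau>" .
    qed
    finally show ?thesis .
  qed
  have T0: "\<bar>T0\<bar> \<le> F * 1" unfolding T0_def
  proof (rule outer)
    fix \<pi>
    have "(\<Sum>x\<in>?PI. \<bar>?p x * ?G \<pi> x\<bar>) \<le> (\<Sum>x\<in>?PI. ?p x)"
      using p_nn G by (intro sum_mono) (auto simp: abs_mult intro!: mult_left_le)
    then show "(\<Sum>x\<in>?PI. \<bar>?p x * ?G \<pi> x\<bar>) \<le> 1" using p1 by simp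
  qed
  \<comment> \<open>No exchange is involved here: for each fixed \<open>\<pi>\<close> the factor
    \<open>?G\<close> is bounded by 1 and the centred sum over \<open>J\<close>
    concentrates.\<close>
  have avg: "\<bar>(\<Sum>u\<in>J. T u) - (\<Sum>u\<in>J. q u) * T0\<bar> \<le> F * sqrt N"
  proof -
    have "(\<Sum>u\<in>J. T u) = (\<Sum>\<pi>\<in>?S. \<Sum>x\<in>?PI. ?p x * (?G \<pi> x * (\<Sum>u\<in>J. g (x u))))"
      unfolding T_def sum_distrib_left by (simp add: sum.swap[of _ J])
    then have "(\<Sum>u\<in>J. T u) - (\<Sum>u\<in>J. q u) * T0
      = (\<Sum>\<pi>\<in>?S. \<Sum>x\<in>?PI. ?p x * (?G \<pi> x * (\<Sum>u\<in>J. g (x u) - q u)))"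
      by (simp add: T0_def sum_subtractf right_diff_distrib sum_distrib_left [of "sum q J"] mult_ac)
    also have "\<bar>\<dots>\<bar> \<le> F * sqrt N"
    proof (rule outer)
      fix \<pi>
      have "(\<Sum>x\<in>?PI. \<bar>?p x * (?G \<pi> x * (\<Sum>u\<in>J. g (x u) - q u))\<bar>)
          \<le> (\<Sum>x\<in>?PI. ?p x * \<bar>\<Sum>u\<in>J. g (x u) - q u\<bar>)"
        using p_nn G
        by (intro sum_mono) (auto simp: abs_mult intro!: mult_left_mono mult_right_le_one_le mult_left_le_one_le)
      also have "\<dots> \<le> sqrt (card J)"
      proof (rule sum_prod_PiE_abs_sum_le[OF fin J(1)])
        fix u assume u: "u \<in> J"
        show "\<bar>g y - q u\<bar> \<le> 1" for y using g[of y] q01[of u] u J by (auto simp: abs_le_iff)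
        have "(\<Sum>y\<in>\<Omega>. a u y * (g y - q u)) = q u - (\<Sum>y\<in>\<Omega>. a u y) * q u"
          by (simp add: q_def right_diff_distrib sum_subtractf sum_distrib_right)
        then show "(\<Sum>y\<in>\<Omega>. a u y * (g y - q u)) = 0" using one u J by auto
      qed (use nn one in auto)
      finally show "(\<Sum>x\<in>?PI. \<bar>?p x * (?G \<pi> x * (\<Sum>u\<in>J. g (x u) - q u))\<bar>) \<le> sqrt N"
        by (simp add: N_def)
    qed
    finally show ?thesis .
  qed
  \<comment> \<open>The averages over \<open>J\<close> are inserted. Exchanging users costs
    \<open>2 * \<tau>\<close> per member of \<open>J\<close> and replacing \<open>q u\<close> by
    \<open>q i\<close> another \<tau>, which makes \<open>3 * \<tau>\<close>; the concentration term
    is of order \<open>sqrt N\<close> and becomes \<open>1 / sqrt N\<close> after division by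
    \<open>N\<close>.\<close>
  have "N * \<bar>T i - q i * T0\<bar> = \<bar>N * (T i - q i * T0)\<bar>"
    using N by (simp add: abs_mult)
  also have "N * (T i - q i * T0) = (\<Sum>u\<in>J. T i - T u) + ((\<Sum>u\<in>J. T u) - (\<Sum>u\<in>J. q u) * T0)
      + (\<Sum>u\<in>J. q u - q i) * T0"
    by (simp add: sum_subtractf N_def algebra_simps)
  also have "\<bar>\<dots>\<bar> \<le> (\<Sum>u\<in>J. \<bar>T i - T u\<bar>) + F * sqrt N + (\<Sum>u\<in>J. \<bar>q u - q i\<bar>) * F"
  proof (intro order.trans[OF abs_triangle_ineq] add_mono avg sum_abs)
    show "\<bar>(\<Sum>u\<in>J. q u - q i) * T0\<bar> \<le> (\<Sum>u\<in>J. \<bar>q u - q i\<bar>) * F"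
      unfolding abs_mult using T0 by (intro mult_mono sum_abs sum_nonneg) auto
  qed
  also have "\<dots> \<le> (\<Sum>u\<in>J. F * (2 * \<tau>)) + F * sqrt N + (\<Sum>u\<in>J. \<tau>) * F"
    using T_close q_close F N by (intro add_mono mult_right_mono sum_mono) auto
  also have "\<dots> = N * (F * (3 * \<tau> + 1 / sqrt N))"
    using N by (simp add: N_def field_simps real_div_sqrt)
  finally have main: "\<bar>T i - q i * T0\<bar> \<le> F * (3 * \<tau> + 1 / sqrt N)"
    using N by simp
  have "T i - q i * T0 = (\<Sum>\<pi>\<in>?S. \<Sum>x\<in>?PI. ?p x * (?G \<pi> x * (g (x i) - q i)))"
    by (simp add: T_def T0_def sum_subtractf left_diff_distrib right_diff_distrib sum_distrib_left mult_ac)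
  with main show ?thesis by (simp add: q_def F_def N_def)
qed

section \<open>Path laws of Markov kernels\<close>

definition path_weight :: "'s \<Rightarrow> ('s \<Rightarrow> 's \<Rightarrow> real) \<Rightarrow> nat \<Rightarrow> (nat \<Rightarrow> 's) \<Rightarrow> real" where
  "path_weight s T K x = of_bool (x 1 = s) * (\<Prod>l\<in>{1..<K}. T (x l) (x (Suc l)))"

lemma path_weight_1: "path_weight s T 1 x = of_bool (x 1 = s)"
  by (simp add: path_weight_def)

lemma path_weight_Suc:
  "K \<ge> 1 \<Longrightarrow> path_weight s T (Suc K) x = path_weight s T K x * T (x K) (x (Suc K))"
  by (simp add: path_weight_def)

lemma path_weight_fun_upd:
  "path_weight s T K (x(Suc K := y)) = path_weight s T K x" if "K \<ge> 1"
  using that unfolding path_weight_def by (intro arg_cong2[where f = "(*)"] prod.cong) auto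

lemma path_weight_nonneg:
  assumes "\<And>i j. i \<in> S \<Longrightarrow> j \<in> S \<Longrightarrow> 0 \<le> T i j" "x \<in> {1..K} \<rightarrow>\<^sub>E S"
  shows "0 \<le> path_weight s T K x"
proof -
  have "x l \<in> S \<and> x (Suc l) \<in> S" if "l \<in> {1..<K}" for l
    using that PiE_mem[OF assms(2), of l] PiE_mem[OF assms(2), of "Suc l"] by auto
  then show ?thesis
    unfolding path_weight_def using assms(1) by (auto intro!: mult_nonneg_nonneg prod_nonneg)
qed

lemma path_weight_le_1:
  assumes "\<And>i j. i \<in> S \<Longrightarrow> j \<in> S \<Longrightarrow> 0 \<le> T i j" "\<And>i j. i \<in> S \<Longrightarrow> j \<in> S \<Longrightarrow> T i j \<le> 1"
    and "x \<in> {1..K} \<rightarrow>\<^sub>E S"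
  shows "path_weight s T K x \<le> 1"
proof -
  have "x l \<in> S \<and> x (Suc l) \<in> S" if "l \<in> {1..<K}" for l
    using that PiE_mem[OF assms(3), of l] PiE_mem[OF assms(3), of "Suc l"] by auto
  then show ?thesis
    unfolding path_weight_def using assms(1,2) by (auto intro!: prod_le_1)
qed

lemma sum_paths_Suc:
  fixes h :: "(nat \<Rightarrow> 's) \<Rightarrow> real"
  shows "(\<Sum>x\<in>{1..Suc K} \<rightarrow>\<^sub>E S. h x) = (\<Sum>x\<in>{1..K} \<rightarrow>\<^sub>E S. \<Sum>y\<in>S. h (x(Suc K := y)))"
  using sum_PiE_insert[of "Suc K" "{1..K}" h "\<lambda>_. S"] by (simp add: atLeastAtMostSuc_conv)

lemma sum_paths_1:
  fixes h :: "'s \<Rightarrow> real"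
  shows "(\<Sum>x\<in>{1..1::nat} \<rightarrow>\<^sub>E S. h (x 1)) = (\<Sum>y\<in>S. h y)"
proof -
  have "(\<Sum>x\<in>{1..Suc 0} \<rightarrow>\<^sub>E S. h (x 1)) = (\<Sum>y\<in>S. h y)"
    by (subst sum_paths_Suc) simp
  then show ?thesis by simp
qed

lemma sum_path_weight:
  assumes "finite S" "s \<in> S" "K \<ge> 1" and one: "\<And>i. i \<in> S \<Longrightarrow> (\<Sum>j\<in>S. T i j) = 1"
  shows "(\<Sum>x\<in>{1..K} \<rightarrow>\<^sub>E S. path_weight s T K x) = 1"
  using \<open>K \<ge> 1\<close>
proof (induction K rule: dec_induct)
  case base
  show ?case using sum_paths_1[of "\<lambda>y. of_bool (y = s)" S] assms unfolding path_weight_1 by simp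
next
  case (step k)
  have "(\<Sum>x\<in>{1..Suc k} \<rightarrow>\<^sub>E S. path_weight s T (Suc k) x)
      = (\<Sum>x\<in>{1..k} \<rightarrow>\<^sub>E S. path_weight s T k x * (\<Sum>y\<in>S. T (x k) y))"
    using step.hyps
    by (subst sum_paths_Suc) (simp add: path_weight_Suc path_weight_fun_upd sum_distrib_left)
  also have "\<dots> = (\<Sum>x\<in>{1..k} \<rightarrow>\<^sub>E S. path_weight s T k x)"
  proof (intro sum.cong refl)
    fix x assume "x \<in> {1..k} \<rightarrow>\<^sub>E S"
    then have "x k \<in> S" using step.hyps by (auto simp: PiE_mem)
    then show "path_weight s T k x * (\<Sum>y\<in>S. T (x k) y) = path_weight s T k x" using one by simp
  qed
  finally show ?case using step.IH by simp
qed

text \<open>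
  The sum of the \<open>(path_weight s T' K x)\<^sup>2 / path_weight s T K x\<close> is one plus a chi-square divergence,
  and unlike the L1 distance it is bounded multiplicatively along the path.
\<close>

lemma sum_path_weight_chi_square_le:
  fixes \<rho> :: real
  assumes "finite S" "s \<in> S" "K \<ge> 1" and "\<rho> \<ge> 0"
    and nn: "\<And>i j. i \<in> S \<Longrightarrow> j \<in> S \<Longrightarrow> 0 \<le> T i j"
    and row: "\<And>i. i \<in> S \<Longrightarrow> (\<Sum>j\<in>S. (T' i j)\<^sup>2 / T i j) \<le> 1 + \<rho>"
  shows "(\<Sum>x\<in>{1..K} \<rightarrow>\<^sub>E S. (path_weight s T' K x)\<^sup>2 / path_weight s T K x) \<le> (1 + \<rho>) ^ (K - 1)"
  using \<open>K \<ge> 1\<close>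
proof (induction K rule: dec_induct)
  case base
  have "(path_weight s T' 1 x)\<^sup>2 / path_weight s T 1 x = of_bool (x 1 = s)" for x
    unfolding path_weight_1 by simp
  then show ?case using sum_paths_1[of "\<lambda>y. of_bool (y = s)" S] assms by simp
next
  case (step k)
  let ?c = "\<lambda>x. (path_weight s T' k x)\<^sup>2 / path_weight s T k x"
  \<comment> \<open>The last transition splits off as a factor of the quotient even where
    \<open>T\<close> vanishes, since division by 0 yields 0.\<close>
  have "(\<Sum>x\<in>{1..Suc k} \<rightarrow>\<^sub>E S. (path_weight s T' (Suc k) x)\<^sup>2 / path_weight s T (Suc k) x)
      = (\<Sum>x\<in>{1..k} \<rightarrow>\<^sub>E S. ?c x * (\<Sum>y\<in>S. (T' (x k) y)\<^sup>2 / T (x k) y))"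
    using step.hyps
    by (subst sum_paths_Suc) (simp add: path_weight_Suc path_weight_fun_upd sum_distrib_left power_mult_distrib)
  also have "\<dots> \<le> (\<Sum>x\<in>{1..k} \<rightarrow>\<^sub>E S. ?c x * (1 + \<rho>))"
  proof (intro sum_mono mult_left_mono row)
    fix x assume x: "x \<in> {1..k} \<rightarrow>\<^sub>E S"
    show "x k \<in> S" using x step.hyps by (auto simp: PiE_mem)
    show "0 \<le> ?c x" using path_weight_nonneg[OF nn x] by auto
  qed
  also have "\<dots> = (\<Sum>x\<in>{1..k} \<rightarrow>\<^sub>E S. ?c x) * (1 + \<rho>)"
    by (simp add: sum_distrib_right)
  also have "\<dots> \<le> (1 + \<rho>) ^ (k - 1) * (1 + \<rho>)"
    using step.IH \<open>\<rho> \<ge> 0\<close> by (intro mult_right_mono) auto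
  also have "\<dots> = (1 + \<rho>) ^ (Suc k - 1)"
    using step.hyps by (simp add: power_eq_if[of _ k])
  finally show ?case .
qed

text \<open>Expands the square. At a point with \<open>\<mu> x = 0\<close> both quotients are 0 by
  the convention for division, and the remaining terms vanish by absolute continuity.\<close>

lemma sum_chi_square:
  fixes \<mu> \<nu> :: "'x \<Rightarrow> real"
  assumes ac: "\<And>x. x \<in> A \<Longrightarrow> \<mu> x = 0 \<Longrightarrow> \<nu> x = 0"
    and "(\<Sum>x\<in>A. \<mu> x) = 1" "(\<Sum>x\<in>A. \<nu> x) = 1"
  shows "(\<Sum>x\<in>A. (\<mu> x - \<nu> x)\<^sup>2 / \<mu> x) = (\<Sum>x\<in>A. (\<nu> x)\<^sup>2 / \<mu> x) - 1"
proof -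
  have "(\<Sum>x\<in>A. (\<mu> x - \<nu> x)\<^sup>2 / \<mu> x) = (\<Sum>x\<in>A. (\<nu> x)\<^sup>2 / \<mu> x - 2 * \<nu> x + \<mu> x)"
    using ac by (intro sum.cong refl) (auto simp: divide_simps power2_eq_square algebra_simps)
  then show ?thesis
    using assms by (simp add: sum.distrib sum_subtractf flip: sum_distrib_left)
qed

text \<open>Cauchy-Schwarz for \<open>sqrt (\<mu> x)\<close> against
  \<open>(\<mu> x - \<nu> x) / sqrt (\<mu> x)\<close>, where the first factor has norm 1.\<close>

lemma sum_abs_diff_le_chi_square:
  fixes \<mu> \<nu> :: "'x \<Rightarrow> real"
  assumes nn: "\<And>x. x \<in> A \<Longrightarrow> 0 \<le> \<mu> x" and ac: "\<And>x. x \<in> A \<Longrightarrow> \<mu> x = 0 \<Longrightarrow> \<nu> x = 0"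
    and one: "(\<Sum>x\<in>A. \<mu> x) = 1" "(\<Sum>x\<in>A. \<nu> x) = 1"
  shows "(\<Sum>x\<in>A. \<bar>\<mu> x - \<nu> x\<bar>) \<le> sqrt ((\<Sum>x\<in>A. (\<nu> x)\<^sup>2 / \<mu> x) - 1)"
proof -
  have "(\<Sum>x\<in>A. \<bar>\<mu> x - \<nu> x\<bar>) = (\<Sum>x\<in>A. \<bar>sqrt (\<mu> x)\<bar> * \<bar>(\<mu> x - \<nu> x) / sqrt (\<mu> x)\<bar>)"
    using nn ac by (intro sum.cong refl) auto
  also have "\<dots> \<le> L2_set (\<lambda>x. sqrt (\<mu> x)) A * L2_set (\<lambda>x. (\<mu> x - \<nu> x) / sqrt (\<mu> x)) A"
    by (rule L2_set_mult_ineq)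
  also have "\<dots> = sqrt (\<Sum>x\<in>A. (\<mu> x - \<nu> x)\<^sup>2 / \<mu> x)"
    using nn one by (simp add: L2_set_def power_divide cong: sum.cong)
  finally show ?thesis using ac one by (simp add: sum_chi_square)
qed

text \<open>Each row has chi-square divergence at most
  \<open>\<rho> = card S * \<eta>\<^sup>2 / \<epsilon>\<close>, as every nonzero divisor is at least
  \<open>\<epsilon>\<close>. The divergence of the path laws is then at most
  \<open>(1 + \<rho>) ^ (K - 1) - 1\<close>, so length and distance enter through
  \<open>K * \<eta>\<^sup>2\<close> alone.\<close>

lemma path_weight_abs_diff_le:
  fixes \<eta> \<epsilon> :: real
  assumes S: "finite S" "s \<in> S" "K \<ge> 1" and "\<epsilon> > 0" "\<eta> \<ge> 0"
    and nn: "\<And>i j. i \<in> S \<Longrightarrow> j \<in> S \<Longrightarrow> 0 \<le> T i j"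
    and one: "\<And>i. i \<in> S \<Longrightarrow> (\<Sum>j\<in>S. T i j) = 1" "\<And>i. i \<in> S \<Longrightarrow> (\<Sum>j\<in>S. T' i j) = 1"
    and pos: "\<And>i j. i \<in> S \<Longrightarrow> j \<in> S \<Longrightarrow> (T i j = 0 \<and> T' i j = 0) \<or> T i j \<ge> \<epsilon>"
    and diff: "\<And>i j. i \<in> S \<Longrightarrow> j \<in> S \<Longrightarrow> \<bar>T i j - T' i j\<bar> \<le> \<eta>"
  shows "(\<Sum>x\<in>{1..K} \<rightarrow>\<^sub>E S. \<bar>path_weight s T K x - path_weight s T' K x\<bar>)
    \<le> sqrt (exp (K * (card S * \<eta>\<^sup>2 / \<epsilon>)) - 1)"
proof -
  define \<rho> where "\<rho> = card S * \<eta>\<^sup>2 / \<epsilon>"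
  have \<rho>: "\<rho> \<ge> 0" using \<open>\<epsilon> > 0\<close> by (simp add: \<rho>_def)
  have row: "(\<Sum>j\<in>S. (T' i j)\<^sup>2 / T i j) \<le> 1 + \<rho>" if i: "i \<in> S" for i
  proof -
    have "T' i j = 0" if "j \<in> S" "T i j = 0" for j
      using pos[OF i that(1)] that(2) \<open>\<epsilon> > 0\<close> by auto
    then have "(\<Sum>j\<in>S. (T' i j)\<^sup>2 / T i j) = 1 + (\<Sum>j\<in>S. (T i j - T' i j)\<^sup>2 / T i j)"
      using one i by (subst sum_chi_square) auto
    also have "(\<Sum>j\<in>S. (T i j - T' i j)\<^sup>2 / T i j) \<le> (\<Sum>j\<in>S. \<eta>\<^sup>2 / \<epsilon>)"
    proof (rule sum_mono)
      fix j assume j: "j \<in> S"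
      have "(T i j - T' i j)\<^sup>2 \<le> \<eta>\<^sup>2"
        using diff[OF i j] \<open>\<eta> \<ge> 0\<close> by (simp flip: abs_le_square_iff)
      then show "(T i j - T' i j)\<^sup>2 / T i j \<le> \<eta>\<^sup>2 / \<epsilon>"
        using pos[OF i j] \<open>\<epsilon> > 0\<close> by (cases "T i j = 0") (auto intro: frac_le)
    qed
    finally show ?thesis by (simp add: \<rho>_def)
  qed
  have "(\<Sum>x\<in>{1..K} \<rightarrow>\<^sub>E S. \<bar>path_weight s T K x - path_weight s T' K x\<bar>)
      \<le> sqrt ((\<Sum>x\<in>{1..K} \<rightarrow>\<^sub>E S. (path_weight s T' K x)\<^sup>2 / path_weight s T K x) - 1)"
  proof (rule sum_abs_diff_le_chi_square)
    fix x assume x: "x \<in> {1..K} \<rightarrow>\<^sub>E S"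
    show "0 \<le> path_weight s T K x" using nn x by (rule path_weight_nonneg)
    assume "path_weight s T K x = 0"
    then have "x 1 \<noteq> s \<or> (\<exists>l\<in>{1..<K}. T (x l) (x (Suc l)) = 0)"
      by (auto simp: path_weight_def)
    moreover have "T' (x l) (x (Suc l)) = 0" if "l \<in> {1..<K}" "T (x l) (x (Suc l)) = 0" for l
      using pos[of "x l" "x (Suc l)"] that PiE_mem[OF x, of l] PiE_mem[OF x, of "Suc l"] \<open>\<epsilon> > 0\<close>
      by auto
    ultimately show "path_weight s T' K x = 0" by (force simp: path_weight_def)
  qed (use S one in \<open>auto intro!: sum_path_weight simp del: One_nat_def\<close>)
  also have "(\<Sum>x\<in>{1..K} \<rightarrow>\<^sub>E S. (path_weight s T' K x)\<^sup>2 / path_weight s T K x) \<le> (1 + \<rho>) ^ (K - 1)"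
    using S \<rho> nn row by (rule sum_path_weight_chi_square_le)
  also have "(1 + \<rho>) ^ (K - 1) \<le> (1 + \<rho>) ^ K"
    using \<rho> by (intro power_increasing) auto
  also have "\<dots> \<le> exp \<rho> ^ K" using \<rho> by (intro power_mono) auto
  also have "\<dots> = exp (K * \<rho>)" by (simp add: exp_of_nat_mult)
  finally show ?thesis by (simp add: \<rho>_def)
qed

text \<open>The factor \<open>r\<close> comes from the left-out edges, whose probability is 1 minus
  a sum of at most \<open>r\<close> free coordinates. On a free edge the error is \<eta>, and
  \<open>r \<ge> 1\<close> as soon as there is an edge.\<close>

lemma trans_prob_diff_le:
  fixes r :: nat and \<eta> :: real
  assumes E: "E \<subseteq> {1..r} \<times> {1..r}" and Ed: "Ed \<subseteq> E" and "0 \<le> \<eta>"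
    and close: "\<And>e. e \<in> Ed \<Longrightarrow> \<bar>p e - p' e\<bar> \<le> \<eta>"
  shows "\<bar>trans_prob E Ed p i j - trans_prob E Ed p' i j\<bar> \<le> r * \<eta>"
proof -
  have *: "\<eta> \<le> r * \<eta>" if "(i, j) \<in> E"
    using that E \<open>0 \<le> \<eta>\<close> by (auto simp: mult_le_cancel_right1)
  have "\<bar>(\<Sum>j' | (i, j') \<in> Ed. p' (i, j')) - (\<Sum>j' | (i, j') \<in> Ed. p (i, j'))\<bar>
      \<le> (\<Sum>j' | (i, j') \<in> Ed. \<bar>p' (i, j') - p (i, j')\<bar>)"
    by (simp add: sum_abs flip: sum_subtractf)
  also have "\<dots> \<le> (\<Sum>j' | (i, j') \<in> Ed. \<eta>)"
    using close by (intro sum_mono) (simp add: abs_minus_commute)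
  also have "\<dots> \<le> r * \<eta>"
  proof -
    have "card {j'. (i, j') \<in> Ed} \<le> card {1..r}"
      using E Ed by (intro card_mono) auto
    then show ?thesis using \<open>0 \<le> \<eta>\<close> by (auto intro!: mult_right_mono)
  qed
  finally have left_out: "\<bar>(\<Sum>j' | (i, j') \<in> Ed. p' (i, j')) - (\<Sum>j' | (i, j') \<in> Ed. p (i, j'))\<bar> \<le> r * \<eta>" .
  consider "(i, j) \<in> Ed" | "(i, j) \<in> E - Ed" | "(i, j) \<notin> E" using Ed by auto
  then show ?thesis
  proof cases
    case 1
    then have "\<bar>p (i, j) - p' (i, j)\<bar> \<le> r * \<eta>"
      using close[OF 1] * Ed by (meson order.trans subsetD)
    with 1 show ?thesis by (simp add: trans_prob_def)
  next
    case 2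
    with left_out show ?thesis by (simp add: trans_prob_def)
  next
    case 3
    with Ed \<open>0 \<le> \<eta>\<close> show ?thesis by (auto simp: trans_prob_def)
  qed
qed

section \<open>Conditional probabilities and mutual information\<close>

text \<open>The conditional probability of \<open>B\<close> given \<open>W\<close> is kept as a
  function on the value space of \<open>W\<close>, since the densities in mutual information are
  functions there. The bounds are asked for almost everywhere: a Radon-Nikodym derivative gives no
  more, and path laws obey them only for acceptable parameters.\<close>

definition (in prob_space) cond_version :: "'b measure \<Rightarrow> ('a \<Rightarrow> 'b) \<Rightarrow> 'a set \<Rightarrow> ('b \<Rightarrow> real) \<Rightarrow> bool" where
  "cond_version N W B q \<longleftrightarrow> q \<in> borel_measurable N \<and> (AE \<omega> in M. 0 \<le> q (W \<omega>) \<and> q (W \<omega>) \<le> 1) \<and>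
    (\<forall>A\<in>sets N. prob (B \<inter> (W -` A \<inter> space M)) = (\<integral>\<omega>. indicator A (W \<omega>) * q (W \<omega>) \<partial>M))"

lemma density_indicator_real: "density M (indicator B) = density M (\<lambda>\<omega>. ennreal (indicator B \<omega>))"
  by (simp add: ennreal_indicator)

lemma emeasure_distr_density_indicator:
  assumes [measurable]: "W \<in> M \<rightarrow>\<^sub>M N" "B \<in> sets M" "A \<in> sets N"
  shows "emeasure (distr (density M (indicator B)) N W) A = emeasure M (B \<inter> (W -` A \<inter> space M))"
proof -
  have "emeasure (distr (density M (indicator B)) N W) A
      = (\<integral>\<^sup>+\<omega>. indicator B \<omega> * indicator (W -` A \<inter> space M) \<omega> \<partial>M)"
    by (simp add: emeasure_distr emeasure_density)
  also have "\<dots> = (\<integral>\<^sup>+\<omega>. indicator (B \<inter> (W -` A \<inter> space M)) \<omega> \<partial>M)"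
    by (intro nn_integral_cong) (auto split: split_indicator)
  finally show ?thesis by simp
qed

context prob_space
begin

lemma cond_versionD:
  assumes "cond_version N W B q"
  shows "q \<in> borel_measurable N" "AE \<omega> in M. 0 \<le> q (W \<omega>)" "AE \<omega> in M. q (W \<omega>) \<le> 1"
    "\<And>A. A \<in> sets N \<Longrightarrow> prob (B \<inter> (W -` A \<inter> space M)) = (\<integral>\<omega>. indicator A (W \<omega>) * q (W \<omega>) \<partial>M)"
  using assms by (auto simp: cond_version_def)

lemma cond_version_nn:
  assumes q: "cond_version N W B q" and [measurable]: "W \<in> M \<rightarrow>\<^sub>M N" "B \<in> events" "A \<in> sets N"
  shows "emeasure M (B \<inter> (W -` A \<inter> space M)) = (\<integral>\<^sup>+\<omega>. ennreal (q (W \<omega>)) * indicator A (W \<omega>) \<partial>M)"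
proof -
  note [measurable] = cond_versionD(1)[OF q]
  have "integrable M (\<lambda>\<omega>. indicator A (W \<omega>) * q (W \<omega>))"
    using cond_versionD(2,3)[OF q]
    by (intro integrable_const_bound[where B = 1]) (auto elim!: eventually_elim2 split: split_indicator)
  then have "(\<integral>\<^sup>+\<omega>. ennreal (indicator A (W \<omega>) * q (W \<omega>)) \<partial>M)
      = ennreal (\<integral>\<omega>. indicator A (W \<omega>) * q (W \<omega>) \<partial>M)"
    using cond_versionD(2)[OF q]
    by (intro nn_integral_eq_integral) (auto elim!: eventually_mono split: split_indicator)
  moreover have "(\<integral>\<^sup>+\<omega>. ennreal (indicator A (W \<omega>) * q (W \<omega>)) \<partial>M)
      = (\<integral>\<^sup>+\<omega>. ennreal (q (W \<omega>)) * indicator A (W \<omega>) \<partial>M)"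
    by (intro nn_integral_cong) (auto split: split_indicator)
  ultimately show ?thesis
    by (simp add: emeasure_eq_measure cond_versionD(4)[OF q])
qed

text \<open>In this form \<open>q\<close> is the density of the law of \<open>W\<close> on
  \<open>B\<close> with respect to the law of \<open>W\<close>. Integrals and integrability then
  transfer at once to unbounded functions of \<open>W\<close>, such as the logarithms in the
  information.\<close>

lemma cond_version_distr:
  assumes q: "cond_version N W B q" and [measurable]: "W \<in> M \<rightarrow>\<^sub>M N" "B \<in> events"
  shows "distr (density M (indicator B)) N W = density (distr M N W) (\<lambda>w. ennreal (q w))"
proof (rule measure_eqI)
  note [measurable] = cond_versionD(1)[OF q]
  fix A assume "A \<in> sets (distr (density M (indicator B)) N W)"
  then have [measurable]: "A \<in> sets N" by simp
  have "emeasure (distr (density M (indicator B)) N W) A = emeasure M (B \<inter> (W -` A \<inter> space M))"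
    by (simp add: emeasure_distr_density_indicator)
  also have "\<dots> = emeasure (density (distr M N W) (\<lambda>w. ennreal (q w))) A"
    by (simp add: cond_version_nn[OF q] emeasure_density nn_integral_distr)
  finally show "emeasure (distr (density M (indicator B)) N W) A
      = emeasure (density (distr M N W) (\<lambda>w. ennreal (q w))) A" .
qed simp

lemma cond_version_integral:
  fixes h :: "'b \<Rightarrow> real"
  assumes q: "cond_version N W B q" and [measurable]: "W \<in> M \<rightarrow>\<^sub>M N" "B \<in> events" "h \<in> borel_measurable N"
  shows "(\<integral>\<omega>. indicator B \<omega> * h (W \<omega>) \<partial>M) = (\<integral>\<omega>. q (W \<omega>) * h (W \<omega>) \<partial>M)"
proof -
  note [measurable] = cond_versionD(1)[OF q]
  have "(\<integral>\<omega>. indicator B \<omega> * h (W \<omega>) \<partial>M) = (\<integral>w. h w \<partial>distr (density M (indicator B)) N W)"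
    by (simp add: integral_distr density_indicator_real integral_real_density)
  also have "\<dots> = (\<integral>w. q w * h w \<partial>distr M N W)"
    unfolding cond_version_distr[OF q assms(2,3)]
    using cond_versionD(2)[OF q] by (subst integral_real_density) (auto simp: AE_distr_iff)
  also have "\<dots> = (\<integral>\<omega>. q (W \<omega>) * h (W \<omega>) \<partial>M)"
    by (simp add: integral_distr)
  finally show ?thesis .
qed

lemma cond_version_integrable:
  fixes h :: "'b \<Rightarrow> real"
  assumes q: "cond_version N W B q" and [measurable]: "W \<in> M \<rightarrow>\<^sub>M N" "B \<in> events" "h \<in> borel_measurable N"
  shows "integrable M (\<lambda>\<omega>. indicator B \<omega> * h (W \<omega>)) \<longleftrightarrow> integrable M (\<lambda>\<omega>. q (W \<omega>) * h (W \<omega>))"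
proof -
  note [measurable] = cond_versionD(1)[OF q]
  have "integrable M (\<lambda>\<omega>. indicator B \<omega> * h (W \<omega>)) \<longleftrightarrow> integrable (distr (density M (indicator B)) N W) h"
    by (simp add: integrable_distr_eq density_indicator_real integrable_real_density)
  also have "\<dots> \<longleftrightarrow> integrable (distr M N W) (\<lambda>w. q w * h w)"
    unfolding cond_version_distr[OF q assms(2,3)]
    using cond_versionD(2)[OF q] by (subst integrable_real_density) (auto simp: AE_distr_iff)
  also have "\<dots> \<longleftrightarrow> integrable M (\<lambda>\<omega>. q (W \<omega>) * h (W \<omega>))"
    by (simp add: integrable_distr_eq)
  finally show ?thesis .
qed

lemma cond_version_prob:
  assumes q: "cond_version N W B q" and W: "W \<in> M \<rightarrow>\<^sub>M N" and B: "B \<in> events"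
  shows "prob B = (\<integral>\<omega>. q (W \<omega>) \<partial>M)"
  using cond_version_integral[OF q W B, of "\<lambda>_. 1"] B by (simp add: Int_absorb1 sets.sets_into_space)

lemma cond_version_AE_0:
  assumes q: "cond_version N W B q" and W[measurable]: "W \<in> M \<rightarrow>\<^sub>M N" and B: "B \<in> events" "prob B = 0"
  shows "AE \<omega> in M. q (W \<omega>) = 0"
proof -
  note [measurable] = cond_versionD(1)[OF q]
  have "integrable M (\<lambda>\<omega>. q (W \<omega>))"
    using cond_versionD(2,3)[OF q] by (intro integrable_const_bound[where B = 1]) (auto elim!: eventually_elim2)
  then show ?thesis
    using cond_version_prob[OF q W B(1)] B(2) cond_versionD(2)[OF q]
    by (simp add: integral_nonneg_eq_0_iff_AE)
qed

text \<open>Radon-Nikodym for the image under \<open>W\<close> of \<open>M\<close> restricted to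
  \<open>B\<close>. This measure is dominated by the law of \<open>W\<close>, which makes it
  absolutely continuous and its derivative at most 1.\<close>

lemma cond_version_exists:
  assumes W[measurable]: "W \<in> M \<rightarrow>\<^sub>M N" and B[measurable]: "B \<in> events"
  obtains q where "cond_version N W B q"
proof -
  interpret D: prob_space "distr M N W" by (rule prob_space_distr) (rule W)
  let ?\<nu> = "distr (density M (indicator B)) N W"
  have \<nu>: "emeasure ?\<nu> A = emeasure M (B \<inter> (W -` A \<inter> space M))" if [measurable]: "A \<in> sets N" for A
    by (simp add: emeasure_distr_density_indicator)
  have le: "emeasure ?\<nu> A \<le> emeasure (distr M N W) A" if [measurable]: "A \<in> sets N" for A
    by (subst \<nu>) (auto simp: emeasure_distr intro!: emeasure_mono)
  have ac: "absolutely_continuous (distr M N W) ?\<nu>"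
    unfolding absolutely_continuous_def
  proof
    fix A assume A: "A \<in> null_sets (distr M N W)"
    then have "A \<in> sets N" by auto
    with le[of A] A show "A \<in> null_sets ?\<nu>" by (auto simp: null_sets_def)
  qed
  obtain f where f[measurable]: "f \<in> borel_measurable N" and dens: "density (distr M N W) f = ?\<nu>"
    using D.Radon_Nikodym[OF ac] by auto
  have f_int: "emeasure ?\<nu> A = (\<integral>\<^sup>+w. f w * indicator A w \<partial>distr M N W)" if "A \<in> sets N" for A
    using that by (simp add: emeasure_density flip: dens)
  have f_le: "AE w in distr M N W. f w \<le> 1"
  proof (rule ccontr)
    assume not_le: "\<not> (AE w in distr M N W. f w \<le> 1)"
    let ?A = "{w \<in> space N. f w > 1}"
    have [measurable]: "?A \<in> sets N" by measurable
    \<comment> \<open>If the derivative exceeded 1 with positive mass, the restricted measure of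
      \<open>?A\<close> would be strictly larger than its mass under the law of
      \<open>W\<close>.\<close>
    have "(\<integral>\<^sup>+w. indicator ?A w \<partial>distr M N W) < (\<integral>\<^sup>+w. f w * indicator ?A w \<partial>distr M N W)"
    proof (rule nn_integral_less)
      show "(\<integral>\<^sup>+w. indicator ?A w \<partial>distr M N W) \<noteq> \<infinity>"
        using D.emeasure_finite[of ?A] by simp
      show "AE w in distr M N W. indicator ?A w \<le> f w * indicator ?A w"
        by (auto split: split_indicator)
      show "\<not> (AE w in distr M N W. f w * indicator ?A w \<le> indicator ?A w)"
      proof
        assume "AE w in distr M N W. f w * indicator ?A w \<le> indicator ?A w"
        moreover have "AE w in distr M N W. w \<in> space N" by (metis AE_space space_distr)
        ultimately have "AE w in distr M N W. f w \<le> 1"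
          by eventually_elim (auto simp: not_less split: split_indicator_asm)
        with not_le show False by simp
      qed
    qed auto
    also have "\<dots> \<le> emeasure (distr M N W) ?A"
      using le[of ?A] f_int[of ?A] by simp
    finally show False by simp
  qed
  have "cond_version N W B (\<lambda>w. enn2real (f w))"
    unfolding cond_version_def
  proof (intro conjI ballI)
    have AE_f: "AE \<omega> in M. f (W \<omega>) \<le> 1" using f_le by (simp add: AE_distr_iff)
    then have "AE \<omega> in M. enn2real (f (W \<omega>)) \<le> 1"
      by eventually_elim (metis enn2real_mono enn2real_1 ennreal_one_less_top)
    then show "AE \<omega> in M. 0 \<le> enn2real (f (W \<omega>)) \<and> enn2real (f (W \<omega>)) \<le> 1" by simp
    fix A assume A[measurable]: "A \<in> sets N"
    have "ennreal (prob (B \<inter> (W -` A \<inter> space M))) = (\<integral>\<^sup>+\<omega>. f (W \<omega>) * indicator A (W \<omega>) \<partial>M)"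
      using \<nu>[OF A] f_int[OF A] by (simp add: emeasure_eq_measure nn_integral_distr)
    also have "\<dots> = (\<integral>\<^sup>+\<omega>. ennreal (indicator A (W \<omega>) * enn2real (f (W \<omega>))) \<partial>M)"
      using AE_f
    proof (intro nn_integral_cong_AE, eventually_elim)
      fix \<omega> assume "f (W \<omega>) \<le> 1"
      then have "f (W \<omega>) < top" using ennreal_one_less_top by (rule le_less_trans)
      then show "f (W \<omega>) * indicator A (W \<omega>) = ennreal (indicator A (W \<omega>) * enn2real (f (W \<omega>)))"
        by (auto split: split_indicator)
    qed
    finally have eq: "ennreal (prob (B \<inter> (W -` A \<inter> space M)))
        = (\<integral>\<^sup>+\<omega>. ennreal (indicator A (W \<omega>) * enn2real (f (W \<omega>))) \<partial>M)" .
    have "(\<integral>\<omega>. indicator A (W \<omega>) * enn2real (f (W \<omega>)) \<partial>M)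
        = enn2real (\<integral>\<^sup>+\<omega>. ennreal (indicator A (W \<omega>) * enn2real (f (W \<omega>))) \<partial>M)"
      by (intro integral_eq_nn_integral) auto
    then show "prob (B \<inter> (W -` A \<inter> space M)) = (\<integral>\<omega>. indicator A (W \<omega>) * enn2real (f (W \<omega>)) \<partial>M)"
      by (simp flip: eq)
  qed auto
  then show thesis by (rule that)
qed

end

section \<open>The function \<open>x * log b x\<close> on the unit interval\<close>

lemma continuous_on_mult_log:
  fixes b :: real
  shows "continuous_on {0..1} (\<lambda>x. x * log b x)"
  unfolding continuous_on_eq_continuous_within
proof
  fix x :: real assume x: "x \<in> {0..1}"
  show "continuous (at x within {0..1}) (\<lambda>x. x * log b x)"
  proof (cases "x = 0")
    case True
    \<comment> \<open>At 0 the product is 0 whatever value the logarithm has there, and this agrees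
      with the limit from the right.\<close>
    have "((\<lambda>x::real. x * ln x) \<longlongrightarrow> 0) (at_right 0)" by real_asymp
    from tendsto_mult_left[OF this, of "1 / ln b"] have "((\<lambda>x. x * log b x) \<longlongrightarrow> 0) (at_right 0)"
      by (simp add: log_def)
    then show ?thesis
      using True by (simp add: continuous_within at_within_Icc_at_right)
  next
    case False
    then have "isCont (\<lambda>x. x * ln x / ln b) x"
      using x by (cases "ln b = 0") (auto intro!: continuous_intros)
    then have "isCont (\<lambda>x. x * log b x) x" by (simp add: log_def)
    then show ?thesis by (rule continuous_at_imp_continuous_at_within)
  qed
qed

lemma mult_log_bounded:
  fixes b :: real
  obtains C where "C > 0" "\<And>x. 0 \<le> x \<Longrightarrow> x \<le> 1 \<Longrightarrow> \<bar>x * log b x\<bar> \<le> C"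
proof -
  have "compact ((\<lambda>x. x * log b x) ` {0..1::real})"
    by (intro compact_continuous_image continuous_on_mult_log compact_Icc)
  then obtain C where "C > 0" "\<forall>z\<in>(\<lambda>x. x * log b x) ` {0..1}. norm z \<le> C"
    using compact_imp_bounded bounded_pos by blast
  then show thesis by (intro that[of C]) auto
qed

text \<open>For \<open>b > 1\<close> the slope at 0 is infinite, so there is no Lipschitz bound.
  Arguments closer than a modulus \<open>\<delta>\<close> cost \<open>\<epsilon>\<close> by uniform
  continuity; for the others \<open>(x - y)\<^sup>2 \<ge> \<delta>\<^sup>2\<close>, and the trivial
  bound \<open>2 * K\<close> is absorbed in the quadratic term. Mean square convergence of
  conditional probabilities thus carries over to their expected entropies.\<close>

lemma mult_log_diff_le:
  fixes b \<epsilon> :: real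
  assumes "\<epsilon> > 0"
  obtains C where "C > 0" "\<And>x y. 0 \<le> x \<Longrightarrow> x \<le> 1 \<Longrightarrow> 0 \<le> y \<Longrightarrow> y \<le> 1 \<Longrightarrow>
    \<bar>x * log b x - y * log b y\<bar> \<le> \<epsilon> + C * (x - y)\<^sup>2"
proof -
  obtain K where K: "K > 0" "\<And>x. 0 \<le> x \<Longrightarrow> x \<le> 1 \<Longrightarrow> \<bar>x * log b x\<bar> \<le> K"
    using mult_log_bounded[of b] by blast
  have "uniformly_continuous_on {0..1} (\<lambda>x. x * log b x)"
    by (intro compact_uniformly_continuous continuous_on_mult_log compact_Icc)
  then obtain \<delta> where \<delta>: "\<delta> > 0" and close: "\<And>x y. x \<in> {0..1} \<Longrightarrow> y \<in> {0..1} \<Longrightarrow> \<bar>x - y\<bar> < \<delta> \<Longrightarrow>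
      \<bar>x * log b x - y * log b y\<bar> < \<epsilon>"
    using \<open>\<epsilon> > 0\<close> unfolding uniformly_continuous_on_def dist_real_def by (metis abs_minus_commute)
  show thesis
  proof (rule that[of "2 * K / \<delta>\<^sup>2"])
    show "2 * K / \<delta>\<^sup>2 > 0" using K \<delta> by simp
    fix x y :: real assume xy: "0 \<le> x" "x \<le> 1" "0 \<le> y" "y \<le> 1"
    show "\<bar>x * log b x - y * log b y\<bar> \<le> \<epsilon> + 2 * K / \<delta>\<^sup>2 * (x - y)\<^sup>2"
    proof (cases "\<bar>x - y\<bar> < \<delta>")
      case True
      have "0 \<le> 2 * K / \<delta>\<^sup>2 * (x - y)\<^sup>2" using K by simp
      then show ?thesis using close[OF _ _ True] xy by fastforce
    next
      case False
      then have "\<delta>\<^sup>2 \<le> (x - y)\<^sup>2"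
        using \<delta> by (simp flip: abs_le_square_iff)
      then have "2 * K \<le> 2 * K / \<delta>\<^sup>2 * (x - y)\<^sup>2"
        using K \<delta> by (simp add: field_simps)
      then show ?thesis using K(2)[of x] K(2)[of y] xy \<open>\<epsilon> > 0\<close> by linarith
    qed
  qed
qed

section \<open>Mutual information with a finite-valued variable\<close>

context prob_space
begin

lemma cond_version_mult_log_integrable:
  assumes q: "cond_version N W B q" and [measurable]: "W \<in> M \<rightarrow>\<^sub>M N"
  shows "integrable M (\<lambda>\<omega>. q (W \<omega>) * log b (q (W \<omega>)))"
proof -
  note [measurable] = cond_versionD(1)[OF q]
  obtain C where "C > 0" "\<And>x. 0 \<le> x \<Longrightarrow> x \<le> 1 \<Longrightarrow> \<bar>x * log b x\<bar> \<le> C"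
    using mult_log_bounded[of b] by blast
  then show ?thesis
    using cond_versionD(2,3)[OF q]
    by (intro integrable_const_bound[where B = C]) (auto elim!: eventually_elim2)
qed

text \<open>The joint law has density \<open>q s w / a s\<close> with respect to the product of the
  marginals, where \<open>a s\<close> is the probability of the value \<open>s\<close>. Integrating
  the logarithm of this density over the joint law and splitting by the value of \<open>X\<close>
  gives the entropy of \<open>X\<close> minus its expected conditional entropy.\<close>

lemma mutual_information_finite:
  fixes X :: "'a \<Rightarrow> 's"
  assumes b: "b > 1" and S: "finite S" and X[measurable]: "X \<in> M \<rightarrow>\<^sub>M count_space S"
    and W[measurable]: "W \<in> M \<rightarrow>\<^sub>M N"
    and q: "\<And>s. s \<in> S \<Longrightarrow> cond_version N W (X -` {s} \<inter> space M) (q s)"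
  shows "mutual_information b (count_space S) N X W
    = (\<Sum>s\<in>S. \<integral>\<omega>. q s (W \<omega>) * log b (q s (W \<omega>)) \<partial>M)
      - (\<Sum>s\<in>S. prob (X -` {s} \<inter> space M) * log b (prob (X -` {s} \<inter> space M)))"
proof -
  define B where "B s = X -` {s} \<inter> space M" for s
  define a where "a s = prob (B s)" for s
  have q: "cond_version N W (B s) (q s)" if "s \<in> S" for s
    using q[OF that] by (simp add: B_def)
  have X_in: "X \<omega> \<in> S" if "\<omega> \<in> space M" for \<omega>
    using measurable_space[OF X that] by simp
  have B[measurable]: "B s \<in> events" for s
  proof (cases "s \<in> S")
    case False
    then have "B s = {}" using X_in by (auto simp: B_def)
    then show ?thesis by simp
  qed (auto simp: B_def intro: measurable_sets[OF X])
  have [measurable]: "q s \<in> borel_measurable N" if "s \<in> S" for s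
    using cond_versionD(1)[OF q[OF that]] .
  note [measurable_dest] = this
  interpret DX: prob_space "distr M (count_space S) X" by (rule prob_space_distr) (rule X)
  interpret DW: prob_space "distr M N W" by (rule prob_space_distr) (rule W)
  interpret P: pair_prob_space "distr M (count_space S) X" "distr M N W" ..
  let ?\<mu> = "distr M (count_space S) X \<Otimes>\<^sub>M distr M N W"
  let ?J = "distr M (count_space S \<Otimes>\<^sub>M N) (\<lambda>\<omega>. (X \<omega>, W \<omega>))"
  define F where "F = (\<lambda>(s, w). q s w / a s)"
  have F_meas: "F \<in> borel_measurable (count_space S \<Otimes>\<^sub>M N)"
    unfolding F_def
    by (rule measurable_pair_measure_countable1) (use S in \<open>auto intro!: countable_finite\<close>)
  have F_meas'[measurable]: "F \<in> borel_measurable ?\<mu>"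
    using F_meas by (simp cong: measurable_cong_sets)
  have sumX: "(\<integral>\<^sup>+\<omega>. g (X \<omega>) \<partial>M) = (\<Sum>s\<in>S. g s * emeasure M (B s))" for g :: "'s \<Rightarrow> ennreal"
  proof -
    have "(\<integral>\<^sup>+\<omega>. g (X \<omega>) \<partial>M) = (\<integral>\<^sup>+\<omega>. (\<Sum>s\<in>S. g s * indicator (B s) \<omega>) \<partial>M)"
      using S X_in by (intro nn_integral_cong) (auto simp: B_def indicator_def if_distrib sum.delta cong: if_cong)
    also have "\<dots> = (\<Sum>s\<in>S. \<integral>\<^sup>+\<omega>. g s * indicator (B s) \<omega> \<partial>M)"
      by (rule nn_integral_sum) auto
    finally show ?thesis by (simp add: nn_integral_cmult_indicator)
  qed
  have dens: "density ?\<mu> (\<lambda>z. ennreal (F z)) = ?J"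
  proof (rule measure_eqI)
    show sets_eq: "sets (density ?\<mu> (\<lambda>z. ennreal (F z))) = sets ?J"
      by (auto intro!: sets_pair_measure_cong)
    fix A assume "A \<in> sets (density ?\<mu> (\<lambda>z. ennreal (F z)))"
    then have A: "A \<in> sets (count_space S \<Otimes>\<^sub>M N)" unfolding sets_eq by simp
    have [measurable]: "A \<in> sets ?\<mu>" using A by simp
    have As: "Pair s -` A \<in> sets N" for s using sets_Pair1[OF A] .
    have "emeasure (density ?\<mu> (\<lambda>z. ennreal (F z))) A = (\<integral>\<^sup>+z. ennreal (F z) * indicator A z \<partial>?\<mu>)"
      by (rule emeasure_density) auto
    also have "\<dots> = (\<integral>\<^sup>+s. \<integral>\<^sup>+w. ennreal (F (s, w)) * indicator A (s, w) \<partial>distr M N W \<partial>distr M (count_space S) X)"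
      by (rule DW.nn_integral_fst[symmetric]) measurable
    also have "\<dots> = (\<integral>\<^sup>+\<omega>. (\<integral>\<^sup>+w. ennreal (F (X \<omega>, w)) * indicator A (X \<omega>, w) \<partial>distr M N W) \<partial>M)"
      by (rule nn_integral_distr) auto
    also have "\<dots> = (\<Sum>s\<in>S. (\<integral>\<^sup>+w. ennreal (F (s, w)) * indicator A (s, w) \<partial>distr M N W) * emeasure M (B s))"
      by (rule sumX)
    also have "\<dots> = (\<Sum>s\<in>S. emeasure M (B s \<inter> (W -` (Pair s -` A) \<inter> space M)))"
    proof (intro sum.cong refl)
      fix s assume s: "s \<in> S"
      have [measurable]: "q s \<in> borel_measurable N" "Pair s -` A \<in> sets N" using s As by auto
      have "(\<integral>\<^sup>+w. ennreal (F (s, w)) * indicator A (s, w) \<partial>distr M N W)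
          = (\<integral>\<^sup>+w. ennreal (q s w / a s) * indicator (Pair s -` A) w \<partial>distr M N W)"
        by (intro nn_integral_cong) (auto simp: F_def indicator_def)
      also have "\<dots> = (\<integral>\<^sup>+\<omega>. ennreal (q s (W \<omega>) / a s) * indicator (Pair s -` A) (W \<omega>) \<partial>M)"
        by (rule nn_integral_distr) auto
      finally have "(\<integral>\<^sup>+w. ennreal (F (s, w)) * indicator A (s, w) \<partial>distr M N W) * emeasure M (B s)
          = (\<integral>\<^sup>+\<omega>. ennreal (q s (W \<omega>) / a s) * indicator (Pair s -` A) (W \<omega>) \<partial>M) * ennreal (a s)"
        by (simp add: a_def emeasure_eq_measure)
      also have "\<dots> = (\<integral>\<^sup>+\<omega>. ennreal (q s (W \<omega>)) * indicator (Pair s -` A) (W \<omega>) \<partial>M)"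
      proof (cases "a s = 0")
        case True
        \<comment> \<open>A value of probability 0 does no harm: \<open>q s\<close> vanishes almost
          everywhere, in agreement with a quotient by 0 being 0.\<close>
        then have "AE \<omega> in M. q s (W \<omega>) = 0"
          using cond_version_AE_0[OF q[OF s] W B] by (simp add: a_def)
        then have "(\<integral>\<^sup>+\<omega>. ennreal (q s (W \<omega>)) * indicator (Pair s -` A) (W \<omega>) \<partial>M) = (\<integral>\<^sup>+\<omega>. 0 \<partial>M)"
          by (intro nn_integral_cong_AE) (auto elim!: eventually_mono)
        with True show ?thesis by simp
      next
        case False
        then have a_pos: "a s > 0" by (simp add: a_def measure_nonneg less_le)
        have "(\<integral>\<^sup>+\<omega>. ennreal (q s (W \<omega>) / a s) * indicator (Pair s -` A) (W \<omega>) \<partial>M) * ennreal (a s)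
          = (\<integral>\<^sup>+\<omega>. (ennreal (q s (W \<omega>) / a s) * indicator (Pair s -` A) (W \<omega>)) * ennreal (a s) \<partial>M)"
          by (rule nn_integral_multc[symmetric]) measurable
        also have "\<dots> = (\<integral>\<^sup>+\<omega>. ennreal (q s (W \<omega>)) * indicator (Pair s -` A) (W \<omega>) \<partial>M)"
          using a_pos by (intro nn_integral_cong) (auto split: split_indicator simp flip: ennreal_mult'')
        finally show ?thesis .
      qed
      also have "\<dots> = emeasure M (B s \<inter> (W -` (Pair s -` A) \<inter> space M))"
        by (rule cond_version_nn[OF q[OF s], symmetric]) auto
      finally show "(\<integral>\<^sup>+w. ennreal (F (s, w)) * indicator A (s, w) \<partial>distr M N W) * emeasure M (B s)
        = emeasure M (B s \<inter> (W -` (Pair s -` A) \<inter> space M))" .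
    qed
    also have "\<dots> = emeasure M (\<Union>s\<in>S. B s \<inter> (W -` (Pair s -` A) \<inter> space M))"
    proof (rule sum_emeasure)
      show "(\<lambda>s. B s \<inter> (W -` (Pair s -` A) \<inter> space M)) ` S \<subseteq> events"
        using As by auto
      show "disjoint_family_on (\<lambda>s. B s \<inter> (W -` (Pair s -` A) \<inter> space M)) S"
        by (auto simp: disjoint_family_on_def B_def)
    qed (rule S)
    also have "(\<Union>s\<in>S. B s \<inter> (W -` (Pair s -` A) \<inter> space M)) = (\<lambda>\<omega>. (X \<omega>, W \<omega>)) -` A \<inter> space M"
      using X_in by (auto simp: B_def)
    also have "emeasure M \<dots> = emeasure ?J A"
      using A by (intro emeasure_distr[symmetric]) measurable
    finally show "emeasure (density ?\<mu> (\<lambda>z. ennreal (F z))) A = emeasure ?J A" .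
  qed
  have F_nn: "AE z in ?\<mu>. 0 \<le> F z"
  proof -
    have "AE w in distr M N W. \<forall>s\<in>S. 0 \<le> F (s, w)"
      unfolding AE_finite_all[OF S]
    proof
      fix s assume s: "s \<in> S"
      have [measurable]: "q s \<in> borel_measurable N" using s by auto
      show "AE w in distr M N W. 0 \<le> F (s, w)"
        unfolding F_def using cond_versionD(2)[OF q[OF s]]
        by (subst AE_distr_iff) (auto elim!: eventually_mono simp: a_def)
    qed
    then have "AE w in distr M N W. 0 \<le> F (s, w)" if "s \<in> S" for s
      by (rule eventually_mono) (use that in auto)
    then have "AE s in distr M (count_space S) X. AE w in distr M N W. 0 \<le> F (s, w)"
      by (intro AE_I2[where P = "\<lambda>s. AE w in distr M N W. 0 \<le> F (s, w)"]) simp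
    then show ?thesis
      by (intro P.AE_pair_measure) measurable
  qed
  have entropy_term: "integrable M (\<lambda>\<omega>. q s (W \<omega>) * log b (q s (W \<omega>)))" if "s \<in> S" for s
    by (rule cond_version_mult_log_integrable[OF q[OF that] W])
  have log_term: "(\<integral>\<omega>. indicator (B s) \<omega> * log b (q s (W \<omega>) / a s) \<partial>M)
      = (\<integral>\<omega>. q s (W \<omega>) * log b (q s (W \<omega>)) \<partial>M) - a s * log b (a s)"
    and log_term_int: "integrable M (\<lambda>\<omega>. indicator (B s) \<omega> * log b (q s (W \<omega>) / a s))"
    if s: "s \<in> S" for s
  proof -
    have [measurable]: "q s \<in> borel_measurable N" using s by auto
    \<comment> \<open>The logarithm of the quotient splits for positive arguments; where
      \<open>q s\<close> vanishes both sides are 0 because of the factor in front.\<close>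
    have AE_eq: "AE \<omega> in M. q s (W \<omega>) * log b (q s (W \<omega>) / a s)
        = q s (W \<omega>) * log b (q s (W \<omega>)) - q s (W \<omega>) * log b (a s)"
    proof (cases "a s = 0")
      case True
      then have "AE \<omega> in M. q s (W \<omega>) = 0"
        using cond_version_AE_0[OF q[OF s] W B] by (simp add: a_def)
      then show ?thesis by eventually_elim simp
    next
      case False
      then have "a s > 0" by (simp add: a_def measure_nonneg less_le)
      then show ?thesis using cond_versionD(2)[OF q[OF s]] b
        by (auto elim!: eventually_mono simp: log_divide less_le algebra_simps)
    qed
    have q_int: "integrable M (\<lambda>\<omega>. q s (W \<omega>))"
      using cond_versionD(2,3)[OF q[OF s]] by (intro integrable_const_bound[where B = 1]) (auto elim!: eventually_elim2)
    have "(\<integral>\<omega>. indicator (B s) \<omega> * log b (q s (W \<omega>) / a s) \<partial>M)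
        = (\<integral>\<omega>. q s (W \<omega>) * log b (q s (W \<omega>) / a s) \<partial>M)"
      by (rule cond_version_integral[OF q[OF s] W B]) measurable
    also have "\<dots> = (\<integral>\<omega>. q s (W \<omega>) * log b (q s (W \<omega>)) - q s (W \<omega>) * log b (a s) \<partial>M)"
      by (rule integral_cong_AE) (use AE_eq in auto)
    also have "\<dots> = (\<integral>\<omega>. q s (W \<omega>) * log b (q s (W \<omega>)) \<partial>M) - a s * log b (a s)"
      using entropy_term[OF s] q_int cond_version_prob[OF q[OF s] W B]
      by (simp add: a_def)
    finally show "(\<integral>\<omega>. indicator (B s) \<omega> * log b (q s (W \<omega>) / a s) \<partial>M)
      = (\<integral>\<omega>. q s (W \<omega>) * log b (q s (W \<omega>)) \<partial>M) - a s * log b (a s)" .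
    have "integrable M (\<lambda>\<omega>. q s (W \<omega>) * log b (q s (W \<omega>) / a s))
        \<longleftrightarrow> integrable M (\<lambda>\<omega>. q s (W \<omega>) * log b (q s (W \<omega>)) - q s (W \<omega>) * log b (a s))"
      by (rule integrable_cong_AE) (use AE_eq in auto)
    then show "integrable M (\<lambda>\<omega>. indicator (B s) \<omega> * log b (q s (W \<omega>) / a s))"
      using entropy_term[OF s] q_int cond_version_integrable[OF q[OF s] W B, of "\<lambda>w. log b (q s w / a s)"]
      by simp
  qed
  \<comment> \<open>Integrating \<open>F * log b (F z)\<close> over the product of the marginals is
    integrating the logarithm alone over the joint law, which can be pulled back to
    \<open>M\<close>.\<close>
  have "mutual_information b (count_space S) N X W = (\<integral>z. F z * log b (F z) \<partial>?\<mu>)"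
    unfolding mutual_information_def dens[symmetric]
    using b F_nn by (intro P.KL_density) auto
  also have "\<dots> = (\<integral>z. log b (F z) \<partial>?J)"
    unfolding dens[symmetric] using F_nn by (subst integral_real_density) auto
  also have "\<dots> = (\<integral>\<omega>. log b (q (X \<omega>) (W \<omega>) / a (X \<omega>)) \<partial>M)"
    using F_meas by (subst integral_distr) (auto simp: F_def)
  also have "\<dots> = (\<integral>\<omega>. (\<Sum>s\<in>S. indicator (B s) \<omega> * log b (q s (W \<omega>) / a s)) \<partial>M)"
    using S X_in
    by (intro Bochner_Integration.integral_cong) (auto simp: B_def indicator_def if_distrib if_distribR sum.delta cong: if_cong)
  also have "\<dots> = (\<Sum>s\<in>S. \<integral>\<omega>. indicator (B s) \<omega> * log b (q s (W \<omega>) / a s) \<partial>M)"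
    using log_term_int by (intro Bochner_Integration.integral_sum) auto
  also have "\<dots> = (\<Sum>s\<in>S. (\<integral>\<omega>. q s (W \<omega>) * log b (q s (W \<omega>)) \<partial>M) - a s * log b (a s))"
    using log_term by (intro sum.cong) auto
  finally show ?thesis by (simp add: sum_subtractf a_def B_def)
qed


text \<open>Conditional mutual information is the information of \<open>X\<close> with the pair
  \<open>(Y, Z)\<close> minus that with \<open>Z\<close>, so the entropy of \<open>X\<close> itself
  cancels. Hypothesis \<open>dev\<close> applied to the difference of the two conditional
  probabilities bounds its mean square by \<open>e\<close>, and \<open>C\<close> converts mean
  square into entropy.\<close>

lemma conditional_mutual_information_finite_le:
  fixes X :: "'a \<Rightarrow> 's" and b C e \<epsilon> :: real
  assumes b: "b > 1" and S: "finite S" and X: "X \<in> M \<rightarrow>\<^sub>M count_space S"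
    and Y[measurable]: "Y \<in> M \<rightarrow>\<^sub>M NY" and Z[measurable]: "Z \<in> M \<rightarrow>\<^sub>M NZ"
    and q: "\<And>s. s \<in> S \<Longrightarrow> cond_version NZ Z (X -` {s} \<inter> space M) (q s)"
    and dev: "\<And>s G. s \<in> S \<Longrightarrow> G \<in> borel_measurable (NY \<Otimes>\<^sub>M NZ) \<Longrightarrow> (\<And>z. \<bar>G z\<bar> \<le> 1) \<Longrightarrow>
      \<bar>\<integral>\<omega>. G (Y \<omega>, Z \<omega>) * (indicator (X -` {s} \<inter> space M) \<omega> - q s (Z \<omega>)) \<partial>M\<bar> \<le> e"
    and C: "C > 0" "\<And>x y. 0 \<le> x \<Longrightarrow> x \<le> 1 \<Longrightarrow> 0 \<le> y \<Longrightarrow> y \<le> 1 \<Longrightarrow>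
      \<bar>x * log b x - y * log b y\<bar> \<le> \<epsilon> + C * (x - y)\<^sup>2"
  shows "\<bar>conditional_mutual_information b (count_space S) NY NZ X Y Z\<bar> \<le> card S * (\<epsilon> + C * e)"
proof -
  let ?B = "\<lambda>s. X -` {s} \<inter> space M" and ?W = "\<lambda>\<omega>. (Y \<omega>, Z \<omega>)"
  have W[measurable]: "?W \<in> M \<rightarrow>\<^sub>M NY \<Otimes>\<^sub>M NZ" by measurable
  have B: "?B s \<in> events" if "s \<in> S" for s
    using that by (intro measurable_sets[OF X]) auto
  have "\<exists>q'. \<forall>s\<in>S. cond_version (NY \<Otimes>\<^sub>M NZ) ?W (?B s) (q' s)"
    using cond_version_exists[OF W B] by (intro bchoice) metis
  then obtain q' where q': "\<And>s. s \<in> S \<Longrightarrow> cond_version (NY \<Otimes>\<^sub>M NZ) ?W (?B s) (q' s)"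
    by blast
  have bound: "\<bar>(\<integral>\<omega>. q' s (?W \<omega>) * log b (q' s (?W \<omega>)) \<partial>M) - (\<integral>\<omega>. q s (Z \<omega>) * log b (q s (Z \<omega>)) \<partial>M)\<bar>
      \<le> \<epsilon> + C * e" if s: "s \<in> S" for s
  proof -
    note [measurable] = cond_versionD(1)[OF q[OF s]] cond_versionD(1)[OF q'[OF s]] B[OF s]
    \<comment> \<open>Clipping changes nothing almost everywhere, but \<open>dev\<close> asks for
      test functions that are bounded by 1 at every point.\<close>
    define G where "G = (\<lambda>(y, z). max (-1) (min 1 (q' s (y, z) - q s z)))"
    have G_meas[measurable]: "G \<in> borel_measurable (NY \<Otimes>\<^sub>M NZ)"
      unfolding G_def by measurable
    have G_bound: "\<bar>G z\<bar> \<le> 1" for z by (auto simp: G_def split: prod.splits)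
    have G_eq: "AE \<omega> in M. G (?W \<omega>) = q' s (?W \<omega>) - q s (Z \<omega>)"
      using cond_versionD(2,3)[OF q[OF s]] cond_versionD(2,3)[OF q'[OF s]]
      by eventually_elim (auto simp: G_def)
    have int_q: "integrable M (\<lambda>\<omega>. G (?W \<omega>) * q s (Z \<omega>))"
      using cond_versionD(2,3)[OF q[OF s]] G_bound
      by (intro integrable_const_bound[where B = 1])
        (auto elim!: eventually_elim2 simp: abs_mult intro!: mult_le_one)
    have int_q': "integrable M (\<lambda>\<omega>. G (?W \<omega>) * q' s (?W \<omega>))"
      using cond_versionD(2,3)[OF q'[OF s]] G_bound
      by (intro integrable_const_bound[where B = 1])
        (auto elim!: eventually_elim2 simp: abs_mult intro!: mult_le_one)
    have int_B: "integrable M (\<lambda>\<omega>. G (?W \<omega>) * indicator (?B s) \<omega>)"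
      using G_bound
      by (intro integrable_const_bound[where B = 1]) (auto simp: abs_mult split: split_indicator)
    have "(\<integral>\<omega>. (q' s (?W \<omega>) - q s (Z \<omega>))\<^sup>2 \<partial>M)
        = (\<integral>\<omega>. G (?W \<omega>) * q' s (?W \<omega>) - G (?W \<omega>) * q s (Z \<omega>) \<partial>M)"
      by (rule integral_cong_AE) (use G_eq in \<open>auto elim!: eventually_mono simp flip: right_diff_distrib simp: power2_eq_square\<close>)
    also have "\<dots> = (\<integral>\<omega>. G (?W \<omega>) * q' s (?W \<omega>) \<partial>M) - (\<integral>\<omega>. G (?W \<omega>) * q s (Z \<omega>) \<partial>M)"
      using int_q int_q' by simp
    \<comment> \<open>\<open>G\<close> is composed with the pair \<open>?W\<close> on which
      \<open>q' s\<close> conditions, so \<open>q' s\<close> may be traded for the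
      indicator.\<close>
    also have "(\<integral>\<omega>. G (?W \<omega>) * q' s (?W \<omega>) \<partial>M) = (\<integral>\<omega>. G (?W \<omega>) * indicator (?B s) \<omega> \<partial>M)"
      using cond_version_integral[OF q'[OF s] W B[OF s] G_meas] by (simp add: mult.commute)
    also have "\<dots> - (\<integral>\<omega>. G (?W \<omega>) * q s (Z \<omega>) \<partial>M)
        = (\<integral>\<omega>. G (?W \<omega>) * (indicator (?B s) \<omega> - q s (Z \<omega>)) \<partial>M)"
      using int_q int_B by (simp add: right_diff_distrib)
    also have "\<dots> \<le> e" using dev[OF s G_meas G_bound] by simp
    finally have sq: "(\<integral>\<omega>. (q' s (?W \<omega>) - q s (Z \<omega>))\<^sup>2 \<partial>M) \<le> e" .
    have int_sq: "integrable M (\<lambda>\<omega>. (q' s (?W \<omega>) - q s (Z \<omega>))\<^sup>2)"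
    proof (rule integrable_const_bound[where B = 1])
      show "AE \<omega> in M. norm ((q' s (?W \<omega>) - q s (Z \<omega>))\<^sup>2) \<le> 1"
        using G_eq by eventually_elim (metis G_bound abs_square_le_1 norm_power real_norm_def power2_abs)
    qed measurable
    have int_l: "integrable M (\<lambda>\<omega>. q' s (?W \<omega>) * log b (q' s (?W \<omega>)))"
      "integrable M (\<lambda>\<omega>. q s (Z \<omega>) * log b (q s (Z \<omega>)))"
      using cond_version_mult_log_integrable[OF q'[OF s] W] cond_version_mult_log_integrable[OF q[OF s] Z] by auto
    have "\<bar>(\<integral>\<omega>. q' s (?W \<omega>) * log b (q' s (?W \<omega>)) \<partial>M) - (\<integral>\<omega>. q s (Z \<omega>) * log b (q s (Z \<omega>)) \<partial>M)\<bar>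
        = \<bar>\<integral>\<omega>. q' s (?W \<omega>) * log b (q' s (?W \<omega>)) - q s (Z \<omega>) * log b (q s (Z \<omega>)) \<partial>M\<bar>"
      using int_l by simp
    also have "\<dots> \<le> (\<integral>\<omega>. \<bar>q' s (?W \<omega>) * log b (q' s (?W \<omega>)) - q s (Z \<omega>) * log b (q s (Z \<omega>))\<bar> \<partial>M)"
      by (rule integral_abs_bound)
    also have "\<dots> \<le> (\<integral>\<omega>. \<epsilon> + C * (q' s (?W \<omega>) - q s (Z \<omega>))\<^sup>2 \<partial>M)"
    proof (rule integral_mono_AE)
      show "AE \<omega> in M. \<bar>q' s (?W \<omega>) * log b (q' s (?W \<omega>)) - q s (Z \<omega>) * log b (q s (Z \<omega>))\<bar>
          \<le> \<epsilon> + C * (q' s (?W \<omega>) - q s (Z \<omega>))\<^sup>2"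
        using cond_versionD(2,3)[OF q[OF s]] cond_versionD(2,3)[OF q'[OF s]]
        by eventually_elim (rule C(2))
    qed (use int_l int_sq in auto)
    also have "\<dots> = \<epsilon> + C * (\<integral>\<omega>. (q' s (?W \<omega>) - q s (Z \<omega>))\<^sup>2 \<partial>M)"
      using int_sq by (simp add: prob_space)
    also have "\<dots> \<le> \<epsilon> + C * e" using sq C(1) by simp
    finally show ?thesis .
  qed
  have "conditional_mutual_information b (count_space S) NY NZ X Y Z
    = (\<Sum>s\<in>S. (\<integral>\<omega>. q' s (?W \<omega>) * log b (q' s (?W \<omega>)) \<partial>M) - (\<integral>\<omega>. q s (Z \<omega>) * log b (q s (Z \<omega>)) \<partial>M))"
    unfolding conditional_mutual_information_def
    by (subst mutual_information_finite[OF b S X W q'], assumption,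
        subst mutual_information_finite[OF b S X Z q], assumption) (simp add: sum_subtractf)
  also have "\<bar>\<dots>\<bar> \<le> (\<Sum>s\<in>S. \<epsilon> + C * e)"
    by (rule order.trans[OF sum_abs sum_mono]) (rule bound)
  finally show ?thesis by simp
qed

end

section \<open>Joint law of parameters, paths and permutation\<close>

lemma measurable_trans_prob[measurable]:
  fixes Ed :: "'s rel"
  shows "(\<lambda>p. trans_prob E Ed p i j) \<in> borel_measurable (param_space Ed)"
proof -
  have [measurable]: "(\<lambda>p. p e) \<in> borel_measurable (param_space Ed)" if "e \<in> Ed" for e :: "'s \<times> 's"
    using measurable_component_singleton[OF that, of "\<lambda>_. lborel"] by simp
  have "(\<lambda>p. \<Sum>j' | (i, j') \<in> Ed. p (i, j')) \<in> borel_measurable (param_space Ed)"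
    by (intro borel_measurable_sum) auto
  then show ?thesis
    unfolding trans_prob_def by (cases "(i, j) \<in> Ed") auto
qed

lemma measurable_path_weight[measurable]:
  "(\<lambda>p. path_weight s (trans_prob E Ed p) K x) \<in> borel_measurable (param_space Ed)"
  unfolding path_weight_def by measurable

lemma acceptable_trans_prob:
  assumes "p \<in> acceptable E Ed" "Ed \<subseteq> E"
  shows "0 \<le> trans_prob E Ed p i j" "trans_prob E Ed p i j \<le> 1"
proof -
  have "0 \<le> trans_prob E Ed p i j \<and> trans_prob E Ed p i j \<le> 1"
  proof (cases "(i, j) \<in> E")
    case True
    then show ?thesis using assms(1) by (auto simp: acceptable_def)
  qed (use assms(2) in \<open>auto simp: trans_prob_def\<close>)
  then show "0 \<le> trans_prob E Ed p i j" "trans_prob E Ed p i j \<le> 1" by auto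
qed

lemma sets_Collect_eq_count_space:
  assumes "f \<in> N \<rightarrow>\<^sub>M count_space S"
  shows "{\<omega> \<in> space N. f \<omega> = c} \<in> sets N"
proof -
  have "{\<omega> \<in> space N. f \<omega> = c} = f -` ({c} \<inter> S) \<inter> space N"
    using measurable_space[OF assms] by auto
  also have "\<dots> \<in> sets N" using assms by (rule measurable_sets) simp
  finally show ?thesis .
qed

lemma measurable_funcset: "f \<in> M \<rightarrow>\<^sub>M N \<Longrightarrow> f \<in> space M \<rightarrow> space N"
  by (simp add: measurable_def)

lemma subalgebra_vimage_algebra:
  "f \<in> M \<rightarrow>\<^sub>M N \<Longrightarrow> subalgebra M (vimage_algebra (space M) f N)"
  by (simp add: subalgebra_def sets_image_in_sets)

context anonymized_markov_users
begin

text \<open>This and \<open>past_algebra\<close> are the sigma-algebras in the model assumptions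
  \<open>chains_cond_indep\<close> and \<open>markov\<close>, which are applied by unfolding the two
  names: all parameter vectors, and in addition the path of user \<open>u\<close> up to time
  \<open>k\<close>.\<close>

definition param_algebra :: "'a measure" where
  "param_algebra = vimage_algebra (space M) (\<lambda>\<omega>. \<lambda>v\<in>{1..}. P v \<omega>) (PiM {1..} (\<lambda>_. param_space Ed))"

definition past_algebra :: "nat \<Rightarrow> nat \<Rightarrow> 'a measure" where
  "past_algebra u k = vimage_algebra (space M)
     (\<lambda>\<omega>. (\<lambda>v\<in>{1..}. P v \<omega>, \<lambda>l\<in>{1..k}. X u l \<omega>))
     (PiM {1..} (\<lambda>_. param_space Ed) \<Otimes>\<^sub>M PiM {1..k} (\<lambda>_. count_space {1..r}))"

abbreviation path_law :: "(nat \<times> nat \<Rightarrow> real) \<Rightarrow> nat \<Rightarrow> (nat \<Rightarrow> nat) \<Rightarrow> real" where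
  "path_law p \<equiv> path_weight 1 (trans_prob E Ed p)"

abbreviation paths :: "nat \<Rightarrow> (nat \<Rightarrow> nat) set" where
  "paths K \<equiv> {1..K} \<rightarrow>\<^sub>E {1..r}"

definition path_event :: "nat \<Rightarrow> nat \<Rightarrow> (nat \<Rightarrow> nat) \<Rightarrow> 'a set" where
  "path_event u K x = {\<omega> \<in> space M. \<forall>l\<in>{1..K}. X u l \<omega> = x l}"

lemma space_param_algebra[simp]: "space param_algebra = space M"
  by (simp add: param_algebra_def)

lemma space_past_algebra[simp]: "space (past_algebra u k) = space M"
  by (simp add: past_algebra_def)

lemma Ed_subset: "Ed \<subseteq> E"
  using free by (simp add: free_edges_def)

lemma finite_E: "finite E"
  by (rule finite_subset[OF edges]) simp

lemma measurable_P[measurable]: "u \<ge> 1 \<Longrightarrow> P u \<in> M \<rightarrow>\<^sub>M param_space Ed"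
  using params_density by (rule distributed_measurable)

lemma measurable_X[measurable]: "u \<ge> 1 \<Longrightarrow> k \<ge> 1 \<Longrightarrow> X u k \<in> M \<rightarrow>\<^sub>M count_space {1..r}"
  by (rule location_measurable)

lemma measurable_all_params[measurable]:
  "(\<lambda>\<omega>. \<lambda>v\<in>{1..}. P v \<omega>) \<in> M \<rightarrow>\<^sub>M PiM {1..} (\<lambda>_. param_space Ed)"
  by (rule measurable_restrict) simp

lemma subalgebra_param: "subalgebra M param_algebra"
  unfolding param_algebra_def by (intro subalgebra_vimage_algebra measurable_all_params)

lemma subalgebra_past: "u \<ge> 1 \<Longrightarrow> subalgebra M (past_algebra u k)"
  unfolding past_algebra_def
  by (intro subalgebra_vimage_algebra measurable_Pair measurable_all_params measurable_restrict measurable_X) auto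

lemma measurable_all_params_param_algebra:
  "(\<lambda>\<omega>. \<lambda>v\<in>{1..}. P v \<omega>) \<in> param_algebra \<rightarrow>\<^sub>M PiM {1..} (\<lambda>_. param_space Ed)"
  unfolding param_algebra_def
  by (intro measurable_vimage_algebra1 measurable_funcset measurable_all_params)

lemma measurable_P_param_algebra:
  assumes "u \<ge> 1"
  shows "P u \<in> param_algebra \<rightarrow>\<^sub>M param_space Ed"
  using measurable_compose[OF measurable_all_params_param_algebra, OF measurable_component_singleton, of u] assms
  by simp

lemma measurable_past_pair:
  assumes "u \<ge> 1"
  shows "(\<lambda>\<omega>. (\<lambda>v\<in>{1..}. P v \<omega>, \<lambda>l\<in>{1..k}. X u l \<omega>)) \<in> past_algebra u k
    \<rightarrow>\<^sub>M PiM {1..} (\<lambda>_. param_space Ed) \<Otimes>\<^sub>M PiM {1..k} (\<lambda>_. count_space {1..r})"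
  unfolding past_algebra_def
proof (rule measurable_vimage_algebra1)
  have "(\<lambda>\<omega>. (\<lambda>v\<in>{1..}. P v \<omega>, \<lambda>l\<in>{1..k}. X u l \<omega>)) \<in> M
    \<rightarrow>\<^sub>M PiM {1..} (\<lambda>_. param_space Ed) \<Otimes>\<^sub>M PiM {1..k} (\<lambda>_. count_space {1..r})"
    using assms by (intro measurable_Pair measurable_all_params measurable_restrict measurable_X) auto
  then show "(\<lambda>\<omega>. (\<lambda>v\<in>{1..}. P v \<omega>, \<lambda>l\<in>{1..k}. X u l \<omega>)) \<in> space M
    \<rightarrow> space (PiM {1..} (\<lambda>_. param_space Ed) \<Otimes>\<^sub>M PiM {1..k} (\<lambda>_. count_space {1..r}))"
    by (rule measurable_funcset)
qed

lemma subalgebra_past_param: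
  assumes "u \<ge> 1"
  shows "subalgebra (past_algebra u k) param_algebra"
proof -
  have "(\<lambda>\<omega>. \<lambda>v\<in>{1..}. P v \<omega>) \<in> past_algebra u k \<rightarrow>\<^sub>M PiM {1..} (\<lambda>_. param_space Ed)"
    using measurable_compose[OF measurable_past_pair[OF assms] measurable_fst] by simp
  then show ?thesis
    using subalgebra_vimage_algebra[of _ "past_algebra u k"] by (simp add: param_algebra_def)
qed

lemma path_event_past:
  assumes "u \<ge> 1"
  shows "path_event u k x \<in> sets (past_algebra u k)"
proof -
  have [measurable]: "X u l \<in> past_algebra u k \<rightarrow>\<^sub>M count_space {1..r}" if "l \<in> {1..k}" for l
    using measurable_compose[OF measurable_compose[OF measurable_past_pair[OF assms] measurable_snd]
        measurable_component_singleton[OF that]] that by simp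
  then have "{\<omega> \<in> space (past_algebra u k). X u l \<omega> = x l} \<in> sets (past_algebra u k)" if "l \<in> {1..k}" for l
    using that by (intro sets_Collect_eq_count_space[where S = "{1..r}"]) auto
  then have "{\<omega> \<in> space (past_algebra u k). \<forall>l\<in>{1..k}. X u l \<omega> = x l} \<in> sets (past_algebra u k)"
    by (intro sets.sets_Collect_finite_All) auto
  also have "{\<omega> \<in> space (past_algebra u k). \<forall>l\<in>{1..k}. X u l \<omega> = x l} = path_event u k x"
    by (simp add: path_event_def)
  finally show ?thesis .
qed

lemma path_event_chain:
  assumes "u \<ge> 1"
  shows "path_event u k x \<in> sets (vimage_algebra (space M) (\<lambda>\<omega>. \<lambda>k\<in>{1..}. X u k \<omega>)
    (PiM {1..} (\<lambda>_. count_space {1..r})))" (is "_ \<in> sets ?V")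
proof -
  have "(\<lambda>\<omega>. \<lambda>k\<in>{1..}. X u k \<omega>) \<in> M \<rightarrow>\<^sub>M PiM {1..} (\<lambda>_. count_space {1..r})"
    using assms by (intro measurable_restrict measurable_X) auto
  then have V: "(\<lambda>\<omega>. \<lambda>k\<in>{1..}. X u k \<omega>) \<in> ?V \<rightarrow>\<^sub>M PiM {1..} (\<lambda>_. count_space {1..r})"
    by (intro measurable_vimage_algebra1 measurable_funcset)
  have [measurable]: "X u l \<in> ?V \<rightarrow>\<^sub>M count_space {1..r}" if "l \<in> {1..}" for l
    using measurable_compose[OF V measurable_component_singleton[OF that]] that by simp
  then have "{\<omega> \<in> space ?V. X u l \<omega> = x l} \<in> sets ?V" if "l \<in> {1..k}" for l
    using that by (intro sets_Collect_eq_count_space[where S = "{1..r}"]) auto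
  then have "{\<omega> \<in> space ?V. \<forall>l\<in>{1..k}. X u l \<omega> = x l} \<in> sets ?V"
    by (intro sets.sets_Collect_finite_All) auto
  also have "{\<omega> \<in> space ?V. \<forall>l\<in>{1..k}. X u l \<omega> = x l} = path_event u k x"
    by (simp add: path_event_def)
  finally show ?thesis .
qed

lemma path_event_sets[measurable]: "u \<ge> 1 \<Longrightarrow> path_event u k x \<in> events"
  using path_event_past subalgebra_past unfolding subalgebra_def by blast

lemma AE_acceptable:
  assumes "u \<ge> 1"
  shows "AE \<omega> in M. P u \<omega> \<in> acceptable E Ed"
proof -
  have [measurable]: "(\<lambda>p. ennreal (f p)) \<in> borel_measurable (param_space Ed)"
    using distributed_borel_measurable[OF params_density[OF assms]] .
  have "AE p in density (param_space Ed) (\<lambda>p. ennreal (f p)). p \<in> acceptable E Ed"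
  proof (subst AE_density)
    show "AE p in param_space Ed. 0 < ennreal (f p) \<longrightarrow> p \<in> acceptable E Ed"
    proof (intro AE_I2 impI, rule ccontr)
      fix p assume "p \<in> space (param_space Ed)" "0 < ennreal (f p)" "p \<notin> acceptable E Ed"
      then show False using density_zero[of p] by simp
    qed
  qed measurable
  then have "AE p in distr M (param_space Ed) (P u). p \<in> acceptable E Ed"
    unfolding distributed_distr_eq_density[OF params_density[OF assms]] .
  then show ?thesis
    by (rule AE_distrD[OF measurable_P[OF assms]])
qed

text \<open>Induction along the path. The Markov assumption conditions on the parameters and on the
  past of the chain; the tower property then removes the past.\<close>

lemma cond_prob_path_event:
  assumes u: "u \<ge> 1" and "K \<ge> 1" and x: "x \<in> paths K"
  shows "AE \<omega> in M. cond_prob M param_algebra (path_event u K x) \<omega> = path_law (P u \<omega>) K x"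
proof -
  interpret param: finite_measure_subalgebra M param_algebra
    by unfold_locales (rule subalgebra_param)
  have x_in: "x l \<in> {1..r}" if "l \<in> {1..K}" for l using x that by auto
  have [measurable]: "(\<lambda>\<omega>. trans_prob E Ed (P u \<omega>) i j) \<in> borel_measurable param_algebra" for i j
    by (rule measurable_compose[OF measurable_P_param_algebra[OF u] measurable_trans_prob])
  \<comment> \<open>\<open>x\<close> stays a fixed path of length \<open>K\<close> and only its
    initial segments vary, so the next state \<open>x (Suc k)\<close> is known to lie in the state
    space.\<close>
  have "k \<le> K \<Longrightarrow> AE \<omega> in M. cond_prob M param_algebra (path_event u k x) \<omega> = path_law (P u \<omega>) k x"
    if "k \<ge> 1" for k
    using that
  proof (induction k rule: dec_induct)
    case base
    have "AE \<omega> in M. indicator (path_event u 1 x) \<omega> = (of_bool (x 1 = 1) :: real)"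
      using initial[OF u] AE_space by eventually_elim (auto simp: path_event_def indicator_def)
    then have "AE \<omega> in M. cond_prob M param_algebra (path_event u 1 x) \<omega>
        = real_cond_exp M param_algebra (\<lambda>_. of_bool (x 1 = 1)) \<omega>"
      using u by (intro param.real_cond_exp_cong) auto
    moreover have "AE \<omega> in M. real_cond_exp M param_algebra (\<lambda>_. of_bool (x 1 = 1)) \<omega> = of_bool (x 1 = 1)"
      by (rule param.real_cond_exp_F_meas) auto
    ultimately show ?case
      unfolding path_weight_1 by eventually_elim simp
  next
    case (step k)
    interpret past: finite_measure_subalgebra M "past_algebra u k"
      by unfold_locales (rule subalgebra_past[OF u])
    let ?A = "path_event u k x" and ?B = "{\<omega> \<in> space M. X u (Suc k) \<omega> = x (Suc k)}"
    let ?t = "\<lambda>\<omega>. trans_prob E Ed (P u \<omega>) (x k) (x (Suc k))"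
    have [measurable]: "?B \<in> events"
      using u by (intro sets_Collect_eq_count_space[OF measurable_X]) auto
    have [measurable]: "?A \<in> events"
      using u by (rule path_event_sets)
    have [measurable]: "?A \<in> sets (past_algebra u k)" by (rule path_event_past[OF u])
    have t_meas[measurable]: "?t \<in> borel_measurable M"
      using u by (intro measurable_compose[OF measurable_P measurable_trans_prob])
    have A_int: "integrable M (indicator ?A :: 'a \<Rightarrow> real)" and B_int: "integrable M (indicator ?B :: 'a \<Rightarrow> real)"
      and AB_int: "integrable M (\<lambda>\<omega>. indicator ?A \<omega> * indicator ?B \<omega> :: real)"
      by (auto simp: less_top[symmetric] intro!: integrable_real_mult_indicator)
    have AX: "X u k \<omega> = x k" if "\<omega> \<in> ?A" for \<omega>
      using that step.hyps by (auto simp: path_event_def)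
    have AB: "indicator (path_event u (Suc k) x) \<omega> = (indicator ?A \<omega> * indicator ?B \<omega> :: real)" for \<omega>
      by (auto simp: path_event_def indicator_def atLeastAtMostSuc_conv)
    have "AE \<omega> in M. cond_prob M (past_algebra u k) (path_event u (Suc k) x) \<omega>
        = indicator ?A \<omega> * cond_prob M (past_algebra u k) ?B \<omega>"
      unfolding AB by (rule past.real_cond_exp_mult) (use AB_int in auto)
    moreover have "AE \<omega> in M. cond_prob M (past_algebra u k) ?B \<omega>
        = trans_prob E Ed (P u \<omega>) (X u k \<omega>) (x (Suc k))"
      unfolding past_algebra_def using u step.hyps step.prems x_in[of "Suc k"] 
      by (intro markov[unfolded Suc_eq_plus1[symmetric]]) auto
    \<comment> \<open>On \<open>?A\<close> the current location is \<open>x k\<close>, which leaves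
      a transition probability that depends on the parameters alone and can be taken out of the
      outer conditional expectation.\<close>
    ultimately have past_eq: "AE \<omega> in M. cond_prob M (past_algebra u k) (path_event u (Suc k) x) \<omega>
        = ?t \<omega> * indicator ?A \<omega>"
      by eventually_elim (use AX in \<open>auto simp: indicator_def\<close>)
    have "AE \<omega> in M. real_cond_exp M param_algebra (cond_prob M (past_algebra u k) (path_event u (Suc k) x)) \<omega>
        = cond_prob M param_algebra (path_event u (Suc k) x) \<omega>"
      using u by (intro param.real_cond_exp_nested_subalg subalgebra_past subalgebra_past_param)
        (auto simp: less_top[symmetric])
    moreover have "AE \<omega> in M. real_cond_exp M param_algebra (cond_prob M (past_algebra u k) (path_event u (Suc k) x)) \<omega>
        = real_cond_exp M param_algebra (\<lambda>\<omega>. ?t \<omega> * indicator ?A \<omega>) \<omega>"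
      by (rule param.real_cond_exp_cong[OF past_eq]) auto
    moreover have "AE \<omega> in M. real_cond_exp M param_algebra (\<lambda>\<omega>. ?t \<omega> * indicator ?A \<omega>) \<omega>
        = ?t \<omega> * cond_prob M param_algebra ?A \<omega>"
    proof (rule param.real_cond_exp_mult)
      show "integrable M (\<lambda>\<omega>. ?t \<omega> * indicator ?A \<omega>)"
      proof (rule integrable_const_bound[where B = 1])
        show "AE \<omega> in M. norm (?t \<omega> * indicator ?A \<omega>) \<le> 1"
          using AE_acceptable[OF u]
          by eventually_elim (auto simp: indicator_def acceptable_trans_prob[OF _ Ed_subset])
      qed measurable
    qed measurable
    moreover have "AE \<omega> in M. cond_prob M param_algebra ?A \<omega> = path_law (P u \<omega>) k x"
      using step by simp
    ultimately show ?case
      by eventually_elim (use step.hyps in \<open>simp add: path_weight_Suc mult.commute\<close>)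
  qed
  from this[OF \<open>K \<ge> 1\<close>] show ?thesis by simp
qed


section \<open>Conditioning on the parameters of the first \<open>n\<close> users\<close>

definition params :: "nat \<Rightarrow> 'a \<Rightarrow> nat \<Rightarrow> nat \<times> nat \<Rightarrow> real" where
  "params n \<omega> = (\<lambda>u\<in>{1..n}. P u \<omega>)"

lemma measurable_params[measurable]: "params n \<in> M \<rightarrow>\<^sub>M PiM {1..n} (\<lambda>_. param_space Ed)"
  unfolding params_def by (intro measurable_restrict measurable_P) auto

lemma measurable_path_law_component:
  assumes "u \<in> I"
  shows "(\<lambda>p. path_law (p u) K x) \<in> borel_measurable (PiM I (\<lambda>_. param_space Ed))"
  using measurable_compose[OF measurable_component_singleton[OF assms, of "\<lambda>_. param_space Ed"]
      measurable_path_weight] by simp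

lemma params_event_param_algebra:
  assumes "A \<in> sets (PiM {1..n} (\<lambda>_. param_space Ed))"
  shows "params n -` A \<inter> space M \<in> sets param_algebra"
proof -
  have "params n \<in> param_algebra \<rightarrow>\<^sub>M PiM {1..n} (\<lambda>_. param_space Ed)"
    unfolding params_def by (intro measurable_restrict measurable_P_param_algebra) auto
  from measurable_sets[OF this assms] show ?thesis by simp
qed

lemma AE_path_law:
  assumes "u \<ge> 1"
  shows "AE \<omega> in M. \<forall>x\<in>paths K. 0 \<le> path_law (P u \<omega>) K x \<and> path_law (P u \<omega>) K x \<le> 1"
  using AE_acceptable[OF assms]
  by eventually_elim
    (auto intro!: path_weight_nonneg[where S = "{1..r}"] path_weight_le_1[where S = "{1..r}"]
      simp: acceptable_trans_prob[OF _ Ed_subset] simp del: One_nat_def)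

lemma cond_prob_paths:
  assumes J: "J \<subseteq> {1..}" "finite J" "J \<noteq> {}" and K: "K \<ge> 1" and x: "\<And>u. u \<in> J \<Longrightarrow> x u \<in> paths K"
  shows "AE \<omega> in M. cond_prob M param_algebra (\<Inter>u\<in>J. path_event u K (x u)) \<omega>
    = (\<Prod>u\<in>J. path_law (P u \<omega>) K (x u))"
proof -
  have "AE \<omega> in M. \<forall>u\<in>J. cond_prob M param_algebra (path_event u K (x u)) \<omega> = path_law (P u \<omega>) K (x u)"
    using J K x by (subst AE_finite_all) (auto intro!: cond_prob_path_event simp del: One_nat_def)
  moreover have "AE \<omega> in M. cond_prob M param_algebra (\<Inter>u\<in>J. path_event u K (x u)) \<omega>
    = (\<Prod>u\<in>J. cond_prob M param_algebra (path_event u K (x u)) \<omega>)"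
    unfolding param_algebra_def
    by (rule chains_cond_indep[OF J]) (use J in \<open>auto intro!: path_event_chain simp del: One_nat_def\<close>)
  ultimately show ?thesis by eventually_elim simp
qed

text \<open>The model conditions on the parameter vectors of all users, the mutual information on
  the first \<open>n\<close>. The passage works because the product of path laws involves users in
  \<open>{1..n}\<close> only, and events of \<open>params n\<close> belong to
  \<open>param_algebra\<close>.\<close>

lemma cond_version_paths:
  assumes J: "J \<subseteq> {1..n}" "J \<noteq> {}" and K: "K \<ge> 1" and x: "\<And>u. u \<in> J \<Longrightarrow> x u \<in> paths K"
  shows "cond_version (PiM {1..n} (\<lambda>_. param_space Ed)) (params n) (\<Inter>u\<in>J. path_event u K (x u))
    (\<lambda>p. \<Prod>u\<in>J. path_law (p u) K (x u))"
  unfolding cond_version_def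
proof (intro conjI ballI)
  interpret param: finite_measure_subalgebra M param_algebra
    by unfold_locales (rule subalgebra_param)
  let ?N = "PiM {1..n} (\<lambda>_. param_space Ed)" and ?C = "\<Inter>u\<in>J. path_event u K (x u)"
  have finJ: "finite J" using J finite_subset by blast
  have J1: "J \<subseteq> {1..}" using J by auto
  have C[measurable]: "?C \<in> events"
    using J finJ by (intro sets.finite_INT path_event_sets) auto
  show "(\<lambda>p. \<Prod>u\<in>J. path_law (p u) K (x u)) \<in> borel_measurable ?N"
    using J by (intro borel_measurable_prod measurable_path_law_component) auto
  have "AE \<omega> in M. \<forall>u\<in>J. \<forall>x\<in>paths K. 0 \<le> path_law (P u \<omega>) K x \<and> path_law (P u \<omega>) K x \<le> 1"
    using J1 finJ AE_path_law by (subst AE_finite_all) auto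
  then show "AE \<omega> in M. 0 \<le> (\<Prod>u\<in>J. path_law (params n \<omega> u) K (x u)) \<and>
      (\<Prod>u\<in>J. path_law (params n \<omega> u) K (x u)) \<le> 1"
    by eventually_elim (use J x in \<open>auto simp: params_def subset_iff intro!: prod_nonneg prod_le_1\<close>)
  fix A assume A: "A \<in> sets ?N"
  let ?A = "params n -` A \<inter> space M"
  have A_param[measurable]: "?A \<in> sets param_algebra" by (rule params_event_param_algebra[OF A])
  have [measurable]: "?A \<in> events" using A by measurable
  have "prob (?C \<inter> ?A) = (\<integral>\<omega>. indicator (?A \<inter> ?C) \<omega> \<partial>M)"
    by (simp add: Int_ac)
  also have "\<dots> = (\<integral>\<omega>. indicator ?A \<omega> * indicator ?C \<omega> \<partial>M)"
    by (simp add: indicator_inter_arith)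
  also have "\<dots> = (\<integral>\<omega>. indicator ?A \<omega> * cond_prob M param_algebra ?C \<omega> \<partial>M)"
    by (rule param.real_cond_exp_intg(2)[symmetric])
      (auto simp: less_top[symmetric] intro!: integrable_real_mult_indicator)
  also have "\<dots> = (\<integral>\<omega>. indicator A (params n \<omega>) * (\<Prod>u\<in>J. path_law (params n \<omega> u) K (x u)) \<partial>M)"
  proof (rule integral_cong_AE)
    have "AE \<omega> in M. cond_prob M param_algebra ?C \<omega> = (\<Prod>u\<in>J. path_law (P u \<omega>) K (x u))"
      using J1 finJ J(2) K x by (rule cond_prob_paths)
    then show "AE \<omega> in M. indicator ?A \<omega> * cond_prob M param_algebra ?C \<omega>
        = indicator A (params n \<omega>) * (\<Prod>u\<in>J. path_law (params n \<omega> u) K (x u))"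
      using AE_space
    proof eventually_elim
      fix \<omega> assume \<omega>: "\<omega> \<in> space M"
        and eq: "cond_prob M param_algebra ?C \<omega> = (\<Prod>u\<in>J. path_law (P u \<omega>) K (x u))"
      have "(\<Prod>u\<in>J. path_law (P u \<omega>) K (x u)) = (\<Prod>u\<in>J. path_law (params n \<omega> u) K (x u))"
        using J by (intro prod.cong) (auto simp: params_def)
      with eq \<omega> show "indicator ?A \<omega> * cond_prob M param_algebra ?C \<omega>
        = indicator A (params n \<omega>) * (\<Prod>u\<in>J. path_law (params n \<omega> u) K (x u))"
        by (simp add: indicator_def)
    qed
    have [measurable]: "(\<lambda>\<omega>. \<Prod>u\<in>J. path_law (params n \<omega> u) K (x u)) \<in> borel_measurable M"
      using J by (intro borel_measurable_prod measurable_compose[OF measurable_params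
            measurable_path_law_component]) auto
    show "(\<lambda>\<omega>. indicator A (params n \<omega>) * (\<Prod>u\<in>J. path_law (params n \<omega> u) K (x u))) \<in> borel_measurable M"
      using A by measurable
  qed measurable
  finally show "prob (?C \<inter> ?A)
    = (\<integral>\<omega>. indicator A (params n \<omega>) * (\<Prod>u\<in>J. path_law (params n \<omega> u) K (x u)) \<partial>M)" .
qed

section \<open>Including the permutation\<close>

definition shuffled_event :: "nat \<Rightarrow> nat \<Rightarrow> (nat \<Rightarrow> nat \<Rightarrow> nat) \<Rightarrow> (nat \<Rightarrow> nat) \<Rightarrow> 'a set" where
  "shuffled_event n K x \<pi> = {\<omega> \<in> space M. perm n \<omega> = \<pi>} \<inter> (\<Inter>u\<in>{1..n}. path_event u K (x u))"

lemma perm_event_sets[measurable]: "n \<ge> 1 \<Longrightarrow> {\<omega> \<in> space M. perm n \<omega> = \<pi>} \<in> events"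
  using permutation_measurable by (rule sets_Collect_eq_count_space)

lemma prob_perm:
  assumes "n \<ge> 1" "\<pi> permutes {1..n}"
  shows "prob {\<omega> \<in> space M. perm n \<omega> = \<pi>} = 1 / fact n"
proof -
  let ?S = "{\<pi>. \<pi> permutes {1..n}}"
  have "prob {\<omega> \<in> space M. perm n \<omega> = \<pi>} = measure (distr M (count_space ?S) (perm n)) {\<pi>}"
    using assms permutation_measurable[OF assms(1)]
    by (subst measure_distr) (auto intro!: arg_cong[where f = prob])
  also have "\<dots> = 1 / card ?S"
    unfolding permutation_uniform[OF assms(1)]
    using assms by (subst measure_uniform_count_measure) (auto simp: finite_permutations)
  also have "card ?S = fact n"
    by (rule card_permutations) auto
  finally show ?thesis by simp
qed

text \<open>Path events and events of \<open>params n\<close> both lie in the sigma-algebra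
  \<open>?V\<close> from which \<open>permutation_indep\<close> makes the permutation independent,
  so fixing the permutation just contributes the factor \<open>1 / fact n\<close>.\<close>

lemma cond_version_shuffled:
  assumes n: "n \<ge> 1" and K: "K \<ge> 1" and x: "x \<in> {1..n} \<rightarrow>\<^sub>E paths K" and \<pi>: "\<pi> permutes {1..n}"
  shows "cond_version (PiM {1..n} (\<lambda>_. param_space Ed)) (params n) (shuffled_event n K x \<pi>)
    (\<lambda>p. 1 / fact n * (\<Prod>u\<in>{1..n}. path_law (p u) K (x u)))"
proof -
  let ?N = "PiM {1..n} (\<lambda>_. param_space Ed)" and ?C = "\<Inter>u\<in>{1..n}. path_event u K (x u)"
  let ?q = "\<lambda>p. \<Prod>u\<in>{1..n}. path_law (p u) K (x u)" and ?D = "{\<omega> \<in> space M. perm n \<omega> = \<pi>}"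
  have q: "cond_version ?N (params n) ?C ?q"
    using n K x by (intro cond_version_paths) (auto simp: PiE_mem simp del: One_nat_def)
  let ?V = "vimage_algebra (space M)
          (\<lambda>\<omega>. (\<lambda>u\<in>{1..}. P u \<omega>, \<lambda>u\<in>{1..}. \<lambda>k\<in>{1..}. X u k \<omega>))
          (PiM {1..} (\<lambda>_. param_space Ed) \<Otimes>\<^sub>M PiM {1..} (\<lambda>_. PiM {1..} (\<lambda>_. count_space {1..r})))"
  have "(\<lambda>\<omega>. (\<lambda>u\<in>{1..}. P u \<omega>, \<lambda>u\<in>{1..}. \<lambda>k\<in>{1..}. X u k \<omega>)) \<in> M \<rightarrow>\<^sub>M
          PiM {1..} (\<lambda>_. param_space Ed) \<Otimes>\<^sub>M PiM {1..} (\<lambda>_. PiM {1..} (\<lambda>_. count_space {1..r}))"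
    by (intro measurable_Pair measurable_all_params measurable_restrict measurable_X) auto
  then have V: "(\<lambda>\<omega>. (\<lambda>u\<in>{1..}. P u \<omega>, \<lambda>u\<in>{1..}. \<lambda>k\<in>{1..}. X u k \<omega>)) \<in> ?V \<rightarrow>\<^sub>M
          PiM {1..} (\<lambda>_. param_space Ed) \<Otimes>\<^sub>M PiM {1..} (\<lambda>_. PiM {1..} (\<lambda>_. count_space {1..r}))"
    by (intro measurable_vimage_algebra1 measurable_funcset)
  have XV: "X u l \<in> ?V \<rightarrow>\<^sub>M count_space {1..r}" if "u \<in> {1..}" "l \<in> {1..}" for u l
    using measurable_compose[OF measurable_compose[OF measurable_compose[OF V measurable_snd]
        measurable_component_singleton[OF that(1)]] measurable_component_singleton[OF that(2)]] that
    by simp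
  have PV: "params n \<in> ?V \<rightarrow>\<^sub>M ?N"
    unfolding params_def
  proof (intro measurable_restrict)
    fix u assume "u \<in> {1..n}"
    then have u: "u \<in> {1..}" by simp
    show "P u \<in> ?V \<rightarrow>\<^sub>M param_space Ed"
      using measurable_compose[OF measurable_compose[OF V measurable_fst] measurable_component_singleton[OF u]] u
      by simp
  qed
  have "{\<omega> \<in> space ?V. X u l \<omega> = x u l} \<in> sets ?V" if "u \<in> {1..n}" "l \<in> {1..K}" for u l
    using that by (intro sets_Collect_eq_count_space[OF XV]) auto
  then have "{\<omega> \<in> space ?V. \<forall>u\<in>{1..n}. \<forall>l\<in>{1..K}. X u l \<omega> = x u l} \<in> sets ?V"
    by (intro sets.sets_Collect_finite_All) auto
  also have "{\<omega> \<in> space ?V. \<forall>u\<in>{1..n}. \<forall>l\<in>{1..K}. X u l \<omega> = x u l} = ?C"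
    using n by (auto simp: path_event_def)
  finally have CV: "?C \<in> sets ?V" .
  have DV: "?D \<in> sets (vimage_algebra (space M) (perm n) (count_space {\<pi>. \<pi> permutes {1..n}}))"
    using sets_Collect_eq_count_space[OF measurable_vimage_algebra1[OF measurable_funcset[OF permutation_measurable[OF n]]], of \<pi>]
    by simp
  have prob: "prob (shuffled_event n K x \<pi> \<inter> (params n -` A \<inter> space M))
      = 1 / fact n * prob (?C \<inter> (params n -` A \<inter> space M))" if A: "A \<in> sets ?N" for A
  proof -
    have "params n -` A \<inter> space M \<in> sets ?V"
      using measurable_sets[OF PV A] by simp
    with CV have "?C \<inter> (params n -` A \<inter> space M) \<in> sets ?V" by (rule sets.Int)
    from indep_setD[OF permutation_indep[OF n] DV this]
    show ?thesis
      by (simp add: shuffled_event_def Int_assoc prob_perm[OF n \<pi>])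
  qed
  show ?thesis
    unfolding cond_version_def
  proof (intro conjI ballI)
    show "(\<lambda>p. 1 / fact n * ?q p) \<in> borel_measurable ?N"
      by (intro borel_measurable_times borel_measurable_const cond_versionD(1)[OF q])
    show "AE \<omega> in M. 0 \<le> 1 / fact n * ?q (params n \<omega>) \<and> 1 / fact n * ?q (params n \<omega>) \<le> 1"
      using cond_versionD(2,3)[OF q]
    proof eventually_elim
      case (elim \<omega>)
      have "1 / fact n * ?q (params n \<omega>) \<le> 1 * 1"
        using elim by (intro mult_mono) (auto simp: fact_ge_1)
      then show ?case using elim by simp
    qed
    fix A assume A: "A \<in> sets ?N"
    show "prob (shuffled_event n K x \<pi> \<inter> (params n -` A \<inter> space M))
        = (\<integral>\<omega>. indicator A (params n \<omega>) * (1 / fact n * ?q (params n \<omega>)) \<partial>M)"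
      unfolding prob[OF A] cond_versionD(4)[OF q A]
      by (simp flip: integral_mult_right_zero add: mult_ac)
  qed
qed


definition user_paths :: "nat \<Rightarrow> nat \<Rightarrow> 'a \<Rightarrow> nat \<Rightarrow> nat \<Rightarrow> nat" where
  "user_paths n K \<omega> = (\<lambda>u\<in>{1..n}. \<lambda>l\<in>{1..K}. X u l \<omega>)"

lemma X_in: "\<omega> \<in> space M \<Longrightarrow> u \<ge> 1 \<Longrightarrow> k \<ge> 1 \<Longrightarrow> X u k \<omega> \<in> {1..r}"
  using measurable_space[OF measurable_X] by simp

lemma user_paths_in: "\<omega> \<in> space M \<Longrightarrow> user_paths n K \<omega> \<in> {1..n} \<rightarrow>\<^sub>E paths K"
  unfolding user_paths_def by (intro restrict_PiE_iff[THEN iffD2] ballI X_in) auto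

lemma perm_permutes: "n \<ge> 1 \<Longrightarrow> \<omega> \<in> space M \<Longrightarrow> perm n \<omega> permutes {1..n}"
  using measurable_space[OF permutation_measurable] by simp

lemma path_event_iff:
  assumes "\<omega> \<in> space M" "x \<in> paths K"
  shows "\<omega> \<in> path_event u K x \<longleftrightarrow> x = (\<lambda>l\<in>{1..K}. X u l \<omega>)"
proof
  assume "\<omega> \<in> path_event u K x"
  then show "x = (\<lambda>l\<in>{1..K}. X u l \<omega>)"
    using PiE_arb[OF assms(2)] by (intro ext) (auto simp: path_event_def)
qed (use assms in \<open>auto simp: path_event_def\<close>)

lemma shuffled_event_iff:
  assumes "\<omega> \<in> space M" "x \<in> {1..n} \<rightarrow>\<^sub>E paths K" "n \<ge> 1"
  shows "\<omega> \<in> shuffled_event n K x \<pi> \<longleftrightarrow> \<pi> = perm n \<omega> \<and> x = user_paths n K \<omega>"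
proof -
  have "(\<forall>u\<in>{1..n}. \<omega> \<in> path_event u K (x u)) \<longleftrightarrow> (\<forall>u\<in>{1..n}. x u = (\<lambda>l\<in>{1..K}. X u l \<omega>))"
    using assms by (intro ball_cong path_event_iff) (auto simp: PiE_mem)
  also have "\<dots> \<longleftrightarrow> x = user_paths n K \<omega>"
    using assms(2) by (auto simp: user_paths_def fun_eq_iff PiE_iff extensional_def)
  finally show ?thesis using assms by (auto simp: shuffled_event_def)
qed

lemma shuffled_event_sets[measurable]: "n \<ge> 1 \<Longrightarrow> shuffled_event n K x \<pi> \<in> events"
  unfolding shuffled_event_def
  by (intro sets.Int perm_event_sets sets.finite_INT path_event_sets) auto

text \<open>Paths and permutations take finitely many values, so the expectation splits over the
  events \<open>shuffled_event\<close>, and on each of them the indicator is replaced by its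
  conditional probability. This leads from the probability space to the finite sums over
  permutations and paths, taken at fixed parameters. The bound on \<open>H\<close> is asked for
  almost everywhere because the location law is known to lie in [0, 1] for acceptable
  parameters.\<close>

lemma integral_shuffled:
  fixes H :: "(nat \<Rightarrow> nat \<times> nat \<Rightarrow> real) \<Rightarrow> (nat \<Rightarrow> nat \<Rightarrow> nat) \<Rightarrow> (nat \<Rightarrow> nat) \<Rightarrow> real"
  assumes n: "n \<ge> 1" and K: "K \<ge> 1"
    and H: "\<And>x \<pi>. x \<in> {1..n} \<rightarrow>\<^sub>E paths K \<Longrightarrow> \<pi> permutes {1..n} \<Longrightarrow>
      (\<lambda>p. H p x \<pi>) \<in> borel_measurable (PiM {1..n} (\<lambda>_. param_space Ed))"
    and H_bound: "\<And>x \<pi>. x \<in> {1..n} \<rightarrow>\<^sub>E paths K \<Longrightarrow> \<pi> permutes {1..n} \<Longrightarrow>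
      AE \<omega> in M. \<bar>H (params n \<omega>) x \<pi>\<bar> \<le> C"
  shows "(\<integral>\<omega>. H (params n \<omega>) (user_paths n K \<omega>) (perm n \<omega>) \<partial>M)
    = (\<integral>\<omega>. (\<Sum>\<pi> | \<pi> permutes {1..n}. \<Sum>x\<in>{1..n} \<rightarrow>\<^sub>E paths K.
        (\<Prod>u\<in>{1..n}. path_law (params n \<omega> u) K (x u)) * H (params n \<omega>) x \<pi>) / fact n \<partial>M)"
    (is "_ = ?rhs")
proof -
  let ?S = "{\<pi>. \<pi> permutes {1..n}}" and ?T = "{1..n} \<rightarrow>\<^sub>E paths K"
  let ?q = "\<lambda>x p. 1 / fact n * (\<Prod>u\<in>{1..n}. path_law (p u) K (x u))"
  have fin: "finite ?S" "finite ?T" by (auto simp: finite_permutations intro!: finite_PiE)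
  have int: "integrable M (\<lambda>\<omega>. indicator (shuffled_event n K x \<pi>) \<omega> * H (params n \<omega>) x \<pi>)"
    if x: "x \<in> ?T" and \<pi>: "\<pi> permutes {1..n}" for x \<pi>
  proof (rule integrable_const_bound[where B = C])
    show "AE \<omega> in M. norm (indicator (shuffled_event n K x \<pi>) \<omega> * H (params n \<omega>) x \<pi>) \<le> C"
      using H_bound[OF x \<pi>] by eventually_elim (auto simp: indicator_def)
    show "(\<lambda>\<omega>. indicator (shuffled_event n K x \<pi>) \<omega> * H (params n \<omega>) x \<pi>) \<in> borel_measurable M"
      using n measurable_compose[OF measurable_params H[OF x \<pi>]] by measurable
  qed
  have int_q: "integrable M (\<lambda>\<omega>. ?q x (params n \<omega>) * H (params n \<omega>) x \<pi>)"
    if "x \<in> ?T" "\<pi> permutes {1..n}" for x \<pi>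
    using cond_version_integrable[OF cond_version_shuffled[OF n K that] measurable_params shuffled_event_sets[OF n] H[OF that]]
      int[OF that] by simp
  have "(\<integral>\<omega>. H (params n \<omega>) (user_paths n K \<omega>) (perm n \<omega>) \<partial>M)
    = (\<integral>\<omega>. (\<Sum>\<pi>\<in>?S. \<Sum>x\<in>?T. indicator (shuffled_event n K x \<pi>) \<omega> * H (params n \<omega>) x \<pi>) \<partial>M)"
  proof (rule Bochner_Integration.integral_cong[OF refl])
    fix \<omega> assume \<omega>: "\<omega> \<in> space M"
    have "(\<Sum>\<pi>\<in>?S. \<Sum>x\<in>?T. indicator (shuffled_event n K x \<pi>) \<omega> * H (params n \<omega>) x \<pi>)
      = (\<Sum>\<pi>\<in>?S. \<Sum>x\<in>?T. if \<pi> = perm n \<omega> then if x = user_paths n K \<omega> then H (params n \<omega>) x \<pi> else 0 else 0)"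
      using \<omega> n by (intro sum.cong refl) (auto simp: indicator_def shuffled_event_iff)
    also have "\<dots> = (\<Sum>\<pi>\<in>?S. if \<pi> = perm n \<omega> then (\<Sum>x\<in>?T. if x = user_paths n K \<omega> then H (params n \<omega>) x \<pi> else 0) else 0)"
      by (intro sum.cong) auto
    also have "\<dots> = H (params n \<omega>) (user_paths n K \<omega>) (perm n \<omega>)"
      using fin perm_permutes[OF n \<omega>] user_paths_in[OF \<omega>, of n K] by simp
    finally show "H (params n \<omega>) (user_paths n K \<omega>) (perm n \<omega>)
      = (\<Sum>\<pi>\<in>?S. \<Sum>x\<in>?T. indicator (shuffled_event n K x \<pi>) \<omega> * H (params n \<omega>) x \<pi>)" ..
  qed
  also have "\<dots> = (\<Sum>\<pi>\<in>?S. \<Sum>x\<in>?T. \<integral>\<omega>. indicator (shuffled_event n K x \<pi>) \<omega> * H (params n \<omega>) x \<pi> \<partial>M)"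
    using int by (subst Bochner_Integration.integral_sum) (auto intro!: sum.cong Bochner_Integration.integral_sum)
  also have "\<dots> = (\<Sum>\<pi>\<in>?S. \<Sum>x\<in>?T. \<integral>\<omega>. ?q x (params n \<omega>) * H (params n \<omega>) x \<pi> \<partial>M)"
  proof (intro sum.cong refl)
    fix \<pi> x assume "\<pi> \<in> ?S" and x: "x \<in> ?T"
    then have \<pi>: "\<pi> permutes {1..n}" by simp
    show "(\<integral>\<omega>. indicator (shuffled_event n K x \<pi>) \<omega> * H (params n \<omega>) x \<pi> \<partial>M)
        = (\<integral>\<omega>. ?q x (params n \<omega>) * H (params n \<omega>) x \<pi> \<partial>M)"
      by (rule cond_version_integral[OF cond_version_shuffled[OF n K x \<pi>] measurable_params
            shuffled_event_sets[OF n] H[OF x \<pi>]])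
  qed
  also have "\<dots> = (\<integral>\<omega>. (\<Sum>\<pi>\<in>?S. \<Sum>x\<in>?T. ?q x (params n \<omega>) * H (params n \<omega>) x \<pi>) \<partial>M)"
    using int_q by (subst Bochner_Integration.integral_sum) (auto intro!: sum.cong Bochner_Integration.integral_sum[symmetric])
  also have "\<dots> = ?rhs"
    by (simp add: sum_divide_distrib)
  finally show ?thesis .
qed

text \<open>The marginal at time \<open>k\<close> is taken from paths of a length \<open>K\<close>,
  later \<open>m + k\<close>, so that the location at time \<open>k\<close> and the \<open>m\<close>
  observed rows are functions of one and the same path.\<close>

definition location_law :: "nat \<Rightarrow> nat \<Rightarrow> nat \<Rightarrow> (nat \<times> nat \<Rightarrow> real) \<Rightarrow> real" where
  "location_law K k s p = (\<Sum>y\<in>paths K. path_law p K y * of_bool (y k = s))"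

lemma AE_location_law:
  assumes "K \<ge> 1" "u \<ge> 1" "r \<ge> 1"
  shows "AE \<omega> in M. 0 \<le> location_law K k s (P u \<omega>) \<and> location_law K k s (P u \<omega>) \<le> 1"
  using AE_acceptable[OF assms(2)]
proof eventually_elim
  fix \<omega> assume p: "P u \<omega> \<in> acceptable E Ed"
  have nn: "0 \<le> path_law (P u \<omega>) K y" if "y \<in> paths K" for y
    using acceptable_trans_prob[OF p Ed_subset] that by (intro path_weight_nonneg)
  have "location_law K k s (P u \<omega>) \<le> (\<Sum>y\<in>paths K. path_law (P u \<omega>) K y)"
    unfolding location_law_def using nn by (intro sum_mono) auto
  also have "\<dots> = 1"
    using assms edges free by (intro sum_path_weight) (auto intro!: sum_trans_prob simp del: One_nat_def)
  finally show "0 \<le> location_law K k s (P u \<omega>) \<and> location_law K k s (P u \<omega>) \<le> 1"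
    using nn by (auto simp: location_law_def intro!: sum_nonneg)
qed

lemma measurable_location_law[measurable]:
  "location_law K k s \<in> borel_measurable (param_space Ed)"
  unfolding location_law_def by measurable

text \<open>The event is the disjoint union of the path events of those paths of length
  \<open>K\<close> that are at \<open>s\<close> at time \<open>k\<close>.\<close>

lemma cond_version_location:
  assumes n: "n \<ge> 1" and k: "1 \<le> k" "k \<le> K" and r: "r \<ge> 1"
  shows "cond_version (PiM {1..n} (\<lambda>_. param_space Ed)) (params n) (X 1 k -` {s} \<inter> space M)
    (\<lambda>p. location_law K k s (p 1))"
proof -
  let ?N = "PiM {1..n} (\<lambda>_. param_space Ed)" and ?S = "{y \<in> paths K. y k = s}"
  have K: "K \<ge> 1" using k by simp
  have one: "(1::nat) \<in> {1..n}" using n by simp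
  have version: "cond_version ?N (params n) (path_event 1 K y) (\<lambda>p. path_law (p 1) K y)" if "y \<in> paths K" for y
    using cond_version_paths[of "{1}" n K "\<lambda>_. y"] one K that by simp
  have fin: "finite ?S" by (simp add: finite_PiE)
  show ?thesis
    unfolding cond_version_def
  proof (intro conjI ballI)
    show "(\<lambda>p. location_law K k s (p 1)) \<in> borel_measurable ?N"
      using measurable_compose[OF measurable_component_singleton[OF one, of "\<lambda>_. param_space Ed"] measurable_location_law]
      by simp
    show "AE \<omega> in M. 0 \<le> location_law K k s (params n \<omega> 1) \<and> location_law K k s (params n \<omega> 1) \<le> 1"
      using AE_location_law[OF K _ r, of 1] one by (simp add: params_def)
    fix A assume A: "A \<in> sets ?N"
    have A_event[measurable]: "params n -` A \<inter> space M \<in> events" using A by measurable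
    have path: "(\<lambda>\<omega>. path_law (params n \<omega> 1) K y) \<in> borel_measurable M" for y
      by (rule measurable_compose[OF measurable_params measurable_path_law_component[OF one]])
    have int: "integrable M (\<lambda>\<omega>. indicator A (params n \<omega>) * path_law (params n \<omega> 1) K y)" if "y \<in> paths K" for y
    proof (rule integrable_const_bound[where B = 1])
      show "AE \<omega> in M. norm (indicator A (params n \<omega>) * path_law (params n \<omega> 1) K y) \<le> 1"
        using cond_versionD(2,3)[OF version[OF that]] by eventually_elim (auto simp: indicator_def)
    qed (use path A in measurable)
    have split: "X 1 k -` {s} \<inter> space M \<inter> (params n -` A \<inter> space M)
        = (\<Union>y\<in>?S. path_event 1 K y \<inter> (params n -` A \<inter> space M))"
    proof (intro set_eqI iffI)
      fix \<omega> assume \<omega>: "\<omega> \<in> X 1 k -` {s} \<inter> space M \<inter> (params n -` A \<inter> space M)"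
      then have "(\<lambda>l\<in>{1..K}. X 1 l \<omega>) \<in> ?S" using k X_in[of \<omega> 1] by auto
      moreover have "\<omega> \<in> path_event 1 K (\<lambda>l\<in>{1..K}. X 1 l \<omega>)" using \<omega> by (auto simp: path_event_def)
      ultimately show "\<omega> \<in> (\<Union>y\<in>?S. path_event 1 K y \<inter> (params n -` A \<inter> space M))" using \<omega> by blast
    qed (use k in \<open>auto simp: path_event_def\<close>)
    have "prob (X 1 k -` {s} \<inter> space M \<inter> (params n -` A \<inter> space M))
        = (\<Sum>y\<in>?S. prob (path_event 1 K y \<inter> (params n -` A \<inter> space M)))"
      unfolding split
    proof (rule finite_measure_finite_Union[OF fin])
      show "(\<lambda>y. path_event 1 K y \<inter> (params n -` A \<inter> space M)) ` ?S \<subseteq> events"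
        using path_event_sets[of 1] A_event by auto
      show "disjoint_family_on (\<lambda>y. path_event 1 K y \<inter> (params n -` A \<inter> space M)) ?S"
        unfolding disjoint_family_on_def by (auto simp: path_event_iff simp del: One_nat_def)
    qed
    also have "\<dots> = (\<Sum>y\<in>?S. \<integral>\<omega>. indicator A (params n \<omega>) * path_law (params n \<omega> 1) K y \<partial>M)"
    proof (rule sum.cong[OF refl])
      fix y assume "y \<in> ?S"
      then have "y \<in> paths K" by simp
      from cond_versionD(4)[OF version[OF this] A]
      show "prob (path_event 1 K y \<inter> (params n -` A \<inter> space M))
          = (\<integral>\<omega>. indicator A (params n \<omega>) * path_law (params n \<omega> 1) K y \<partial>M)" .
    qed
    also have "\<dots> = (\<integral>\<omega>. (\<Sum>y\<in>?S. indicator A (params n \<omega>) * path_law (params n \<omega> 1) K y) \<partial>M)"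
      using int by (intro Bochner_Integration.integral_sum[symmetric]) auto
    also have "\<dots> = (\<integral>\<omega>. indicator A (params n \<omega>) * location_law K k s (params n \<omega> 1) \<partial>M)"
      unfolding location_law_def
      by (simp add: sum_distrib_left sum.inter_filter[symmetric] finite_PiE of_bool_def if_distrib mult.assoc cong: if_cong)
    finally show "prob (X 1 k -` {s} \<inter> space M \<inter> (params n -` A \<inter> space M))
      = (\<integral>\<omega>. indicator A (params n \<omega>) * location_law K k s (params n \<omega> 1) \<partial>M)" .
  qed
qed

lemma measurable_anonymized_obs:
  assumes n: "n \<ge> 1"
  shows "anonymized_obs X perm n m \<in> M \<rightarrow>\<^sub>M obs_space r n m"
  unfolding anonymized_obs_def
proof (intro measurable_restrict)
  fix j k assume j: "j \<in> {1..n}" and k: "k \<in> {1..m}"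
  show "(\<lambda>\<omega>. X (inv (perm n \<omega>) j) k \<omega>) \<in> M \<rightarrow>\<^sub>M count_space {1..r}"
  proof (rule measurable_compose_countable'[OF _ permutation_measurable[OF n]])
    fix \<pi> assume "\<pi> \<in> {\<pi>. \<pi> permutes {1..n}}"
    then have "\<pi> permutes {1..n}" by simp
    from permutes_in_image[OF permutes_inv[OF this], of j] j have "inv \<pi> j \<in> {1..n}" by simp
    then show "X (inv \<pi> j) k \<in> M \<rightarrow>\<^sub>M count_space {1..r}" using k by (intro measurable_X) auto
  qed (simp add: finite_permutations countable_finite)
qed

end

section \<open>Cells of the parameter space\<close>

text \<open>By exchangeability every index has the same expected share, and the shares in one cell
  add up to 1, or to 0 for an empty cell, where \<open>0 / 0 = 0\<close>.\<close>

lemma expectation_cell_share_le: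
  fixes \<kappa> :: "'x \<Rightarrow> 'c"
  assumes \<mu>: "prob_space \<mu>" and I: "finite I" "i \<in> I"
    and \<kappa>: "{x \<in> space \<mu>. \<kappa> x = c} \<in> sets \<mu>"
  shows "(\<integral>p. of_bool (\<kappa> (p i) = c) / (\<Sum>v\<in>I. of_bool (\<kappa> (p v) = c)) \<partial>PiM I (\<lambda>_. \<mu>)) \<le> 1 / card I"
proof -
  let ?D = "PiM I (\<lambda>_. \<mu>)"
  interpret \<mu>: prob_space \<mu> by (rule \<mu>)
  interpret D: prob_space ?D by (intro prob_space_PiM \<mu>)
  define N where "N p = (\<Sum>v\<in>I. of_bool (\<kappa> (p v) = c) :: real)" for p
  define h where "h u p = of_bool (\<kappa> (p u) = c) / N p" for u p
  have ind_meas: "(\<lambda>p. of_bool (\<kappa> (p u) = c) :: real) \<in> borel_measurable ?D" if "u \<in> I" for u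
  proof -
    have "(\<lambda>x. indicator {x \<in> space \<mu>. \<kappa> x = c} x :: real) \<in> borel_measurable \<mu>"
      using \<kappa> by measurable
    from measurable_compose[OF measurable_component_singleton[OF that, of "\<lambda>_. \<mu>"] this]
    show ?thesis
      by (rule measurable_cong[THEN iffD1, rotated]) (use that in \<open>auto simp: indicator_def space_PiM\<close>)
  qed
  then have h_meas: "h u \<in> borel_measurable ?D" if "u \<in> I" for u
    unfolding h_def N_def using that by (intro borel_measurable_divide borel_measurable_sum) auto
  have h01: "0 \<le> h u p \<and> h u p \<le> 1" if "u \<in> I" for u p
  proof -
    have "of_bool (\<kappa> (p u) = c) \<le> N p"
      unfolding N_def using I that by (intro member_le_sum) auto
    moreover have "0 \<le> N p" by (auto simp: N_def intro: sum_nonneg)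
    ultimately show ?thesis
      unfolding h_def by (auto simp: divide_le_eq_1)
  qed
  have h_int: "integrable ?D (h u)" if "u \<in> I" for u
    using h01[OF that] h_meas[OF that] by (intro D.integrable_const_bound[where B = 1]) auto
  have swap: "(\<integral>p. h u p \<partial>?D) = (\<integral>p. h i p \<partial>?D)" if u: "u \<in> I" for u
  proof -
    let ?t = "Transposition.transpose i u"
    have t: "?t permutes I" using I u by (intro permutes_swap_id)
    have t_in: "?t v \<in> I" if "v \<in> I" for v using permutes_in_image[OF t] that by simp
    have distr: "distr ?D ?D (\<lambda>p. \<lambda>v\<in>I. p (?t v)) = ?D"
      using distr_PiM_reindex[of I "\<lambda>_. \<mu>" ?t I] \<mu> permutes_inj_on[OF t, of I] t_in by auto
    have meas: "(\<lambda>p. \<lambda>v\<in>I. p (?t v)) \<in> ?D \<rightarrow>\<^sub>M ?D"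
      using t_in by (intro measurable_restrict measurable_component_singleton) auto
    have "(\<integral>p. h i p \<partial>?D) = (\<integral>p. h i p \<partial>distr ?D ?D (\<lambda>p. \<lambda>v\<in>I. p (?t v)))"
      by (simp add: distr)
    also have "\<dots> = (\<integral>p. h i (\<lambda>v\<in>I. p (?t v)) \<partial>?D)"
      by (rule integral_distr[OF meas h_meas[OF I(2)]])
    also have "\<dots> = (\<integral>p. h u p \<partial>?D)"
    proof (intro Bochner_Integration.integral_cong refl)
      fix p
      have "N (\<lambda>v\<in>I. p (?t v)) = (\<Sum>v\<in>I. of_bool (\<kappa> (p (?t v)) = c))"
        by (simp add: N_def)
      also have "\<dots> = N p"
        unfolding N_def by (subst (2) sum.permute[OF t]) (simp add: comp_def)
      finally show "h i (\<lambda>v\<in>I. p (?t v)) = h u p"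
        using I by (simp add: h_def)
    qed
    finally show ?thesis ..
  qed
  have "card I * (\<integral>p. h i p \<partial>?D) = (\<Sum>u\<in>I. \<integral>p. h u p \<partial>?D)"
    using swap by simp
  also have "\<dots> = (\<integral>p. (\<Sum>u\<in>I. h u p) \<partial>?D)"
    using h_int by (intro Bochner_Integration.integral_sum[symmetric]) auto
  also have "\<dots> \<le> (\<integral>p. 1 \<partial>?D)"
  proof (intro integral_mono)
    show "(\<Sum>u\<in>I. h u p) \<le> 1" for p
      by (simp add: h_def N_def flip: sum_divide_distrib)
  qed (use h_int in auto)
  also have "\<dots> = 1" by (simp add: D.prob_space)
  finally have "card I * (\<integral>p. h i p \<partial>?D) \<le> 1" .
  then show ?thesis
    using I card_gt_0_iff[of I] by (auto simp: h_def N_def field_simps)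
qed

text \<open>The exceptional set is a graph over the other coordinates, since \<open>g\<close> does
  not look at coordinate \<open>e\<close>. When that coordinate is integrated first, every slice is
  contained in a single point.\<close>

lemma AE_PiM_lborel_neq:
  fixes g :: "('i \<Rightarrow> real) \<Rightarrow> real"
  assumes I: "finite I" "e \<in> I" and g[measurable]: "g \<in> borel_measurable (PiM I (\<lambda>_. lborel))"
    and indep: "\<And>x y. g (x(e := y)) = g x"
  shows "AE x in PiM I (\<lambda>_. lborel). x e \<noteq> g x"
proof -
  interpret product_sigma_finite "\<lambda>_ :: 'i. lborel :: real measure" by standard
  let ?I = "I - {e}" and ?D = "PiM I (\<lambda>_. lborel :: real measure)"
  have I_eq: "insert e ?I = I" using I by auto
  have [measurable]: "(\<lambda>x. x e) \<in> borel_measurable ?D"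
    using measurable_component_singleton[OF I(2), of "\<lambda>_. lborel :: real measure"] by simp
  let ?Z = "{x \<in> space ?D. x e = g x}"
  have Z: "?Z \<in> sets ?D" by measurable
  have "emeasure ?D ?Z = (\<integral>\<^sup>+x. indicator ?Z x \<partial>?D)"
    using Z by simp
  also have "\<dots> = (\<integral>\<^sup>+x. (\<integral>\<^sup>+y. indicator ?Z (x(e := y)) \<partial>lborel) \<partial>PiM ?I (\<lambda>_. lborel))"
    using product_nn_integral_insert[of ?I e "indicator ?Z"] I Z unfolding I_eq by simp
  also have "\<dots> = (\<integral>\<^sup>+x. 0 \<partial>PiM ?I (\<lambda>_. lborel :: real measure))"
  proof (intro nn_integral_cong)
    fix x :: "'i \<Rightarrow> real"
    have "(\<integral>\<^sup>+y. indicator ?Z (x(e := y)) \<partial>lborel) \<le> (\<integral>\<^sup>+y. indicator {g x} y \<partial>lborel)"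
      by (intro nn_integral_mono) (auto simp: indicator_def indep)
    then show "(\<integral>\<^sup>+y. indicator ?Z (x(e := y)) \<partial>lborel) = 0" by simp
  qed
  finally have "?Z \<in> null_sets ?D" using Z by (simp add: null_sets_def)
  then show ?thesis by (rule AE_I') auto
qed

context anonymized_markov_users
begin

text \<open>\<open>L\<close> is the reciprocal of the side, and a cell is named by its integer
  corner. Acceptable parameters have coordinates in [0, 1] and therefore meet only the finitely many
  names in \<open>cells L\<close>.\<close>

definition cell :: "real \<Rightarrow> (nat \<times> nat \<Rightarrow> real) \<Rightarrow> nat \<times> nat \<Rightarrow> int" where
  "cell L p = (\<lambda>e\<in>Ed. \<lfloor>L * p e\<rfloor>)"

text \<open>Keeps the divisors of the chi-square estimate away from 0; it is imposed on user 1
  only.\<close>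

definition trans_ge :: "real \<Rightarrow> (nat \<times> nat \<Rightarrow> real) \<Rightarrow> bool" where
  "trans_ge \<epsilon> p \<longleftrightarrow> (\<forall>(i, j)\<in>E. \<epsilon> \<le> trans_prob E Ed p i j)"

lemma finite_Ed: "finite Ed"
  using Ed_subset finite_E finite_subset by blast

lemma cell_eq_imp_close:
  assumes "cell L p = cell L p'" "L > 0" "e \<in> Ed"
  shows "\<bar>p e - p' e\<bar> \<le> 1 / L"
proof -
  have "\<lfloor>L * p e\<rfloor> = \<lfloor>L * p' e\<rfloor>"
    using fun_cong[OF assms(1), of e] assms(3) by (simp add: cell_def)
  then have "\<bar>L * p e - L * p' e\<bar> \<le> 1" by linarith
  moreover have "L * \<bar>p e - p' e\<bar> = \<bar>L * p e - L * p' e\<bar>"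
    using assms(2) by (simp add: abs_mult flip: right_diff_distrib)
  ultimately show ?thesis using assms(2) by (simp add: pos_le_divide_eq mult.commute)
qed

text \<open>The law of \<open>p\<close> stands in the denominators: its transition probabilities are
  at least \<epsilon> on \<open>E\<close>, and off \<open>E\<close> both kernels vanish. A common
  cell makes free coordinates differ by at most \<open>1 / L\<close>, hence transition probabilities
  by at most \<open>r / L\<close>.\<close>

lemma path_law_abs_diff_le:
  assumes acc: "p \<in> acceptable E Ed" "p' \<in> acceptable E Ed" and ge: "trans_ge \<epsilon> p"
    and cell: "cell L p = cell L p'" and pos: "L > 0" "\<epsilon> > 0" and K: "K \<ge> 1" and r: "r \<ge> 1"
  shows "(\<Sum>y\<in>paths K. \<bar>path_law p K y - path_law p' K y\<bar>)
    \<le> sqrt (exp (K * (r * (r * (1 / L))\<^sup>2 / \<epsilon>)) - 1)"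
proof -
  have "(\<Sum>y\<in>paths K. \<bar>path_law p K y - path_law p' K y\<bar>)
    \<le> sqrt (exp (K * (card {1..r} * (r * (1 / L))\<^sup>2 / \<epsilon>)) - 1)"
  proof (rule path_weight_abs_diff_le[where S = "{1..r}" and s = 1 and T = "trans_prob E Ed p"
      and T' = "trans_prob E Ed p'" and \<eta> = "real r * (1 / L)" and \<epsilon> = \<epsilon>])
    fix i j
    show "trans_prob E Ed p i j = 0 \<and> trans_prob E Ed p' i j = 0 \<or> \<epsilon> \<le> trans_prob E Ed p i j"
    proof (cases "(i, j) \<in> E")
      case True
      then show ?thesis using ge by (auto simp: trans_ge_def)
    next
      case False
      then show ?thesis using Ed_subset by (auto simp: trans_prob_def)
    qed
    show "\<bar>trans_prob E Ed p i j - trans_prob E Ed p' i j\<bar> \<le> r * (1 / L)"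
      using edges Ed_subset pos(1) by (intro trans_prob_diff_le cell_eq_imp_close[OF cell]) auto
  qed (use acc K r pos edges free acceptable_trans_prob[OF acc(1) Ed_subset]
      in \<open>auto intro!: sum_trans_prob simp del: One_nat_def\<close>)
  then show ?thesis by simp
qed

lemma shuffled_path_correlation_le:
  assumes n: "n \<ge> 1" and K: "K \<ge> 1" and r: "r \<ge> 1"
    and acc: "\<And>u. u \<in> {1..n} \<Longrightarrow> p u \<in> acceptable E Ed"
    and G: "\<And>z. \<bar>G z\<bar> \<le> 1" and J: "J \<subseteq> {1..n}" "J \<noteq> {}"
    and \<tau>: "\<And>u. u \<in> J \<Longrightarrow> (\<Sum>y\<in>paths K. \<bar>path_law (p 1) K y - path_law (p u) K y\<bar>) \<le> \<tau>"
  shows "\<bar>(\<Sum>\<pi> | \<pi> permutes {1..n}. \<Sum>x\<in>{1..n} \<rightarrow>\<^sub>E paths K. (\<Prod>u\<in>{1..n}. path_law (p u) K (x u)) *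
      (G (\<lambda>j\<in>{1..n}. x (inv \<pi> j)) * (of_bool (x 1 k = s) - location_law K k s (p 1)))) / fact n\<bar>
    \<le> 3 * \<tau> + 1 / sqrt (card J)"
proof -
  have "\<bar>\<Sum>\<pi> | \<pi> permutes {1..n}. \<Sum>x\<in>{1..n} \<rightarrow>\<^sub>E paths K. (\<Prod>u\<in>{1..n}. path_law (p u) K (x u)) *
      (G (\<lambda>j\<in>{1..n}. x (inv \<pi> j)) * (of_bool (x 1 k = s) - (\<Sum>y\<in>paths K. path_law (p 1) K y * of_bool (y k = s))))\<bar>
    \<le> fact (card {1..n}) * (3 * \<tau> + 1 / sqrt (card J))"
  proof (rule shuffled_correlation_le)
    fix u y assume u: "u \<in> {1..n}" and y: "y \<in> paths K"
    show "0 \<le> path_law (p u) K y"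
      using acceptable_trans_prob[OF acc[OF u] Ed_subset] y by (intro path_weight_nonneg)
  next
    fix u assume "u \<in> {1..n}"
    show "(\<Sum>y\<in>paths K. path_law (p u) K y) = 1"
      using K r edges free by (intro sum_path_weight) (auto intro!: sum_trans_prob simp del: One_nat_def)
  qed (use n G J \<tau> in \<open>auto intro: finite_PiE\<close>)
  then show ?thesis by (simp add: location_law_def field_simps)
qed

text \<open>The reciprocal of the number of users in the cell of user 1, split by which cell that
  is. The cell of user 1 is random, whereas exchangeability applies to a fixed
  \<open>c\<close>.\<close>

definition cell_share :: "nat \<Rightarrow> real \<Rightarrow> (nat \<times> nat \<Rightarrow> int) \<Rightarrow> (nat \<Rightarrow> nat \<times> nat \<Rightarrow> real) \<Rightarrow> real" where
  "cell_share n L c p = of_bool (cell L (p 1) = c) / (\<Sum>v\<in>{1..n}. of_bool (cell L (p v) = c))"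

abbreviation cells :: "real \<Rightarrow> (nat \<times> nat \<Rightarrow> int) set" where
  "cells L \<equiv> Ed \<rightarrow>\<^sub>E {0..\<lfloor>L\<rfloor>}"

lemma finite_cells: "finite (cells L)"
  using finite_Ed by (intro finite_PiE) auto

lemma cell_in_cells:
  assumes "p \<in> acceptable E Ed" "L > 0"
  shows "cell L p \<in> cells L"
proof -
  have "0 \<le> p e \<and> p e \<le> 1" if "e \<in> Ed" for e
    using acceptable_trans_prob[OF assms(1) Ed_subset, of "fst e" "snd e"] that by (simp add: trans_prob_def)
  then show ?thesis
    using assms(2) by (auto simp: cell_def intro!: floor_mono mult_left_le)
qed

lemma sum_cell_share:
  assumes "p 1 \<in> acceptable E Ed" "L > 0"
  shows "(\<Sum>c\<in>cells L. cell_share n L c p) = 1 / card {u \<in> {1..n}. cell L (p u) = cell L (p 1)}"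
proof -
  have "(\<Sum>c\<in>cells L. cell_share n L c p)
    = (\<Sum>c\<in>cells L. if c = cell L (p 1) then 1 / (\<Sum>v\<in>{1..n}. of_bool (cell L (p v) = cell L (p 1))) else 0)"
    by (intro sum.cong) (auto simp: cell_share_def)
  also have "\<dots> = 1 / (\<Sum>v\<in>{1..n}. of_bool (cell L (p v) = cell L (p 1)))"
    using finite_cells cell_in_cells[OF assms] by simp
  also have "(\<Sum>v\<in>{1..n}. of_bool (cell L (p v) = cell L (p 1)) :: real)
      = card {u \<in> {1..n}. cell L (p u) = cell L (p 1)}"
    by (simp add: of_bool_def sum.If_cases Int_def)
  finally show ?thesis .
qed

lemma measurable_cell_set:
  assumes "c \<in> cells L"
  shows "{p \<in> space (param_space Ed). cell L p = c} \<in> sets (param_space Ed)"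
proof -
  have [measurable]: "(\<lambda>p. p e) \<in> borel_measurable (param_space Ed)" if "e \<in> Ed" for e
    using measurable_component_singleton[OF that, of "\<lambda>_. lborel"] by simp
  have "{p \<in> space (param_space Ed). cell L p = c} = {p \<in> space (param_space Ed). \<forall>e\<in>Ed. \<lfloor>L * p e\<rfloor> = c e}"
    using assms by (auto simp: cell_def fun_eq_iff PiE_iff extensional_def restrict_def)
  also have "\<dots> \<in> sets (param_space Ed)"
    using finite_Ed by (intro sets.sets_Collect_finite_All) auto
  finally show ?thesis .
qed

lemma measurable_cell_share:
  assumes "n \<ge> 1" "c \<in> cells L"
  shows "cell_share n L c \<in> borel_measurable (PiM {1..n} (\<lambda>_. param_space Ed))"
proof -
  have "(\<lambda>p. of_bool (cell L (p u) = c) :: real) \<in> borel_measurable (PiM {1..n} (\<lambda>_. param_space Ed))"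
    if u: "u \<in> {1..n}" for u
  proof -
    have "(\<lambda>x. indicator {p \<in> space (param_space Ed). cell L p = c} x :: real) \<in> borel_measurable (param_space Ed)"
      using measurable_cell_set[OF assms(2)] by measurable
    note meas = measurable_compose[OF measurable_component_singleton[OF u, of "\<lambda>_. param_space Ed"] this]
    have "p u \<in> space (param_space Ed)" if "p \<in> space (PiM {1..n} (\<lambda>_. param_space Ed))" for p
      using measurable_space[OF measurable_component_singleton[OF u, of "\<lambda>_. param_space Ed"] that] .
    with meas show ?thesis
      by (subst measurable_cong[where g = "\<lambda>p. indicator {p \<in> space (param_space Ed). cell L p = c} (p u)"])
        (auto simp: indicator_def simp del: One_nat_def)
  qed
  then show ?thesis
    unfolding cell_share_def[abs_def] using assms(1)
    by (intro borel_measurable_divide borel_measurable_sum) auto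
qed

lemma distr_params:
  assumes n: "n \<ge> 1"
  shows "distr M (PiM {1..n} (\<lambda>_. param_space Ed)) (params n)
    = PiM {1..n} (\<lambda>_. distr M (param_space Ed) (P 1))"
proof -
  have indep: "indep_vars (\<lambda>_. param_space Ed) P {1..n}"
    using params_indep by (rule indep_vars_subset) auto
  have "distr M (PiM {1..n} (\<lambda>_. param_space Ed)) (params n)
      = PiM {1..n} (\<lambda>u. distr M (param_space Ed) (P u))"
    using indep_vars_iff_distr_eq_PiM'[of "{1..n}" P "\<lambda>_. param_space Ed"] indep n
    unfolding params_def[abs_def] by (auto intro!: measurable_P)
  also have "\<dots> = PiM {1..n} (\<lambda>_. distr M (param_space Ed) (P 1))"
    by (intro PiM_cong refl)
      (metis atLeastAtMost_iff distributed_distr_eq_density order_refl params_density)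
  finally show ?thesis .
qed

lemma expectation_cell_share:
  assumes n: "n \<ge> 1" and c: "c \<in> cells L"
  shows "(\<integral>\<omega>. cell_share n L c (params n \<omega>) \<partial>M) \<le> 1 / n"
    and "integrable M (\<lambda>\<omega>. cell_share n L c (params n \<omega>))"
proof -
  let ?\<mu> = "distr M (param_space Ed) (P 1)"
  have "(\<integral>\<omega>. cell_share n L c (params n \<omega>) \<partial>M)
      = (\<integral>p. cell_share n L c p \<partial>PiM {1..n} (\<lambda>_. ?\<mu>))"
    unfolding distr_params[OF n, symmetric]
    by (rule integral_distr[OF measurable_params measurable_cell_share[OF assms], symmetric])
  also have "\<dots> \<le> 1 / card {1..n}"
    unfolding cell_share_def[abs_def] using n measurable_cell_set[OF c]
    by (intro expectation_cell_share_le prob_space_distr measurable_P) auto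
  finally show "(\<integral>\<omega>. cell_share n L c (params n \<omega>) \<partial>M) \<le> 1 / n" by simp
  show "integrable M (\<lambda>\<omega>. cell_share n L c (params n \<omega>))"
  proof (rule integrable_const_bound[where B = 1])
    have "\<bar>cell_share n L c p\<bar> \<le> 1" for p
    proof -
      define N where "N = (\<Sum>v\<in>{1..n}. of_bool (cell L (p v) = c) :: real)"
      have "of_bool (cell L (p 1) = c) \<le> N"
        unfolding N_def using n by (intro member_le_sum) auto
      moreover have "0 \<le> N" by (auto simp: N_def intro: sum_nonneg)
      ultimately show ?thesis
        unfolding cell_share_def N_def[symmetric] by (auto simp: divide_le_eq_1)
    qed
    then show "AE \<omega> in M. norm (cell_share n L c (params n \<omega>)) \<le> 1" by simp
    show "(\<lambda>\<omega>. cell_share n L c (params n \<omega>)) \<in> borel_measurable M"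
      by (rule measurable_compose[OF measurable_params measurable_cell_share[OF assms]])
  qed
qed

end

text \<open>Only the expectation of \<open>1 / N\<close> is under control. Expanding the nonnegative
  square of \<open>1 / sqrt N - \<delta>\<close> replaces the root by an expression linear in
  \<open>1 / N\<close>, at the price of a constant \<delta> that is chosen later.\<close>

lemma inverse_sqrt_le:
  fixes N \<delta> :: real
  assumes "N > 0" "\<delta> > 0"
  shows "1 / sqrt N \<le> \<delta> + 1 / N / \<delta>"
proof -
  define t where "t = 1 / sqrt N"
  have t: "t > 0" "t * t = 1 / N" using assms by (auto simp: t_def)
  have "0 \<le> (t - \<delta>)\<^sup>2" "0 < t * \<delta>" using t assms by auto
  then have "t * \<delta> \<le> \<delta> * \<delta> + t * t"
    by (simp add: power2_eq_square algebra_simps)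
  then have "t \<le> \<delta> + t * t / \<delta>" using assms(2) by (simp add: field_simps)
  then show ?thesis unfolding t(2) unfolding t_def .
qed

text \<open>Continuity of the measure from above: the events decrease to the event that
  \<open>t\<close> is not positive.\<close>

lemma (in prob_space) prob_less_tendsto_0:
  fixes t :: "'a \<Rightarrow> real"
  assumes [measurable]: "t \<in> borel_measurable M" and pos: "AE \<omega> in M. t \<omega> > 0"
  shows "(\<lambda>i. prob {\<omega> \<in> space M. t \<omega> < 1 / Suc i}) \<longlonglongrightarrow> 0"
proof -
  have "(\<lambda>i. prob {\<omega> \<in> space M. t \<omega> < 1 / Suc i}) \<longlonglongrightarrow> prob (\<Inter>i. {\<omega> \<in> space M. t \<omega> < 1 / Suc i})"
  proof (rule finite_Lim_measure_decseq)
    show "decseq (\<lambda>i. {\<omega> \<in> space M. t \<omega> < 1 / Suc i})"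
    proof (rule decseq_SucI)
      fix i
      have "1 / Suc (Suc i) \<le> 1 / Suc i" by (simp add: field_simps)
      then show "{\<omega> \<in> space M. t \<omega> < 1 / Suc (Suc i)} \<subseteq> {\<omega> \<in> space M. t \<omega> < 1 / Suc i}"
        by auto
    qed
  qed auto
  also have "prob (\<Inter>i. {\<omega> \<in> space M. t \<omega> < 1 / Suc i}) = 0"
  proof -
    have "(\<Inter>i. {\<omega> \<in> space M. t \<omega> < 1 / Suc i}) = {\<omega> \<in> space M. t \<omega> \<le> 0}"
    proof (intro set_eqI iffI)
      fix \<omega> assume \<omega>: "\<omega> \<in> (\<Inter>i. {\<omega> \<in> space M. t \<omega> < 1 / Suc i})"
      have "t \<omega> \<le> 0"
      proof (rule ccontr)
        assume "\<not> t \<omega> \<le> 0"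
        then obtain i where "1 / Suc i < t \<omega>" using reals_Archimedean[of "t \<omega>"] by (auto simp: inverse_eq_divide)
        with \<omega> show False by (auto dest: spec[of _ i])
      qed
      with \<omega> show "\<omega> \<in> {\<omega> \<in> space M. t \<omega> \<le> 0}" by auto
    next
      fix \<omega> assume "\<omega> \<in> {\<omega> \<in> space M. t \<omega> \<le> 0}"
      then show "\<omega> \<in> (\<Inter>i. {\<omega> \<in> space M. t \<omega> < 1 / Suc i})"
        by (auto intro: le_less_trans[of _ 0])
    qed
    moreover have "prob {\<omega> \<in> space M. t \<omega> \<le> 0} = 0"
      using pos by (subst prob_eq_0) (auto elim!: eventually_mono)
    ultimately show ?thesis by simp
  qed
  finally show ?thesis .
qed

section \<open>Transition probabilities bounded away from zero\<close>

context anonymized_markov_users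
begin

text \<open>Acceptability gives nonnegativity. Unless the transition probability is constantly 1,
  its zero set is given by an equation that can be solved for one free coordinate; this is a
  Lebesgue null set and hence null for the law of the parameters.\<close>

lemma AE_trans_prob_pos:
  assumes e: "(i, j) \<in> E" and u: "u \<ge> 1"
  shows "AE \<omega> in M. trans_prob E Ed (P u \<omega>) i j > 0"
proof -
  have comp[measurable]: "(\<lambda>p. p e) \<in> borel_measurable (param_space Ed)" if "e \<in> Ed" for e
    using measurable_component_singleton[OF that, of "\<lambda>_. lborel"] by simp
  have "AE p in param_space Ed. trans_prob E Ed p i j \<noteq> 0"
  proof (cases "(i, j) \<in> Ed")
    case True
    have "AE p in param_space Ed. p (i, j) \<noteq> 0"
      using finite_Ed True by (intro AE_PiM_lborel_neq) auto
    with True show ?thesis by (simp add: trans_prob_def)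
  next
    case False
    let ?D = "{j'. (i, j') \<in> Ed}"
    have "?D \<subseteq> {1..r}" using Ed_subset edges by auto
    then have fin: "finite ?D" using finite_subset by blast
    show ?thesis
    proof (cases "?D = {}")
      case True
      \<comment> \<open>A state without free edges has a single outgoing edge, so there is no
        coordinate to solve for.\<close>
      then have "trans_prob E Ed p i j = 1" for p
        using e False by (simp add: trans_prob_def)
      then show ?thesis by simp
    next
      case nonempty: False
      then obtain j1 where j1: "(i, j1) \<in> Ed" by auto
      \<comment> \<open>The left-out edge has probability 0 exactly when coordinate
        \<open>j1\<close> equals 1 minus the other free coordinates of the row.\<close>
      let ?g = "\<lambda>p. 1 - (\<Sum>j'\<in>?D - {j1}. p (i, j')) :: real"
      have "AE p in param_space Ed. p (i, j1) \<noteq> ?g p"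
        using finite_Ed j1 by (intro AE_PiM_lborel_neq borel_measurable_diff borel_measurable_sum) auto
      moreover have "trans_prob E Ed p i j = ?g p - p (i, j1)" for p
        using e False fin j1 by (simp add: trans_prob_def sum.remove[of ?D j1])
      ultimately show ?thesis by (auto elim!: eventually_mono)
    qed
  qed
  moreover have [measurable]: "(\<lambda>p. ennreal (f p)) \<in> borel_measurable (param_space Ed)"
    using distributed_borel_measurable[OF params_density[OF u]] .
  ultimately have "AE p in density (param_space Ed) (\<lambda>p. ennreal (f p)). trans_prob E Ed p i j \<noteq> 0"
    by (subst AE_density) (auto elim!: eventually_mono)
  then have "AE p in distr M (param_space Ed) (P u). trans_prob E Ed p i j \<noteq> 0"
    unfolding distributed_distr_eq_density[OF params_density[OF u]] .
  from AE_distrD[OF measurable_P[OF u] this] AE_acceptable[OF u]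
  show ?thesis
    by eventually_elim (use acceptable_trans_prob(1)[OF _ Ed_subset] in \<open>auto simp: less_le\<close>)
qed

lemma trans_ge_event[measurable]: "{\<omega> \<in> space M. \<not> trans_ge \<epsilon> (P 1 \<omega>)} \<in> events"
proof -
  have t: "(\<lambda>\<omega>. trans_prob E Ed (P 1 \<omega>) i j) \<in> borel_measurable M" for i j
    by (rule measurable_compose[OF measurable_P measurable_trans_prob]) simp
  have "{\<omega> \<in> space M. \<not> trans_ge \<epsilon> (P 1 \<omega>)}
      = (\<Union>e\<in>E. {\<omega> \<in> space M. trans_prob E Ed (P 1 \<omega>) (fst e) (snd e) < \<epsilon>})"
    by (auto simp: trans_ge_def case_prod_unfold not_le)
  also have "\<dots> \<in> events"
    using finite_E t by (intro sets.finite_UN) measurable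
  finally show ?thesis .
qed

text \<open>A union bound over the finitely many edges. The resulting \<epsilon> depends on \<delta>
  and on the law of user 1, but not on \<open>n\<close>.\<close>

lemma prob_trans_ge:
  assumes "\<delta> > 0"
  obtains \<epsilon> where "\<epsilon> > 0" "prob {\<omega> \<in> space M. \<not> trans_ge \<epsilon> (P 1 \<omega>)} \<le> \<delta>"
proof -
  let ?A = "\<lambda>i e. {\<omega> \<in> space M. trans_prob E Ed (P 1 \<omega>) (fst e) (snd e) < 1 / Suc i}"
  have t: "(\<lambda>\<omega>. trans_prob E Ed (P 1 \<omega>) i j) \<in> borel_measurable M" for i j
    by (rule measurable_compose[OF measurable_P measurable_trans_prob]) simp
  have "(\<lambda>i. \<Sum>e\<in>E. prob (?A i e)) \<longlonglongrightarrow> (\<Sum>e\<in>E. 0)"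
    by (intro tendsto_sum prob_less_tendsto_0 t AE_trans_prob_pos) auto
  then have "\<forall>\<^sub>F i in sequentially. (\<Sum>e\<in>E. prob (?A i e)) < \<delta>"
    using assms by (intro order_tendstoD(2)[where y = 0]) auto
  then obtain i where i: "(\<Sum>e\<in>E. prob (?A i e)) < \<delta>"
    by (meson eventually_happens' sequentially_bot)
  have "{\<omega> \<in> space M. \<not> trans_ge (1 / Suc i) (P 1 \<omega>)} = (\<Union>e\<in>E. ?A i e)"
    by (auto simp: trans_ge_def case_prod_unfold not_le)
  moreover have "prob (\<Union>e\<in>E. ?A i e) \<le> (\<Sum>e\<in>E. prob (?A i e))"
    using finite_E t by (intro finite_measure_subadditive_finite) auto
  ultimately have "prob {\<omega> \<in> space M. \<not> trans_ge (1 / Suc i) (P 1 \<omega>)} \<le> \<delta>"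
    using i by simp
  then show thesis by (intro that[of "1 / Suc i"]) auto
qed

section \<open>Correlation of the location with the observations\<close>

definition path_distance_bound :: "real \<Rightarrow> real \<Rightarrow> nat \<Rightarrow> real" where
  "path_distance_bound \<epsilon> L K = sqrt (exp (K * (r * (r * (1 / L))\<^sup>2 / \<epsilon>)) - 1)"

text \<open>If \<open>trans_ge\<close> holds, the users in the cell of user 1 serve as
  \<open>J\<close>. Otherwise \<open>J = {1}\<close> with distance 0 gives the trivial bound 1,
  which is charged to the indicator. The right side is arranged so that its expectation can be taken
  term by term.\<close>

lemma shuffled_path_correlation_cells_le:
  assumes n: "n \<ge> 1" and K: "K \<ge> 1" and r: "r \<ge> 1"
    and acc: "\<And>u. u \<in> {1..n} \<Longrightarrow> p u \<in> acceptable E Ed"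
    and G: "\<And>z. \<bar>G z\<bar> \<le> 1" and pos: "L > 0" "\<epsilon> > 0" "\<delta> > 0"
  shows "\<bar>(\<Sum>\<pi> | \<pi> permutes {1..n}. \<Sum>x\<in>{1..n} \<rightarrow>\<^sub>E paths K. (\<Prod>u\<in>{1..n}. path_law (p u) K (x u)) *
      (G (\<lambda>j\<in>{1..n}. x (inv \<pi> j)) * (of_bool (x 1 k = s) - location_law K k s (p 1)))) / fact n\<bar>
    \<le> of_bool (\<not> trans_ge \<epsilon> (p 1)) + 3 * path_distance_bound \<epsilon> L K + \<delta> + (\<Sum>c\<in>cells L. cell_share n L c p) / \<delta>"
    (is "?T \<le> _")
proof -
  have one: "(1::nat) \<in> {1..n}" using n by simp
  let ?J = "{u \<in> {1..n}. cell L (p u) = cell L (p 1)}"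
  have J: "1 \<in> ?J" "finite ?J" using one by auto
  then have N: "real (card ?J) > 0" by (metis card_gt_0_iff empty_iff of_nat_0_less_iff)
  have share: "(\<Sum>c\<in>cells L. cell_share n L c p) = 1 / card ?J"
    using acc[OF one] pos(1) by (rule sum_cell_share)
  have \<tau>0: "path_distance_bound \<epsilon> L K \<ge> 0"
    using pos by (simp add: path_distance_bound_def)
  show ?thesis
  proof (cases "trans_ge \<epsilon> (p 1)")
    case True
    have "?T \<le> 3 * path_distance_bound \<epsilon> L K + 1 / sqrt (card ?J)"
    proof (rule shuffled_path_correlation_le[OF n K r acc G])
      fix u assume u: "u \<in> ?J"
      show "(\<Sum>y\<in>paths K. \<bar>path_law (p 1) K y - path_law (p u) K y\<bar>) \<le> path_distance_bound \<epsilon> L K"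
        unfolding path_distance_bound_def using u acc one True pos K r by (intro path_law_abs_diff_le) auto
    qed (use J in auto)
    also have "1 / sqrt (card ?J) \<le> \<delta> + 1 / card ?J / \<delta>"
      using N pos(3) by (rule inverse_sqrt_le)
    finally show ?thesis using True by (simp add: share)
  next
    case False
    have "?T \<le> 3 * 0 + 1 / sqrt (card {1::nat})"
      by (rule shuffled_path_correlation_le[OF n K r acc G]) (use one in auto)
    also have "\<dots> = 1" by simp
    also have "1 \<le> of_bool (\<not> trans_ge \<epsilon> (p 1)) + 3 * path_distance_bound \<epsilon> L K + \<delta>
        + (\<Sum>c\<in>cells L. cell_share n L c p) / \<delta>"
      using False \<tau>0 pos(3) share N by simp
    finally show ?thesis .
  qed
qed

text \<open>The observations are the shuffled family of full paths, cut to length \<open>m\<close>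
  after shuffling. In this form the exchange of two users applies, and the cut is absorbed in the
  test function.\<close>

lemma anonymized_obs_eq:
  assumes "\<omega> \<in> space M" "n \<ge> 1" "m \<le> K"
  shows "anonymized_obs X perm n m \<omega>
    = (\<lambda>j\<in>{1..n}. restrict ((\<lambda>j\<in>{1..n}. user_paths n K \<omega> (inv (perm n \<omega>) j)) j) {1..m})"
proof -
  have "inv (perm n \<omega>) j \<in> {1..n}" if "j \<in> {1..n}" for j
    using permutes_in_image[OF permutes_inv[OF perm_permutes[OF assms(2,1)]], of j] that by simp
  then show ?thesis
    using assms(3) by (auto simp: anonymized_obs_def user_paths_def fun_eq_iff simp del: One_nat_def)
qed

lemma location_correlation_le:
  assumes n: "n \<ge> 1" and r: "r \<ge> 1" and k: "1 \<le> k" "k \<le> K" and m: "m \<le> K"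
    and G_meas: "G \<in> borel_measurable (obs_space r n m \<Otimes>\<^sub>M PiM {1..n} (\<lambda>_. param_space Ed))"
    and G: "\<And>z. \<bar>G z\<bar> \<le> 1" and pos: "L > 0" "\<epsilon> > 0" "\<delta> > 0"
  shows "\<bar>\<integral>\<omega>. G (anonymized_obs X perm n m \<omega>, params n \<omega>)
      * (indicator (X 1 k -` {s} \<inter> space M) \<omega> - location_law K k s (params n \<omega> 1)) \<partial>M\<bar>
    \<le> prob {\<omega> \<in> space M. \<not> trans_ge \<epsilon> (P 1 \<omega>)} + 3 * path_distance_bound \<epsilon> L K + \<delta>
      + card (cells L) / n / \<delta>"
proof -
  let ?N = "PiM {1..n} (\<lambda>_. param_space Ed)"
  have K: "K \<ge> 1" using k by simp
  have one: "(1::nat) \<in> {1..n}" using n by simp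
  have params_1: "params n \<omega> 1 = P 1 \<omega>" for \<omega> using one by (simp add: params_def)
  \<comment> \<open>The test function may depend on the parameters: for fixed \<open>p\<close> it is
    a bounded function of the shuffled paths, so the exchange argument runs at each fixed
    \<open>p\<close>, before the integration over the parameters.\<close>
  define G' where "G' p z = G (\<lambda>j\<in>{1..n}. restrict (z j) {1..m}, p)" for p z
  define H where "H p x \<pi> = G' p (\<lambda>j\<in>{1..n}. x (inv \<pi> j)) * (of_bool (x 1 k = s) - location_law K k s (p 1))"
    for p :: "nat \<Rightarrow> nat \<times> nat \<Rightarrow> real" and x :: "nat \<Rightarrow> nat \<Rightarrow> nat" and \<pi> :: "nat \<Rightarrow> nat"
  let ?T = "\<lambda>p. (\<Sum>\<pi> | \<pi> permutes {1..n}. \<Sum>x\<in>{1..n} \<rightarrow>\<^sub>E paths K.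
    (\<Prod>u\<in>{1..n}. path_law (p u) K (x u)) * H p x \<pi>) / fact n"
  let ?b = "\<lambda>\<omega>. of_bool (\<not> trans_ge \<epsilon> (params n \<omega> 1)) + 3 * path_distance_bound \<epsilon> L K + \<delta>
    + (\<Sum>c\<in>cells L. cell_share n L c (params n \<omega>)) / \<delta>"
  have loc_meas: "(\<lambda>p. location_law K k s (p 1)) \<in> borel_measurable ?N"
    using cond_versionD(1)[OF cond_version_location[OF n k r]] .
  have H_meas: "(\<lambda>p. H p x \<pi>) \<in> borel_measurable ?N"
    if x: "x \<in> {1..n} \<rightarrow>\<^sub>E paths K" and \<pi>: "\<pi> permutes {1..n}" for x \<pi>
  proof -
    let ?z = "\<lambda>j\<in>{1..n}. restrict ((\<lambda>j\<in>{1..n}. x (inv \<pi> j)) j) {1..m}"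
    have "x (inv \<pi> j) l \<in> {1..r}" if "j \<in> {1..n}" "l \<in> {1..m}" for j l
    proof -
      have "inv \<pi> j \<in> {1..n}" using permutes_in_image[OF permutes_inv[OF \<pi>], of j] that by simp
      from PiE_mem[OF x this] show ?thesis by (rule PiE_mem) (use that m in auto)
    qed
    then have "?z \<in> space (obs_space r n m)"
      by (auto simp: space_PiM simp del: One_nat_def)
    then have "Pair ?z \<in> ?N \<rightarrow>\<^sub>M obs_space r n m \<Otimes>\<^sub>M ?N" by (rule measurable_Pair1')
    from measurable_compose[OF this G_meas] show ?thesis
      unfolding H_def G'_def using loc_meas by (intro borel_measurable_times borel_measurable_diff) auto
  qed
  have loc: "AE \<omega> in M. 0 \<le> location_law K k s (params n \<omega> 1) \<and> location_law K k s (params n \<omega> 1) \<le> 1"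
    unfolding params_1 by (rule AE_location_law[OF K _ r]) simp
  have H_bound: "AE \<omega> in M. \<bar>H (params n \<omega>) x \<pi>\<bar> \<le> 1" for x \<pi>
    using loc
  proof eventually_elim
    fix \<omega> assume "0 \<le> location_law K k s (params n \<omega> 1) \<and> location_law K k s (params n \<omega> 1) \<le> 1"
    then have "\<bar>of_bool (x 1 k = s) - location_law K k s (params n \<omega> 1)\<bar> \<le> 1" by auto
    then show "\<bar>H (params n \<omega>) x \<pi>\<bar> \<le> 1"
      unfolding H_def G'_def abs_mult using G by (intro mult_le_one) auto
  qed
  have e1: "(\<integral>\<omega>. G (anonymized_obs X perm n m \<omega>, params n \<omega>)
      * (indicator (X 1 k -` {s} \<inter> space M) \<omega> - location_law K k s (params n \<omega> 1)) \<partial>M)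
    = (\<integral>\<omega>. H (params n \<omega>) (user_paths n K \<omega>) (perm n \<omega>) \<partial>M)"
  proof (rule Bochner_Integration.integral_cong[OF refl])
    fix \<omega> assume \<omega>: "\<omega> \<in> space M"
    have "user_paths n K \<omega> 1 k = X 1 k \<omega>" using one k by (simp add: user_paths_def)
    then show "G (anonymized_obs X perm n m \<omega>, params n \<omega>)
      * (indicator (X 1 k -` {s} \<inter> space M) \<omega> - location_law K k s (params n \<omega> 1))
      = H (params n \<omega>) (user_paths n K \<omega>) (perm n \<omega>)"
      unfolding H_def G'_def anonymized_obs_eq[OF \<omega> n m] using \<omega> by (simp add: indicator_def)
  qed
  have e2: "(\<integral>\<omega>. H (params n \<omega>) (user_paths n K \<omega>) (perm n \<omega>) \<partial>M) = (\<integral>\<omega>. ?T (params n \<omega>) \<partial>M)"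
    using H_meas H_bound by (rule integral_shuffled[OF n K])
  have e3: "\<bar>\<integral>\<omega>. ?T (params n \<omega>) \<partial>M\<bar> \<le> (\<integral>\<omega>. ?b \<omega> \<partial>M)"
  proof -
    have T_meas: "(\<lambda>\<omega>. ?T (params n \<omega>)) \<in> borel_measurable M"
    proof (rule measurable_compose[OF measurable_params])
      show "?T \<in> borel_measurable ?N"
        using H_meas by (intro borel_measurable_divide borel_measurable_sum borel_measurable_times
            borel_measurable_prod measurable_path_law_component borel_measurable_const) auto
    qed
    have b_int: "integrable M ?b"
    proof -
      have "integrable M (\<lambda>\<omega>. indicator {\<omega> \<in> space M. \<not> trans_ge \<epsilon> (P 1 \<omega>)} \<omega> :: real)"
        by (auto simp: less_top[symmetric] simp del: One_nat_def)
      then have "integrable M (\<lambda>\<omega>. of_bool (\<not> trans_ge \<epsilon> (params n \<omega> 1)) :: real)"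
        by (rule Bochner_Integration.integrable_cong[THEN iffD1, rotated -1])
          (auto simp: params_1 indicator_def simp del: One_nat_def)
      then show ?thesis
        using expectation_cell_share(2)[OF n] by (intro Bochner_Integration.integrable_add
            integrable_divide Bochner_Integration.integrable_sum) auto
    qed
    have le: "AE \<omega> in M. \<bar>?T (params n \<omega>)\<bar> \<le> ?b \<omega>"
    proof -
      have "AE \<omega> in M. \<forall>u\<in>{1..n}. P u \<omega> \<in> acceptable E Ed"
        using AE_acceptable by (subst AE_finite_all) auto
      then show ?thesis
      proof eventually_elim
        fix \<omega> assume "\<forall>u\<in>{1..n}. P u \<omega> \<in> acceptable E Ed"
        then have acc: "params n \<omega> u \<in> acceptable E Ed" if "u \<in> {1..n}" for u
          using that by (simp add: params_def)
        show "\<bar>?T (params n \<omega>)\<bar> \<le> ?b \<omega>"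
          unfolding H_def
          by (rule shuffled_path_correlation_cells_le[OF n K r acc _ pos]) (auto simp: G'_def G)
      qed
    qed
    have T_int: "integrable M (\<lambda>\<omega>. ?T (params n \<omega>))"
    proof (rule Bochner_Integration.integrable_bound[OF b_int T_meas])
      show "AE \<omega> in M. norm (?T (params n \<omega>)) \<le> norm (?b \<omega>)"
        using le by eventually_elim auto
    qed
    have "\<bar>\<integral>\<omega>. ?T (params n \<omega>) \<partial>M\<bar> \<le> (\<integral>\<omega>. \<bar>?T (params n \<omega>)\<bar> \<partial>M)"
      by (rule integral_abs_bound)
    also have "\<dots> \<le> (\<integral>\<omega>. ?b \<omega> \<partial>M)"
      by (rule integral_mono_AE[OF integrable_abs[OF T_int] b_int le])
    finally show ?thesis .
  qed
  have e4: "(\<integral>\<omega>. ?b \<omega> \<partial>M) = prob {\<omega> \<in> space M. \<not> trans_ge \<epsilon> (P 1 \<omega>)} + 3 * path_distance_bound \<epsilon> L K + \<delta>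
      + (\<Sum>c\<in>cells L. \<integral>\<omega>. cell_share n L c (params n \<omega>) \<partial>M) / \<delta>"
  proof -
    let ?A = "{\<omega> \<in> space M. \<not> trans_ge \<epsilon> (P 1 \<omega>)}"
    let ?s = "\<lambda>\<omega>. \<Sum>c\<in>cells L. cell_share n L c (params n \<omega>)"
    define d where "d = 3 * path_distance_bound \<epsilon> L K + \<delta>"
    have A_int: "integrable M (\<lambda>\<omega>. indicator ?A \<omega> + d)"
      using trans_ge_event by (simp add: less_top[symmetric] del: One_nat_def)
    have s_int: "integrable M (\<lambda>\<omega>. ?s \<omega> / \<delta>)"
      using expectation_cell_share(2)[OF n]
      by (intro integrable_divide Bochner_Integration.integrable_sum) auto
    have "(\<integral>\<omega>. ?b \<omega> \<partial>M) = (\<integral>\<omega>. (indicator ?A \<omega> + d) + ?s \<omega> / \<delta> \<partial>M)"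
      by (intro Bochner_Integration.integral_cong) (auto simp: params_1 indicator_def d_def simp del: One_nat_def)
    also have "\<dots> = (\<integral>\<omega>. indicator ?A \<omega> + d \<partial>M) + (\<integral>\<omega>. ?s \<omega> / \<delta> \<partial>M)"
      by (rule Bochner_Integration.integral_add[OF A_int s_int])
    also have "(\<integral>\<omega>. indicator ?A \<omega> + d \<partial>M) = prob ?A + d"
      using trans_ge_event by (subst Bochner_Integration.integral_add)
        (auto simp: less_top[symmetric] prob_space Int_def simp del: One_nat_def intro!: arg_cong[where f = prob])
    also have "(\<integral>\<omega>. ?s \<omega> / \<delta> \<partial>M) = (\<Sum>c\<in>cells L. \<integral>\<omega>. cell_share n L c (params n \<omega>) \<partial>M) / \<delta>"
    proof -
      have "(\<integral>\<omega>. ?s \<omega> \<partial>M) = (\<Sum>c\<in>cells L. \<integral>\<omega>. cell_share n L c (params n \<omega>) \<partial>M)"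
        using expectation_cell_share(2)[OF n] by (rule Bochner_Integration.integral_sum)
      then show ?thesis by simp
    qed
    finally show ?thesis by (simp add: d_def)
  qed
  have "(\<Sum>c\<in>cells L. \<integral>\<omega>. cell_share n L c (params n \<omega>) \<partial>M) \<le> (\<Sum>c\<in>cells L. 1 / n)"
    by (intro sum_mono expectation_cell_share(1) n)
  then have e5: "(\<Sum>c\<in>cells L. \<integral>\<omega>. cell_share n L c (params n \<omega>) \<partial>M) / \<delta> \<le> card (cells L) / n / \<delta>"
    using pos(3) by (intro divide_right_mono) auto
  show ?thesis
    unfolding e1 e2 using order.trans[OF e3 e4[THEN eq_refl]] e5 by linarith
qed


text \<open>A left-out edge is determined by its source, and every state is the source of one. This
  identifies \<open>card Ed\<close> with the dimension \<open>d\<close> in the exponent.\<close>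

lemma card_Ed: "card E = card Ed + r"
proof -
  have "bij_betw fst (E - Ed) {1..r}"
  proof (rule bij_betwI')
    show "fst e \<in> {1..r}" if "e \<in> E - Ed" for e
      using that edges by auto
    show "(fst e = fst e') = (e = e')" if "e \<in> E - Ed" "e' \<in> E - Ed" for e e'
    proof
      assume eq: "fst e = fst e'"
      have "fst e \<in> {1..r}" using that edges by auto
      then have "\<exists>!j. (fst e, j) \<in> E - Ed" using free unfolding free_edges_def by blast
      moreover have "(fst e, snd e) \<in> E - Ed" using that(1) by simp
      moreover have "(fst e, snd e') \<in> E - Ed" unfolding eq using that(2) by simp
      ultimately have "snd e = snd e'" by blast
      with eq show "e = e'" by (rule prod_eqI)
    qed simp
    show "\<exists>e\<in>E - Ed. i = fst e" if "i \<in> {1..r}" for i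
    proof -
      obtain j where "(i, j) \<in> E - Ed" using free \<open>i \<in> {1..r}\<close> unfolding free_edges_def by blast
      then show ?thesis by (intro bexI[of _ "(i, j)"]) auto
    qed
  qed
  then have "card (E - Ed) = r" by (simp add: bij_betw_same_card)
  moreover have "card E = card Ed + card (E - Ed)"
    using finite_E Ed_subset by (metis card_Diff_subset card_mono finite_subset le_add_diff_inverse)
  ultimately show ?thesis by simp
qed

lemma card_cells_le:
  assumes "L > 0"
  shows "real (card (cells L)) \<le> (L + 1) ^ card Ed"
proof -
  have "card (cells L) = nat (\<lfloor>L\<rfloor> + 1) ^ card Ed"
    using finite_Ed by (simp add: card_PiE)
  then have "real (card (cells L)) = real (nat (\<lfloor>L\<rfloor> + 1)) ^ card Ed" by simp
  also have "\<dots> \<le> (L + 1) ^ card Ed"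
    using assms by (intro power_mono) linarith+
  finally show ?thesis .
qed

text \<open>Paths of length \<open>m + k\<close> cover the \<open>m\<close> observed times and the
  time \<open>k\<close>, also when \<open>k > m\<close>.\<close>

lemma conditional_mutual_information_le:
  assumes b: "b > 1" and n: "n \<ge> 1" and r: "r \<ge> 1" and k: "k \<ge> 1"
    and pos: "L > 0" "\<epsilon> > 0" "\<delta> > 0"
    and C: "C > 0" "\<And>x y. 0 \<le> x \<Longrightarrow> x \<le> 1 \<Longrightarrow> 0 \<le> y \<Longrightarrow> y \<le> 1 \<Longrightarrow>
      \<bar>x * log b x - y * log b y\<bar> \<le> \<eta> + C * (x - y)\<^sup>2"
  shows "\<bar>conditional_mutual_information b (count_space {1..r}) (obs_space r n m) (PiM {1..n} (\<lambda>_. param_space Ed))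
      (X 1 k) (anonymized_obs X perm n m) (params n)\<bar>
    \<le> r * (\<eta> + C * (prob {\<omega> \<in> space M. \<not> trans_ge \<epsilon> (P 1 \<omega>)}
      + 3 * path_distance_bound \<epsilon> L (m + k) + \<delta> + card (cells L) / n / \<delta>))"
proof -
  have "\<bar>conditional_mutual_information b (count_space {1..r}) (obs_space r n m) (PiM {1..n} (\<lambda>_. param_space Ed))
      (X 1 k) (anonymized_obs X perm n m) (params n)\<bar>
    \<le> card {1..r} * (\<eta> + C * (prob {\<omega> \<in> space M. \<not> trans_ge \<epsilon> (P 1 \<omega>)}
      + 3 * path_distance_bound \<epsilon> L (m + k) + \<delta> + card (cells L) / n / \<delta>))"
  proof (rule conditional_mutual_information_finite_le[OF b _ measurable_X measurable_anonymized_obs measurable_params _ _ C])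
    show "cond_version (PiM {1..n} (\<lambda>_. param_space Ed)) (params n) (X 1 k -` {s} \<inter> space M)
        (\<lambda>p. location_law (m + k) k s (p 1))" for s
      using n k r by (intro cond_version_location) auto
    show "\<bar>\<integral>\<omega>. G (anonymized_obs X perm n m \<omega>, params n \<omega>)
      * (indicator (X 1 k -` {s} \<inter> space M) \<omega> - location_law (m + k) k s (params n \<omega> 1)) \<partial>M\<bar>
      \<le> prob {\<omega> \<in> space M. \<not> trans_ge \<epsilon> (P 1 \<omega>)} + 3 * path_distance_bound \<epsilon> L (m + k) + \<delta>
        + card (cells L) / n / \<delta>"
      if "G \<in> borel_measurable (obs_space r n m \<Otimes>\<^sub>M PiM {1..n} (\<lambda>_. param_space Ed))" "\<And>z. \<bar>G z\<bar> \<le> 1" for s G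
      using n r k that pos by (intro location_correlation_le) auto
  qed (use n k in auto)
  then show ?thesis by simp
qed

end

section \<open>Asymptotics\<close>

text \<open>
  With \<open>a = 1 / d\<close> and cells of side \<open>n powr (\<beta> - a)\<close>, the number of cells is \<open>o(n)\<close> as soon as
  \<open>\<beta> > 0\<close>, and the number of observations times the squared side vanishes if \<open>2 * \<beta> < \<alpha>\<close>.
\<close>

lemma cell_count_tendsto_0:
  fixes d :: nat
  assumes d: "d > 0" and \<beta>: "\<beta> > 0"
  shows "(\<lambda>n. (real n powr (1 / d - \<beta>) + 1) ^ d / real n) \<longlonglongrightarrow> 0"
proof -
  define a where "a = 1 / real d"
  have a: "a > 0" using d by (simp add: a_def)
  have "(\<lambda>n::nat. real n powr (- \<beta>) + real n powr (- a)) \<longlonglongrightarrow> 0"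
    using a \<beta> by (intro tendsto_add_zero tendsto_neg_powr filterlim_real_sequentially) auto
  then have "(\<lambda>n::nat. (real n powr (- \<beta>) + real n powr (- a)) ^ d) \<longlonglongrightarrow> 0 ^ d"
    by (rule tendsto_power)
  then have "(\<lambda>n::nat. (real n powr (- \<beta>) + real n powr (- a)) ^ d) \<longlonglongrightarrow> 0"
    unfolding zero_power[OF d] .
  moreover have "\<forall>\<^sub>F n::nat in sequentially. (real n powr (- \<beta>) + real n powr (- a)) ^ d
      = (real n powr (1 / d - \<beta>) + 1) ^ d / real n"
    using eventually_gt_at_top[of 0]
  proof eventually_elim
    case (elim n)
    have "(real n powr a) ^ d = (real n powr a) powr real d"
      using elim by (simp add: powr_realpow)
    also have "\<dots> = real n"
      using elim d by (simp add: a_def powr_powr)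
    finally have "(real n powr a) ^ d = real n" .
    \<comment> \<open>The division by \<open>n\<close>, which is the \<open>d\<close>-th power of
      \<open>n powr a\<close>, is drawn into the power.\<close>
    moreover have "real n powr (- \<beta>) + real n powr (- a) = (real n powr (1 / d - \<beta>) + 1) / real n powr a"
      using elim by (simp add: a_def powr_diff powr_minus field_simps)
    ultimately show ?case by (simp add: power_divide)
  qed
  ultimately show ?thesis by (rule Lim_transform_eventually)
qed

lemma observations_times_square_tendsto_0:
  fixes m :: "nat \<Rightarrow> nat"
  assumes "c > 0" and \<beta>: "2 * \<beta> < \<alpha>" "\<beta> < a"
    and m: "\<And>n. m n = nat \<lfloor>c * real n powr (2 * a - \<alpha>)\<rfloor>"
  shows "(\<lambda>n. real (m n + k) * (1 / real n powr (a - \<beta>))\<^sup>2) \<longlonglongrightarrow> 0"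
proof (rule tendsto_sandwich[OF _ _ tendsto_const])
  \<comment> \<open>The second term stems from the fixed extra length \<open>k\<close>; it vanishes
    because \<open>\<beta> < a\<close>, that is, because the cells shrink.\<close>
  show "(\<lambda>n::nat. c * real n powr (2 * \<beta> - \<alpha>) + real k * real n powr (2 * \<beta> - 2 * a)) \<longlonglongrightarrow> 0"
    using \<beta> by (intro tendsto_add_zero tendsto_mult_right_zero tendsto_neg_powr filterlim_real_sequentially) auto
  show "\<forall>\<^sub>F n in sequentially. real (m n + k) * (1 / real n powr (a - \<beta>))\<^sup>2
      \<le> c * real n powr (2 * \<beta> - \<alpha>) + real k * real n powr (2 * \<beta> - 2 * a)"
    using eventually_gt_at_top[of 0]
  proof eventually_elim
    case (elim n)
    have "(1 / real n powr (a - \<beta>))\<^sup>2 = real n powr (2 * \<beta> - 2 * a)"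
      using elim by (simp add: power2_eq_square powr_diff powr_add[symmetric] field_simps)
    moreover have "real (m n + k) \<le> c * real n powr (2 * a - \<alpha>) + k"
      using m[of n] \<open>c > 0\<close> by (simp add: of_nat_floor)
    ultimately have "real (m n + k) * (1 / real n powr (a - \<beta>))\<^sup>2
        \<le> (c * real n powr (2 * a - \<alpha>) + k) * real n powr (2 * \<beta> - 2 * a)"
      by (simp add: mult_right_mono)
    also have "\<dots> = c * real n powr (2 * \<beta> - \<alpha>) + real k * real n powr (2 * \<beta> - 2 * a)"
      by (simp add: distrib_right mult.assoc flip: powr_add)
    finally show ?case .
  qed
qed auto

section \<open>Choice of the scales and passage to the limit\<close>

theorem theorem3:
  fixes M :: "'a measure"
    and r :: nat and E Ed :: "nat rel"
    and f :: "(nat \<times> nat \<Rightarrow> real) \<Rightarrow> real"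
    and P :: "nat \<Rightarrow> 'a \<Rightarrow> nat \<times> nat \<Rightarrow> real"
    and X :: "nat \<Rightarrow> nat \<Rightarrow> 'a \<Rightarrow> nat"
    and perm :: "nat \<Rightarrow> 'a \<Rightarrow> nat \<Rightarrow> nat"
    and c \<alpha> b :: real and m :: "nat \<Rightarrow> nat"
  assumes model: "anonymized_markov_users M r E Ed f P X perm"
    and irreducible: "strongly_connected_on {1..r} E"
    and aperiodic: "aperiodic_rel E"
    and card_E: "card E > r"
    and c: "c > 0" and \<alpha>: "\<alpha> > 0"
    and m: "\<And>n. m n = nat \<lfloor>c * real n powr (2 / (real (card E) - real r) - \<alpha>)\<rfloor>"
    and b: "b > 1"
  shows "\<forall>k\<ge>1. (\<lambda>n. prob_space.conditional_mutual_information M b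
      (count_space {1..r}) (obs_space r n (m n)) (PiM {1..n} (\<lambda>_. param_space Ed))
      (X 1 k) (anonymized_obs X perm n (m n)) (\<lambda>\<omega>. \<lambda>u\<in>{1..n}. P u \<omega>)) \<longlonglongrightarrow> 0"
proof (intro allI impI)
  fix k :: nat assume k: "k \<ge> 1"
  interpret anonymized_markov_users M r E Ed f P X perm by (rule model)
  define d where "d = card Ed"
  define a where "a = 1 / real d"
  \<comment> \<open>Half of the smaller of \<open>\<alpha> / 2\<close> and \<open>a\<close>: this
    gives \<open>2 * \<beta> < \<alpha>\<close> and keeps the exponent \<open>a - \<beta>\<close> of
    \<open>L\<close> positive.\<close>
  define \<beta> where "\<beta> = min (\<alpha> / 2) a / 2"
  define L where "L n = real n powr (a - \<beta>)" for n :: nat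
  have d: "d > 0" "real (card E) - real r = d" using card_E card_Ed by (auto simp: d_def)
  have a: "a > 0" using d by (simp add: a_def)
  have \<beta>: "\<beta> > 0" "2 * \<beta> < \<alpha>" "\<beta> < a" using a \<alpha> by (auto simp: \<beta>_def)
  have r: "r \<ge> 1"
  proof (rule ccontr)
    assume "\<not> r \<ge> 1"
    then have "E = {}" using edges by auto
    with card_E show False by simp
  qed
  let ?I = "\<lambda>n. conditional_mutual_information b
      (count_space {1..r}) (obs_space r n (m n)) (PiM {1..n} (\<lambda>_. param_space Ed))
      (X 1 k) (anonymized_obs X perm n (m n)) (params n)"
  have distance: "(\<lambda>n. path_distance_bound \<epsilon> (L n) (m n + k)) \<longlonglongrightarrow> 0" for \<epsilon>
  proof -
    have "(\<lambda>n. real (m n + k) * (1 / L n)\<^sup>2) \<longlonglongrightarrow> 0"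
      unfolding L_def using c a \<beta> m d by (intro observations_times_square_tendsto_0[where \<alpha> = \<alpha>]) (auto simp: a_def)
    from tendsto_mult_right[OF this, of "real r * (real r)\<^sup>2 / \<epsilon>"]
    have "(\<lambda>n. (m n + k) * (r * (r * (1 / L n))\<^sup>2 / \<epsilon>)) \<longlonglongrightarrow> 0"
      by (simp add: power_mult_distrib mult_ac power_divide)
    then have "(\<lambda>n. sqrt (exp ((m n + k) * (r * (r * (1 / L n))\<^sup>2 / \<epsilon>)) - 1)) \<longlonglongrightarrow> sqrt (exp 0 - 1)"
      by (intro tendsto_intros)
    then show ?thesis by (simp add: path_distance_bound_def)
  qed
  have count: "(\<lambda>n. card (cells (L n)) / n) \<longlonglongrightarrow> 0"
  proof (rule tendsto_sandwich[OF _ _ tendsto_const cell_count_tendsto_0[OF d(1) \<beta>(1)]])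
    show "\<forall>\<^sub>F n in sequentially. card (cells (L n)) / n \<le> (real n powr (1 / d - \<beta>) + 1) ^ d / real n"
      using eventually_gt_at_top[of 0]
    proof eventually_elim
      case (elim n)
      then have "L n > 0" by (simp add: L_def)
      from card_cells_le[OF this] show ?case
        by (intro divide_right_mono) (auto simp: d_def L_def a_def)
    qed
  qed auto
  have "?I \<longlonglongrightarrow> 0"
  proof (rule LIMSEQ_I)
    fix e :: real assume e: "e > 0"
    \<comment> \<open>The constants are chosen in the order \<eta>, \<open>C\<close>, \<delta>,
      \<epsilon>, all before \<open>n\<close>. With these values the final bound
      \<open>r * (\<eta> + C * (3 * \<delta>))\<close> is \<open>e / 2\<close> plus three eighths of
      \<open>e\<close>.\<close>
    define \<eta> where "\<eta> = e / (2 * r)"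
    have \<eta>: "\<eta> > 0" using e r by (simp add: \<eta>_def)
    obtain C where C: "C > 0" "\<And>x y. 0 \<le> x \<Longrightarrow> x \<le> 1 \<Longrightarrow> 0 \<le> y \<Longrightarrow> y \<le> 1 \<Longrightarrow>
        \<bar>x * log b x - y * log b y\<bar> \<le> \<eta> + C * (x - y)\<^sup>2"
      using mult_log_diff_le[OF \<eta>, of b] by blast
    define \<delta> where "\<delta> = e / (8 * r * C)"
    have \<delta>: "\<delta> > 0" using e r C(1) by (simp add: \<delta>_def)
    obtain \<epsilon> where \<epsilon>: "\<epsilon> > 0" "prob {\<omega> \<in> space M. \<not> trans_ge \<epsilon> (P 1 \<omega>)} \<le> \<delta>"
      using prob_trans_ge[OF \<delta>] by blast
    have "(\<lambda>n. 3 * path_distance_bound \<epsilon> (L n) (m n + k) + card (cells (L n)) / n / \<delta>) \<longlonglongrightarrow> 3 * 0 + 0 / \<delta>"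
      using \<delta> by (intro tendsto_intros distance count) auto
    then have "\<forall>\<^sub>F n in sequentially. 3 * path_distance_bound \<epsilon> (L n) (m n + k) + card (cells (L n)) / n / \<delta> < \<delta>"
      using \<delta> by (intro order_tendstoD(2)) auto
    moreover have "\<forall>\<^sub>F n in sequentially. n \<ge> (1::nat)" by (rule eventually_ge_at_top)
    ultimately have "\<forall>\<^sub>F n in sequentially. norm (?I n - 0) < e"
    proof eventually_elim
      case (elim n)
      then have L: "L n > 0" by (simp add: L_def)
      have "\<bar>?I n\<bar> \<le> r * (\<eta> + C * (prob {\<omega> \<in> space M. \<not> trans_ge \<epsilon> (P 1 \<omega>)}
          + 3 * path_distance_bound \<epsilon> (L n) (m n + k) + \<delta> + card (cells (L n)) / n / \<delta>))"
        by (rule conditional_mutual_information_le[OF b elim(2) r k L \<epsilon>(1) \<delta> C])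
      \<comment> \<open>One \<delta> each for the exceptional event of user 1, for the constant from
        \<open>inverse_sqrt_le\<close>, and for the two terms that tend to 0.\<close>
      also have "\<dots> \<le> r * (\<eta> + C * (3 * \<delta>))"
        using elim(1) \<epsilon>(2) C(1) by (intro mult_left_mono add_left_mono) auto
      also have "\<dots> < e"
        using e r C(1) by (simp add: \<eta>_def \<delta>_def field_simps)
      finally show ?case by simp
    qed
    then show "\<exists>n0. \<forall>n\<ge>n0. norm (?I n - 0) < e"
      by (simp add: eventually_sequentially)
  qed
  then show "(\<lambda>n. conditional_mutual_information b
      (count_space {1..r}) (obs_space r n (m n)) (PiM {1..n} (\<lambda>_. param_space Ed))
      (X 1 k) (anonymized_obs X perm n (m n)) (\<lambda>\<omega>. \<lambda>u\<in>{1..n}. P u \<omega>)) \<longlonglongrightarrow> 0"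
    by (simp only: params_def[abs_def])
qed

end
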